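(* Assume (A1)--(A3) of the context, so that $\mathcal{L}=\boldsymbol b\cdot\nabla$. Let $A>1$ and suppose the time step satisfies $\tau\le A-1$. Let $U_m$ be the Lawson--Euler solution and $\tilde U_m$ the SPM solution with $N$ particles and cell side length $h$. Then there is a constant $C_1>0$, depending on the smoothness of $U_m$ and $f_m$, such that, with $C_0=\frac{\sqrt d}{\pi}$, the error at time $t_m=m\tau\le T$ satisfies $$\mathbb{E}\left[\|U_m-\tilde U_m\|_2^2\right]\le e^{(B+1)T}\left(\mathcal{E}_f+\mathcal{E}_r(m)\right),$$ where $$\mathcal{E}_f=AC_1h^2,\qquad \mathcal{E}_r(m)=\sum_{j=0}^{m-1}\left(\frac{\mathbb{E}[Z_j^2]}{Nh^d}+C_0^2|U_j|_{H^1}^2h^2\right),$$ and $$B=\begin{cases}2AL_f^2\left(1+\frac{2}{h^2}\right), & \text{if } f \text{ depends on } \nabla u,\\ 2AL_f^2, & \text{if } f \text{ is independent of } \nabla u.\end{cases}$$ Here $L_f$ is the Lipschitz constant of $f$ from (A1) and $Z_j$ is the (random) normalization constant in the relocation step of SPM at time $t_j$.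
   Context: **Problem.** On $\mathbb{R}^d\times[0,T]$ consider the Cauchy problem $\partial_t u=\mathcal{L}u+f(t,\boldsymbol x,u,\nabla u)$, $u(\boldsymbol x,0)=u_0(\boldsymbol x)\in L^2(\mathbb{R}^d)$, where $\mathcal{L}$ is a linear operator and $f$ is the nonlinear term. $\|\cdot\|_2$ is the $L^2(\mathbb{R}^d)$ norm and $|v|_{H^1}=\|\nabla v\|_2$. **Assumptions.** (A1) There is $L_f>0$ such that for all $t\in[0,T]$, $\boldsymbol x\in\mathbb{R}^d$, $u_1,u_2\in\mathbb{R}$, $v_1,v_2\in\mathbb{R}^d$: $|f(t,\boldsymbol x,u_1,v_1)-f(t,\boldsymbol x,u_2,v_2)|\le L_f\sqrt{|u_1-u_2|^2+\|v_1-v_2\|^2}$. (A2) The exact solution $u$ is sufficiently regular and decays rapidly at infinity, and the Lawson--Euler solution $U_m$ and $f_m:=f(t_m,\boldsymbol x,U_m,\nabla U_m)$ inherit these properties (sufficient smoothness and fast decay). (A3) $\mathcal{L}=\boldsymbol b\cdot\nabla$ with a constant vector $\boldsymbol b\in\mathbb{R}^d$. Thus $e^{\tau\mathcal{L}}v(\boldsymbol x)=v(\boldsymbol x+\boldsymbol b\tau)$, and the adjoint semigroup is $e^{\tau\mathcal{L}^*}\varphi(\boldsymbol x)=\varphi(\boldsymbol x-\boldsymbol b\tau)$. **Lawson--Euler solution.** For a time step $\tau>0$ and $t_m=m\tau$: $U_0=u_0$, $U_{m+1}=e^{\tau\mathcal{L}}(U_m+\tau f_m)$. **Piecewise constant projection.**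 Let $\{Q_k\}$ be the cells of side length $h$ of a uniform cubic grid ($|Q_k|=h^d$). For a function $v$, $\mathcal{P}_hv=\sum_k\left(\frac1{|Q_k|}\int_{Q_k}v\right)\mathbf 1_{Q_k}$. For a weighted point measure $X=\frac1N\sum_iw_i\delta_{\boldsymbol x_i}$, $\mathcal{P}_hX=\sum_k\left(\frac{1}{N|Q_k|}\sum_{i:\boldsymbol x_i\in Q_k}w_i\right)\mathbf 1_{Q_k}$ (so cells without particles have value $0$). The discrete gradient $\nabla_h$ has components $\nabla_{h,j}v(\boldsymbol x)=\frac{v(\boldsymbol x+he_j)-v(\boldsymbol x-he_j)}{2h}$, with $e_j$ the $j$-th unit vector. **SPM (stochastic particle method).** A fixed number $N$ of particles with positions $\boldsymbol x_i(t_m)\in\mathbb{R}^d$ and weights $w_i(t_m)\in\mathbb{R}$ defines $X_{t_m}=\frac1N\sum_{i=1}^Nw_i(t_m)\delta_{\boldsymbol x_i(t_m)}$, and the SPM solution is $\tilde U_m=\mathcal{P}_hX_{t_m}$ for $m\ge1$; the method starts from the given datum, $\tilde U_0=u_0$. Put $\tilde f_m=f(t_m,\boldsymbol x,\tilde U_m,\nabla_h\tilde U_m)$ for $m\ge 1$ and $\tilde f_0=f(0,\boldsymbol x,u_0,\nabla u_0)$. Step $m\to m+1$, conditionally on the current particle system: (i) Relocation: draw $\tilde{\boldsymbol x}_1(t_m),\dots,\tilde{\boldsymbol x}_N(t_m)$ independently from the density $\frac{|\tilde U_m+\tau\tilde f_m|}{Z_m}$, where $Z_m=\int_{\mathbb{R}^d}|\tilde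 U_m+\tau\tilde f_m|\,d\boldsymbol x$. (ii) Weights: $w_i(t_{m+1})=Z_m\,\frac{\tilde U_m+\tau\tilde f_m}{|\tilde U_m+\tau\tilde f_m|}(\tilde{\boldsymbol x}_i(t_m))$. (iii) Motion: $\boldsymbol x_i(t_{m+1})=\tilde{\boldsymbol x}_i(t_m)-\boldsymbol b\tau$. The expectation $\mathbb{E}$ is over all random draws. **Constants.** $C_1$ is a constant not depending on $N$ or $h$. *)

theory Defs
  imports "HOL-Probability.Probability"
begin

definition grad :: "(real ^ 'd \<Rightarrow> real) \<Rightarrow> real ^ 'd \<Rightarrow> real ^ 'd" where
  "grad v x = (\<chi> j. frechet_derivative v (at x) (axis j 1))"

text \<open>Both norms occur only squared. The \<open>L\<^sup>2\<close> norm is taken with values in \<^typ>\<open>ennreal\<close>, so that it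
  is infinite, and not \<open>0\<close>, outside \<open>L\<^sup>2\<close>.\<close>

definition l2_norm_sq :: "(real ^ 'd \<Rightarrow> 'b::real_normed_vector) \<Rightarrow> ennreal" where
  "l2_norm_sq v = (\<integral>\<^sup>+ x. ennreal ((norm (v x))\<^sup>2) \<partial>lborel)"

definition h1_seminorm_sq :: "(real ^ 'd \<Rightarrow> real) \<Rightarrow> real" where
  "h1_seminorm_sq v = enn2real (l2_norm_sq (grad v))"

definition in_L2 :: "(real ^ 'd \<Rightarrow> real) \<Rightarrow> bool" where
  "in_L2 v \<longleftrightarrow> v \<in> borel_measurable lborel \<and> l2_norm_sq v < \<infinity>"

text \<open>\<open>smooth_decaying n v\<close>: \<open>v\<close> is \<open>n\<close> times continuously differentiable, and all its partial
  derivatives of order at most \<open>n\<close> decay faster than every power of \<open>1 / norm x\<close>.\<close>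

definition rapidly_decaying :: "(real ^ 'd \<Rightarrow> real) \<Rightarrow> bool" where
  "rapidly_decaying v \<longleftrightarrow> (\<forall>k::nat. bounded (range (\<lambda>x. norm x ^ k * v x)))"

primrec smooth_decaying :: "nat \<Rightarrow> (real ^ 'd \<Rightarrow> real) \<Rightarrow> bool" where
  "smooth_decaying 0 v \<longleftrightarrow> continuous_on UNIV v \<and> rapidly_decaying v"
| "smooth_decaying (Suc n) v \<longleftrightarrow>
     v differentiable_on UNIV \<and> rapidly_decaying v \<and>
     (\<forall>j. smooth_decaying n (\<lambda>x. frechet_derivative v (at x) (axis j 1)))"

definition advection :: "real ^ 'd \<Rightarrow> (real ^ 'd \<Rightarrow> real) \<Rightarrow> real ^ 'd \<Rightarrow> real" where
  "advection b v x = b \<bullet> grad v x"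

text \<open>The semigroup generated by \<^const>\<open>advection\<close>.\<close>

definition transport ::
  "real ^ 'd \<Rightarrow> real \<Rightarrow> (real ^ 'd \<Rightarrow> real) \<Rightarrow> real ^ 'd \<Rightarrow> real" where
  "transport b s v x = v (x + s *\<^sub>R b)"

type_synonym 'd nonlinearity = "real \<Rightarrow> real ^ 'd \<Rightarrow> real \<Rightarrow> real ^ 'd \<Rightarrow> real"

definition lipschitz_nonlinearity :: "real \<Rightarrow> real \<Rightarrow> 'd::finite nonlinearity \<Rightarrow> bool" where
  "lipschitz_nonlinearity T Lf f \<longleftrightarrow>
     (\<forall>t\<in>{0..T}. \<forall>x u1 u2 v1 v2.
        \<bar>f t x u1 v1 - f t x u2 v2\<bar> \<le> Lf * sqrt (\<bar>u1 - u2\<bar>\<^sup>2 + (norm (v1 - v2))\<^sup>2))"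

definition gradient_independent :: "real \<Rightarrow> 'd::finite nonlinearity \<Rightarrow> bool" where
  "gradient_independent T f \<longleftrightarrow> (\<forall>t\<in>{0..T}. \<forall>x u v1 v2. f t x u v1 = f t x u v2)"

definition source ::
  "'d::finite nonlinearity \<Rightarrow> real \<Rightarrow> (real ^ 'd \<Rightarrow> real) \<Rightarrow> real ^ 'd \<Rightarrow> real" where
  "source f t v x = f t x (v x) (grad v x)"

definition cauchy_solution ::
  "'d::finite nonlinearity \<Rightarrow> real ^ 'd \<Rightarrow> (real ^ 'd \<Rightarrow> real) \<Rightarrow> real \<Rightarrow>
   (real \<Rightarrow> real ^ 'd \<Rightarrow> real) \<Rightarrow> bool" where
  "cauchy_solution f b u0 T u \<longleftrightarrow>
     u 0 = u0 \<and>
     (\<forall>t\<in>{0..T}. \<forall>x.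
        ((\<lambda>s. u s x) has_real_derivative (advection b (u t) x + source f t (u t) x))
          (at t within {0..T}))"

primrec lawson_euler ::
  "'d::finite nonlinearity \<Rightarrow> real ^ 'd \<Rightarrow> (real ^ 'd \<Rightarrow> real) \<Rightarrow> real \<Rightarrow> nat \<Rightarrow>
   real ^ 'd \<Rightarrow> real" where
  "lawson_euler f b u0 \<tau> 0 = u0"
| "lawson_euler f b u0 \<tau> (Suc m) =
     transport b \<tau> (\<lambda>x. lawson_euler f b u0 \<tau> m x
                         + \<tau> * source f (real m * \<tau>) (lawson_euler f b u0 \<tau> m) x)"

text \<open>The grid point \<open>a\<close> fixes the position of the grid; half-open cells partition the space.\<close>

definition grid_cell :: "real ^ 'd \<Rightarrow> real \<Rightarrow> int ^ 'd \<Rightarrow> (real ^ 'd) set" where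
  "grid_cell a h k =
     {x. \<forall>j. a $ j + h * of_int (k $ j) \<le> x $ j \<and> x $ j < a $ j + h * of_int (k $ j + 1)}"

text \<open>The particle \<open>i < N\<close> has position \<open>fst (p i)\<close> and weight \<open>snd (p i)\<close>. At each point \<open>x\<close>
  exactly one summand of the sum over cells can be nonzero.\<close>

definition particle_projection ::
  "nat \<Rightarrow> real ^ 'd \<Rightarrow> real \<Rightarrow> (nat \<Rightarrow> (real ^ 'd) \<times> real) \<Rightarrow> real ^ 'd \<Rightarrow> real" where
  "particle_projection N a h p x =
     (\<Sum>\<^sub>\<infinity>k. (\<Sum>i | i < N \<and> fst (p i) \<in> grid_cell a h k. snd (p i)) / (real N * h ^ CARD('d))
             * indicator (grid_cell a h k) x)"

definition discrete_grad :: "real \<Rightarrow> (real ^ 'd \<Rightarrow> real) \<Rightarrow> real ^ 'd \<Rightarrow> real ^ 'd" where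
  "discrete_grad h v x =
     (\<chi> j. (v (x + h *\<^sub>R axis j 1) - v (x - h *\<^sub>R axis j 1)) / (2 * h))"

text \<open>The predictor is \<open>v + \<tau> f(t\<^sub>m, x, v, \<nabla>\<^sub>h v)\<close>; the first step uses the exact gradient of the
  initial datum.\<close>

definition spm_predictor ::
  "'d::finite nonlinearity \<Rightarrow> real \<Rightarrow> real \<Rightarrow> nat \<Rightarrow> (real ^ 'd \<Rightarrow> real) \<Rightarrow> real ^ 'd \<Rightarrow> real"
where
  "spm_predictor f \<tau> h m v x =
     v x + \<tau> * (if m = 0 then source f 0 v x
                 else f (real m * \<tau>) x (v x) (discrete_grad h v x))"

definition l1_mass :: "(real ^ 'd \<Rightarrow> real) \<Rightarrow> real" where
  "l1_mass V = (LINT x|lborel. \<bar>V x\<bar>)"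

definition spm_field ::
  "(real ^ 'd \<Rightarrow> real) \<Rightarrow> nat \<Rightarrow> real ^ 'd \<Rightarrow> real \<Rightarrow> nat \<Rightarrow> (nat \<Rightarrow> (real ^ 'd) \<times> real) \<Rightarrow>
   real ^ 'd \<Rightarrow> real" where
  "spm_field u0 N a h m p = (if m = 0 then u0 else particle_projection N a h p)"

text \<open>The particle system as a function of the relocated positions: \<open>y m i\<close> is the position drawn
  for particle \<open>i\<close> in the step from \<open>m\<close> to \<open>m + 1\<close>. There are no particles at time \<open>0\<close>; the
  value there is a placeholder.\<close>

primrec spm_particles ::
  "'d::finite nonlinearity \<Rightarrow> real ^ 'd \<Rightarrow> (real ^ 'd \<Rightarrow> real) \<Rightarrow> real \<Rightarrow> nat \<Rightarrow> real ^ 'd \<Rightarrow> real \<Rightarrow>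
   (nat \<Rightarrow> nat \<Rightarrow> real ^ 'd) \<Rightarrow> nat \<Rightarrow> nat \<Rightarrow> (real ^ 'd) \<times> real" where
  "spm_particles f b u0 \<tau> N a h y 0 = (\<lambda>i. (0, 0))"
| "spm_particles f b u0 \<tau> N a h y (Suc m) =
     (let V = spm_predictor f \<tau> h m
                (spm_field u0 N a h m (spm_particles f b u0 \<tau> N a h y m))
      in (\<lambda>i. (y m i - \<tau> *\<^sub>R b, l1_mass V * (V (y m i) / \<bar>V (y m i)\<bar>))))"

definition spm_solution ::
  "'d::finite nonlinearity \<Rightarrow> real ^ 'd \<Rightarrow> (real ^ 'd \<Rightarrow> real) \<Rightarrow> real \<Rightarrow> nat \<Rightarrow> real ^ 'd \<Rightarrow> real \<Rightarrow>
   (nat \<Rightarrow> nat \<Rightarrow> real ^ 'd) \<Rightarrow> nat \<Rightarrow> real ^ 'd \<Rightarrow> real" where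
  "spm_solution f b u0 \<tau> N a h y m =
     spm_field u0 N a h m (spm_particles f b u0 \<tau> N a h y m)"

definition spm_density ::
  "'d::finite nonlinearity \<Rightarrow> real ^ 'd \<Rightarrow> (real ^ 'd \<Rightarrow> real) \<Rightarrow> real \<Rightarrow> nat \<Rightarrow> real ^ 'd \<Rightarrow> real \<Rightarrow>
   (nat \<Rightarrow> nat \<Rightarrow> real ^ 'd) \<Rightarrow> nat \<Rightarrow> real ^ 'd \<Rightarrow> real" where
  "spm_density f b u0 \<tau> N a h y m x =
     \<bar>spm_predictor f \<tau> h m (spm_solution f b u0 \<tau> N a h y m) x\<bar>"

definition spm_Z ::
  "'d::finite nonlinearity \<Rightarrow> real ^ 'd \<Rightarrow> (real ^ 'd \<Rightarrow> real) \<Rightarrow> real \<Rightarrow> nat \<Rightarrow> real ^ 'd \<Rightarrow> real \<Rightarrow>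
   (nat \<Rightarrow> nat \<Rightarrow> real ^ 'd) \<Rightarrow> nat \<Rightarrow> real" where
  "spm_Z f b u0 \<tau> N a h y m =
     l1_mass (spm_predictor f \<tau> h m (spm_solution f b u0 \<tau> N a h y m))"

definition particle_algebra ::
  "'d::finite nonlinearity \<Rightarrow> real ^ 'd \<Rightarrow> (real ^ 'd \<Rightarrow> real) \<Rightarrow> real \<Rightarrow> nat \<Rightarrow> real ^ 'd \<Rightarrow> real \<Rightarrow>
   'w measure \<Rightarrow> (nat \<Rightarrow> nat \<Rightarrow> 'w \<Rightarrow> real ^ 'd) \<Rightarrow> nat \<Rightarrow> 'w measure" where
  "particle_algebra f b u0 \<tau> N a h M Y m =
     vimage_algebra (space M)
       (\<lambda>\<omega>. \<lambda>i\<in>{..<N}. spm_particles f b u0 \<tau> N a h (\<lambda>j i. Y j i \<omega>) m i)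
       (Pi\<^sub>M {..<N} (\<lambda>_. borel))"

text \<open>The random positions \<open>Y m i\<close>, \<open>m < n\<close>, \<open>i < N\<close>, on the probability space \<open>M\<close> realise the
  first \<open>n\<close> steps of the method: conditionally on the particle system at step \<open>m\<close>, the positions
  \<open>Y m 0, \<dots>, Y m (N - 1)\<close> are independent with density \<open>spm_density / spm_Z\<close>. If \<open>spm_Z\<close>
  vanishes, there is no such density; then all new weights are \<open>0\<close> and the drawn positions are
  immaterial.\<close>

definition spm_draws ::
  "'d::finite nonlinearity \<Rightarrow> real ^ 'd \<Rightarrow> (real ^ 'd \<Rightarrow> real) \<Rightarrow> real \<Rightarrow> nat \<Rightarrow> real ^ 'd \<Rightarrow> real \<Rightarrow>
   nat \<Rightarrow> 'w measure \<Rightarrow> (nat \<Rightarrow> nat \<Rightarrow> 'w \<Rightarrow> real ^ 'd) \<Rightarrow> bool" where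
  "spm_draws f b u0 \<tau> N a h n M Y \<longleftrightarrow>
     prob_space M \<and>
     (\<forall>m<n. \<forall>i<N. Y m i \<in> borel_measurable M) \<and>
     (\<forall>m<n. \<forall>S. (\<forall>i<N. S i \<in> sets borel) \<longrightarrow>
        (AE \<omega> in M. spm_Z f b u0 \<tau> N a h (\<lambda>j i. Y j i \<omega>) m > 0 \<longrightarrow>
           real_cond_exp M (particle_algebra f b u0 \<tau> N a h M Y m)
             (\<lambda>\<omega>'. \<Prod>i<N. indicator (S i) (Y m i \<omega>')) \<omega> =
           (\<Prod>i<N. LINT x:S i|lborel.
              spm_density f b u0 \<tau> N a h (\<lambda>j i. Y j i \<omega>) m x /
              spm_Z f b u0 \<tau> N a h (\<lambda>j i. Y j i \<omega>) m)))"

definition growth_rate :: "real \<Rightarrow> 'd::finite nonlinearity \<Rightarrow> real \<Rightarrow> real \<Rightarrow> real \<Rightarrow> real" where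
  "growth_rate T f A Lf h =
     (if gradient_independent T f then 2 * A * Lf\<^sup>2 else 2 * A * Lf\<^sup>2 * (1 + 2 / h\<^sup>2))"

end

(*
  C1 may depend on everything except N, h, the grid and the random draws, and only the finitely many
  m \<le> T / \<tau> matter. Hence powers of 1/h cost nothing in two situations.
  By the Lipschitz condition, Z_m is bounded, deterministically, by a constant times (1 + 1/h)^m, so
  the squared error is at most K (1 + 1/h)^p. For h \<ge> 1 this is at most a constant times h^2. If f
  depends on the gradient, the factor exp (4 A Lf^2 T / h^2) contained in exp (B T) beats every power
  of 1/h, for h < 1 as well.

  There remains a gradient-independent f with h < 1, where no power of 1/h may be lost. Fix x with
  cell Q. The new field at x is an average of N conditionally independent draws whose mean is the cell
  average of the transported predictor W, so
    E (SPM(x) - U(x))^2 <= E (P_h W(x) - U(x))^2 + E (Z int_Q |W|) / (N h^(2d)).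
  After integration over x the last term becomes E Z^2 / (N h^d), because z lies in the cell of x iff
  x lies in the cell of z. The first term is split by Young's inequality, with a loss 1 + \<tau> Lf^2, into
  the propagated error (Jensen and the Lipschitz condition in u) and the projection error of the
  smooth function U, which is of order h^2. The growth per step,
    (1 + \<tau> Lf^2) (1 + \<tau> Lf)^2 <= exp (\<tau> (1 + 2 Lf^2)),
  stays below exp (\<tau> (B + 1)) because A > 1.
*)
theory Submission
  imports Defs
begin

text \<open>On the whole space a supremum bound for the gradient of U gives no finite L2 projection
  error. Every estimate for U therefore carries one integrable weight whose values at nearby points
  are comparable; the comparison constant is uniform over cells of side at most 1.

  The obstacle in the variance estimate is the form of the hypothesis on the draws: it concerns
  products of fixed sets, only where Z_m > 0, whereas the sign in a particle weight couples the draw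
  with the random predictor. Multiplied by Z_m for one draw and by Z_m^2 for two, the conditional
  laws become identities without quotients between finite measures on product spaces, and these are
  determined by rectangles. One and two draws suffice, because the second moment of a sum involves
  only pairs.

  The Young parameter \<tau> Lf^2 is proportional to \<tau>, so its loss compounds to a fixed
  exponential over [0, T]; its reciprocal multiplies only terms of order h^2 and is absorbed by C1.
  The 1 in B + 1 pays for 2 \<tau> Lf \<le> \<tau> (1 + Lf^2).\<close>

section \<open>An integrable weight for rapidly decaying functions\<close>

text \<open>A product over the coordinates, and not a power of \<open>norm x\<close>, so that its
  integral factorizes into one-dimensional integrals of 1 / (1 + s^2).\<close>

definition decay_weight :: "'a::euclidean_space \<Rightarrow> real" where
  "decay_weight x = (\<Prod>b\<in>Basis. inverse (1 + (x \<bullet> b)\<^sup>2))"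

lemma decay_weight_pos: "decay_weight x > 0"
  unfolding decay_weight_def by (intro prod_pos) (simp add: add_pos_nonneg)

lemma decay_weight_le_1: "decay_weight x \<le> 1"
  unfolding decay_weight_def
  by (intro prod_le_1) (auto simp: divide_simps add_nonneg_pos add_pos_nonneg)

lemma measurable_decay_weight [measurable]: "decay_weight \<in> borel_measurable borel"
  unfolding decay_weight_def by measurable

lemma integrable_decay_weight: "integrable lborel (decay_weight :: 'a::euclidean_space \<Rightarrow> real)"
proof (rule integrableI_nonneg)
  have "integrable lborel (\<lambda>x::real. inverse (1 + x\<^sup>2))"
    using integrable_inverse_1_plus_square by (simp add: set_integrable_def)
  then have *: "(\<integral>\<^sup>+x. ennreal (inverse (1 + x\<^sup>2)) \<partial>lborel) < \<infinity>"
    by (subst (asm) integrable_iff_bounded) (simp add: add_nonneg_nonneg)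
  have "(\<integral>\<^sup>+x. ennreal (decay_weight (x::'a)) \<partial>lborel)
      = (\<integral>\<^sup>+x. (\<Prod>b\<in>Basis. (\<lambda>s. ennreal (inverse (1 + s\<^sup>2))) ((x::'a) \<bullet> b)) \<partial>lborel)"
    unfolding decay_weight_def by (simp add: prod_ennreal add_nonneg_nonneg)
  also have "\<dots> = (\<Prod>b\<in>(Basis::'a set). \<integral>\<^sup>+x. ennreal (inverse (1 + x\<^sup>2)) \<partial>lborel)"
    by (rule nn_integral_lborel_prod) auto
  also have "\<dots> < \<infinity>"
    using * by (simp add: power_less_top_ennreal)
  finally show "(\<integral>\<^sup>+x. ennreal (decay_weight (x::'a)) \<partial>lborel) < \<infinity>" .
qed (auto intro: less_imp_le decay_weight_pos)

text \<open>In each coordinate, x_b^2 \<le> 2 z_b^2 + 2 r^2 gives 1 + x_b^2 \<le> 2 (1 + r^2) (1 +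
  z_b^2), and the factors multiply. The lemma moves a bound from the points of a ball to its
  centre.\<close>

lemma decay_weight_shift:
  fixes x z :: "'a::euclidean_space"
  assumes "norm (z - x) \<le> r"
  shows "decay_weight z \<le> (2 * (1 + r\<^sup>2)) ^ DIM('a) * decay_weight x"
proof -
  have "decay_weight z \<le> (\<Prod>b\<in>(Basis::'a set). (2 * (1 + r\<^sup>2)) * inverse (1 + (x \<bullet> b)\<^sup>2))"
    unfolding decay_weight_def
  proof (intro prod_mono conjI)
    fix b :: 'a assume b: "b \<in> Basis"
    have "\<bar>(z - x) \<bullet> b\<bar> \<le> r"
      using Basis_le_norm[OF b, of "z - x"] assms by linarith
    then have "((x - z) \<bullet> b)\<^sup>2 \<le> r\<^sup>2"
      by (intro abs_le_square_iff[THEN iffD1]) (auto simp: inner_diff_left)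
    moreover have "(x \<bullet> b)\<^sup>2 \<le> 2 * (z \<bullet> b)\<^sup>2 + 2 * ((x - z) \<bullet> b)\<^sup>2"
      using sum_squares_bound[of "z \<bullet> b" "(x - z) \<bullet> b"]
      by (simp add: inner_diff_left power2_eq_square algebra_simps)
    moreover have "0 \<le> r\<^sup>2 * (z \<bullet> b)\<^sup>2" by simp
    moreover have "x \<bullet> b - z \<bullet> b = (x - z) \<bullet> b" by (simp add: inner_diff_left)
    ultimately have "1 + (x \<bullet> b)\<^sup>2 \<le> (2 * (1 + r\<^sup>2)) * (1 + (z \<bullet> b)\<^sup>2)"
      by (simp only: distrib_left distrib_right)
    then show "inverse (1 + (z \<bullet> b)\<^sup>2) \<le> 2 * (1 + r\<^sup>2) * inverse (1 + (x \<bullet> b)\<^sup>2)"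
      by (simp add: divide_simps add_pos_nonneg)
  qed (simp add: add_nonneg_nonneg)
  then show ?thesis
    by (simp add: prod.distrib decay_weight_def)
qed

text \<open>The reciprocal of the weight is at most (1 + |x|^2)^n \<le> 2^n (1 + |x|^(2n)) with n
  the dimension, so the decay conditions with exponents 0 and 2n suffice; \<open>B0\<close> and
  \<open>B1\<close> are their bounds.\<close>

lemma rapidly_decaying_le_decay_weight:
  fixes v :: "real ^ 'd \<Rightarrow> real"
  assumes "rapidly_decaying v"
  obtains K where "K \<ge> 0" "\<And>x. \<bar>v x\<bar> \<le> K * decay_weight x"
proof -
  define n where "n = DIM(real ^ 'd)"
  obtain B0 where B0: "\<And>x. norm (norm x ^ 0 * v x) \<le> B0"
    using assms unfolding rapidly_decaying_def bounded_iff by blast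
  obtain B1 where B1: "\<And>x. norm (norm x ^ (2 * n) * v x) \<le> B1"
    using assms unfolding rapidly_decaying_def bounded_iff by blast
  have "\<bar>v x\<bar> \<le> 2 ^ n * (B0 + B1) * decay_weight x" for x
  proof -
    have "(\<Prod>b\<in>(Basis::(real^'d) set). 1 + (x \<bullet> b)\<^sup>2) \<le> (\<Prod>b\<in>(Basis::(real^'d) set). 1 + (norm x)\<^sup>2)"
      by (intro prod_mono) (auto intro!: abs_le_square_iff[THEN iffD1] simp: Basis_le_norm add_nonneg_nonneg)
    also have "\<dots> = (1 + (norm x)\<^sup>2) ^ n" by (simp add: n_def)
    also have "\<dots> \<le> (2 * max 1 ((norm x)\<^sup>2)) ^ n"
      by (intro power_mono) (auto simp: add_nonneg_nonneg)
    also have "\<dots> = 2 ^ n * max 1 ((norm x)\<^sup>2) ^ n" by (simp add: power_mult_distrib)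
    also have "max 1 ((norm x)\<^sup>2) ^ n \<le> 1 + norm x ^ (2 * n)"
      by (auto simp: max_def power_mult)
    finally have P: "(\<Prod>b\<in>(Basis::(real^'d) set). 1 + (x \<bullet> b)\<^sup>2) \<le> 2 ^ n * (1 + norm x ^ (2 * n))"
      by simp
    have "\<bar>v x\<bar> * (\<Prod>b\<in>(Basis::(real^'d) set). 1 + (x \<bullet> b)\<^sup>2)
        \<le> \<bar>v x\<bar> * (2 ^ n * (1 + norm x ^ (2 * n)))"
      by (intro mult_left_mono P) auto
    also have "\<dots> = 2 ^ n * (\<bar>v x\<bar> + norm x ^ (2 * n) * \<bar>v x\<bar>)" by (simp add: algebra_simps)
    also have "\<dots> \<le> 2 ^ n * (B0 + B1)"
      using B0[of x] B1[of x] by (intro mult_left_mono add_mono) (auto simp: abs_mult)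
    finally have "\<bar>v x\<bar> * (\<Prod>b\<in>(Basis::(real^'d) set). 1 + (x \<bullet> b)\<^sup>2) \<le> 2 ^ n * (B0 + B1)" .
    moreover have "(\<Prod>b\<in>(Basis::(real^'d) set). 1 + (x \<bullet> b)\<^sup>2) > 0"
      by (intro prod_pos) (simp add: add_pos_nonneg)
    moreover have "decay_weight x = inverse (\<Prod>b\<in>Basis. 1 + (x \<bullet> b)\<^sup>2)"
      unfolding decay_weight_def by (simp add: prod_inversef[symmetric] o_def)
    ultimately show ?thesis
      by (simp add: field_simps)
  qed
  moreover have "B0 \<ge> 0" "B1 \<ge> 0" using B0[of 0] B1[of 0] norm_ge_zero order_trans by blast+
  ultimately show ?thesis using that[of "2 ^ n * (B0 + B1)"] by simp
qed

lemma smooth_decaying_imp: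
  assumes "smooth_decaying n v"
  shows "rapidly_decaying v" "continuous_on UNIV v"
  using assms by (cases n; auto intro: differentiable_imp_continuous_on)+

lemma smooth_decaying_bound:
  fixes v :: "real ^ 'd \<Rightarrow> real"
  assumes "smooth_decaying n v"
  obtains K where "K \<ge> 0" "\<And>x. \<bar>v x\<bar> \<le> K * decay_weight x"
  using rapidly_decaying_le_decay_weight smooth_decaying_imp(1)[OF assms] by blast

lemma smooth_decaying_partials_bound:
  fixes v :: "real ^ 'd \<Rightarrow> real"
  assumes "smooth_decaying (Suc n) v"
  obtains K where "K \<ge> 0"
    "\<And>x. (\<Sum>j\<in>UNIV. \<bar>frechet_derivative v (at x) (axis j 1)\<bar>) \<le> K * decay_weight x"
proof -
  have "\<forall>j. \<exists>K\<ge>0. \<forall>x. \<bar>frechet_derivative v (at x) (axis j 1)\<bar> \<le> K * decay_weight x"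
    using assms by (metis smooth_decaying_bound smooth_decaying.simps(2))
  then obtain K where K: "\<And>j. K j \<ge> 0"
      "\<And>j x. \<bar>frechet_derivative v (at x) (axis j 1)\<bar> \<le> K j * decay_weight x"
    by metis
  show ?thesis
    by (rule that[of "\<Sum>j\<in>UNIV. K j"]) (auto simp: sum_nonneg K sum_distrib_right intro!: sum_mono)
qed

lemma norm_grad_le:
  "norm (grad v x) \<le> (\<Sum>j\<in>UNIV. \<bar>frechet_derivative v (at x) (axis j 1)\<bar>)"
  using norm_le_l1_cart[of "grad v x"] by (simp add: grad_def)

text \<open>Mean value inequality on the ball around x through z. The partial derivatives at a point
  y of this ball are controlled by the weight at y, and \<open>decay_weight_shift\<close> replaces
  it by the weight at x. The bound is thus integrable in x, as the projection error over all cells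
  requires.\<close>

lemma smooth_decaying_increment_bound:
  fixes v :: "real ^ 'd \<Rightarrow> real"
  assumes "smooth_decaying (Suc n) v"
  obtains K where "K \<ge> 0"
    "\<And>x z. norm (z - x) \<le> r \<Longrightarrow> \<bar>v z - v x\<bar> \<le> K * norm (z - x) * decay_weight x"
proof -
  obtain K where K: "K \<ge> 0"
    "\<And>x. (\<Sum>j\<in>UNIV. \<bar>frechet_derivative v (at x) (axis j 1)\<bar>) \<le> K * decay_weight x"
    using smooth_decaying_partials_bound[OF assms] by blast
  let ?c = "(2 * (1 + r\<^sup>2)) ^ DIM(real ^ 'd)"
  have D: "(v has_derivative frechet_derivative v (at x)) (at x)" for x
    using assms by (simp add: frechet_derivative_works[symmetric] differentiable_on_def)
  have "\<bar>v z - v x\<bar> \<le> K * ?c * norm (z - x) * decay_weight x" if zx: "norm (z - x) \<le> r" for x z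
  proof -
    have "norm (v z - v x) \<le> (K * ?c * decay_weight x) * norm (z - x)"
    proof (rule differentiable_bound[where S = "cball x (norm (z - x))"])
      fix y assume y: "y \<in> cball x (norm (z - x))"
      show "(v has_derivative frechet_derivative v (at y)) (at y within cball x (norm (z - x)))"
        using D by (rule has_derivative_at_withinI)
      have lin: "linear (frechet_derivative v (at y))"
        using D[of y] has_derivative_linear by blast
      have "norm (frechet_derivative v (at y) w) \<le> K * ?c * decay_weight x * norm w" for w
      proof -
        \<comment> \<open>The derivative is controlled only in the coordinate directions; linearity
          extends the bound to all directions.\<close>
        have "w = (\<Sum>j\<in>UNIV. w $ j *\<^sub>R axis j 1)"
          by (simp add: basis_expansion flip: scalar_mult_eq_scaleR)
        then have "frechet_derivative v (at y) w
            = frechet_derivative v (at y) (\<Sum>j\<in>UNIV. w $ j *\<^sub>R axis j 1)" by simp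
        also have "\<dots> = (\<Sum>j\<in>UNIV. w $ j * frechet_derivative v (at y) (axis j 1))"
          by (simp add: linear_sum[OF lin] linear_scale[OF lin])
        also have "norm \<dots> \<le> (\<Sum>j\<in>UNIV. norm w * \<bar>frechet_derivative v (at y) (axis j 1)\<bar>)"
          by (intro order_trans[OF norm_sum] sum_mono)
            (auto simp: abs_mult intro!: mult_right_mono component_le_norm_cart)
        also have "\<dots> \<le> norm w * (K * decay_weight y)"
          using K(2)[of y] by (auto simp: sum_distrib_left[symmetric] intro!: mult_left_mono)
        also have "\<dots> \<le> norm w * (K * (?c * decay_weight x))"
        proof -
          have "norm (y - x) \<le> r" using y zx by (simp add: dist_norm norm_minus_commute)
          from decay_weight_shift[OF this] show ?thesis
            using K(1) by (intro mult_left_mono) auto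
        qed
        finally show ?thesis by (simp add: mult_ac)
      qed
      then show "onorm (frechet_derivative v (at y)) \<le> K * ?c * decay_weight x"
        by (intro onorm_bound) (auto intro!: mult_nonneg_nonneg K less_imp_le[OF decay_weight_pos] add_nonneg_nonneg)
    qed (auto simp: dist_norm norm_minus_commute)
    then show ?thesis by (simp add: mult_ac)
  qed
  then show ?thesis using K(1) that[of "K * ?c"] by simp
qed

section \<open>Cells and the particle projection\<close>

definition cell_index :: "real ^ 'd \<Rightarrow> real \<Rightarrow> real ^ 'd \<Rightarrow> int ^ 'd" where
  "cell_index a h x = (\<chi> j. \<lfloor>(x $ j - a $ j) / h\<rfloor>)"

abbreviation cell_of :: "real ^ 'd \<Rightarrow> real \<Rightarrow> real ^ 'd \<Rightarrow> (real ^ 'd) set" where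
  "cell_of a h x \<equiv> grid_cell a h (cell_index a h x)"

lemma mem_grid_cell_iff: "h > 0 \<Longrightarrow> x \<in> grid_cell a h k \<longleftrightarrow> cell_index a h x = k"
  by (auto simp: grid_cell_def cell_index_def vec_eq_iff floor_eq_iff field_simps)

text \<open>In this form the indicator is visibly symmetric in x and z and jointly measurable,
  because the labels are countably many. The measurability and Fubini arguments for cells rewrite
  with it.\<close>

lemma indicator_cell_of:
  "h > 0 \<Longrightarrow> indicator (cell_of a h x) z
    = (if cell_index a h x = cell_index a h z then 1 else 0 :: 'b::zero_neq_one)"
  by (auto simp: mem_grid_cell_iff)

lemma measurable_cell_index [measurable]:
  fixes a :: "real ^ 'd"
  shows "cell_index a h \<in> borel \<rightarrow>\<^sub>M count_space UNIV"
proof (rule measurable_count_space_eq_countable[THEN iffD2, OF _ conjI])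
  show "countable (UNIV :: (int ^ 'd) set)" by simp
next
  show "cell_index a h \<in> space borel \<rightarrow> UNIV" by simp
next
  have "cell_index a h -` {k} = (\<Inter>j\<in>UNIV. {x. \<lfloor>(x $ j - a $ j) / h\<rfloor> = k $ j})" for k
    by (auto simp: cell_index_def vec_eq_iff)
  moreover have "{x. \<lfloor>(x $ j - a $ j) / h\<rfloor> = k $ j} \<in> sets borel" for k :: "int ^ 'd" and j :: 'd
  proof -
    have "Measurable.pred borel (\<lambda>x::real^'d. \<lfloor>(x $ j - a $ j) / h\<rfloor> = k $ j)" by measurable
    then show ?thesis by (simp add: pred_def)
  qed
  ultimately show "\<forall>k\<in>UNIV. cell_index a h -` {k} \<inter> space borel \<in> sets borel"
    by (auto intro!: sets.finite_INT)
qed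

lemma sets_grid_cell [measurable]: "h > 0 \<Longrightarrow> grid_cell a h k \<in> sets borel"
proof -
  assume "h > 0"
  then have "grid_cell a h k = cell_index a h -` {k} \<inter> space borel" by (auto simp: mem_grid_cell_iff)
  also have "\<dots> \<in> sets borel" by (rule measurable_sets[OF measurable_cell_index]) auto
  finally show ?thesis .
qed

text \<open>The indicator of a half-open cell factorizes over the coordinates, so the volume is a
  product of interval lengths.\<close>

lemma emeasure_grid_cell:
  fixes a :: "real ^ 'd"
  assumes "h > 0"
  shows "emeasure lborel (grid_cell a h k) = ennreal (h ^ CARD('d))"
proof -
  define l :: "real ^ 'd" where "l = (\<chi> j. a $ j + h * of_int (k $ j))"
  have *: "indicator (grid_cell a h k) x
      = (\<Prod>b\<in>Basis. (\<lambda>b s. indicator {l \<bullet> b ..< l \<bullet> b + h} s :: ennreal) b (x \<bullet> b))" for x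
  proof -
    have iff: "x \<in> grid_cell a h k \<longleftrightarrow> (\<forall>b\<in>Basis. x \<bullet> b \<in> {l \<bullet> b ..< l \<bullet> b + h})"
      by (auto simp: grid_cell_def Basis_vec_def inner_axis l_def algebra_simps)
    show ?thesis
    proof (cases "x \<in> grid_cell a h k")
      case True
      with iff show ?thesis by (intro trans[OF _ prod.neutral[symmetric]]) auto
    next
      case False
      with iff obtain c where "c \<in> Basis" "x \<bullet> c \<notin> {l \<bullet> c ..< l \<bullet> c + h}" by blast
      with False show ?thesis by (subst prod_zero) (auto intro!: bexI[of _ c])
    qed
  qed
  have "emeasure lborel (grid_cell a h k) = (\<integral>\<^sup>+x. indicator (grid_cell a h k) x \<partial>lborel)"
    using assms by simp
  also have "\<dots> = (\<Prod>b\<in>(Basis::(real^'d) set). \<integral>\<^sup>+s. indicator {l \<bullet> b ..< l \<bullet> b + h} s \<partial>lborel)"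
    unfolding * by (rule nn_integral_lborel_prod) auto
  also have "\<dots> = ennreal (h ^ CARD('d))"
    using assms by (simp add: ennreal_power)
  finally show ?thesis .
qed

text \<open>The estimate passes through the l1 norm, hence d and not sqrt d; the difference only
  affects the constant in front of h^2.\<close>

lemma norm_diff_cell_of:
  fixes a :: "real ^ 'd"
  assumes "h > 0" "z \<in> cell_of a h x"
  shows "norm (z - x) \<le> real CARD('d) * h"
proof -
  have "\<bar>(z - x) $ j\<bar> \<le> h" for j
  proof -
    have "x \<in> cell_of a h x" using assms by (simp add: mem_grid_cell_iff)
    with assms(2) show ?thesis unfolding grid_cell_def
      by (auto simp: algebra_simps dest!: spec[of _ j])
  qed
  then have "(\<Sum>j\<in>UNIV. \<bar>(z - x) $ j\<bar>) \<le> (\<Sum>j\<in>(UNIV::'d set). h)" by (intro sum_mono) auto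
  then show ?thesis using norm_le_l1_cart[of "z - x"] by simp
qed

text \<open>In the infinite sum over cells only the cell of x survives. What remains is a finite sum
  over particles, to which expectations can be applied term by term.\<close>

lemma particle_projection_eq:
  fixes a :: "real ^ 'd"
  assumes "h > 0"
  shows "particle_projection N a h p x =
    (\<Sum>i<N. snd (p i) * indicator (cell_of a h x) (fst (p i))) / (real N * h ^ CARD('d))"
proof -
  let ?k = "cell_index a h x"
  let ?g = "\<lambda>k. (\<Sum>i | i < N \<and> fst (p i) \<in> grid_cell a h k. snd (p i)) / (real N * h ^ CARD('d))"
  have "particle_projection N a h p x = (\<Sum>\<^sub>\<infinity>k\<in>{?k}. ?g k * indicator (grid_cell a h k) x)"
    unfolding particle_projection_def
    by (rule infsum_cong_neutral) (auto simp: indicator_def mem_grid_cell_iff[OF assms])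
  also have "\<dots> = ?g ?k" using assms by (simp add: mem_grid_cell_iff)
  also have "(\<Sum>i | i < N \<and> fst (p i) \<in> cell_of a h x. snd (p i))
      = (\<Sum>i<N. snd (p i) * indicator (cell_of a h x) (fst (p i)))"
    by (rule sum.mono_neutral_cong_left) auto
  finally show ?thesis .
qed

text \<open>After exchanging the integrals, each z is counted with the volume of the set of x that
  share its cell, which is the cell of z itself.\<close>

lemma cell_average_nn_integral:
  fixes a :: "real ^ 'd" and g :: "real ^ 'd \<Rightarrow> ennreal"
  assumes [measurable]: "g \<in> borel_measurable borel" and h: "h > 0"
  shows "(\<integral>\<^sup>+x. (\<integral>\<^sup>+z. g z * indicator (cell_of a h x) z \<partial>lborel) \<partial>lborel)
    = ennreal (h ^ CARD('d)) * (\<integral>\<^sup>+z. g z \<partial>lborel)"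
proof -
  have [measurable]: "Measurable.pred (borel \<Otimes>\<^sub>M borel) (\<lambda>(x, z). cell_index a h x = cell_index a h z)"
    by measurable
  note eq = indicator_cell_of[OF h, of a]
  have "(\<integral>\<^sup>+x. (\<integral>\<^sup>+z. g z * indicator (cell_of a h x) z \<partial>lborel) \<partial>lborel)
      = (\<integral>\<^sup>+z. (\<integral>\<^sup>+x. g z * indicator (cell_of a h x) z \<partial>lborel) \<partial>lborel)"
    unfolding eq by (rule lborel_pair.Fubini') measurable
  also have "\<dots> = (\<integral>\<^sup>+z. (\<integral>\<^sup>+x. g z * indicator (cell_of a h z) x \<partial>lborel) \<partial>lborel)"
    by (intro nn_integral_cong) (simp add: eq eq_commute)
  also have "\<dots> = (\<integral>\<^sup>+z. g z * ennreal (h ^ CARD('d)) \<partial>lborel)"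
    using h by (simp add: nn_integral_cmult emeasure_grid_cell)
  finally show ?thesis by (simp add: nn_integral_multc mult.commute)
qed

section \<open>Translation invariance, masses and integrals of weighted bounds\<close>

lemma nn_integral_lborel_translation:
  fixes c :: "'a::euclidean_space"
  assumes [measurable]: "g \<in> borel_measurable borel"
  shows "(\<integral>\<^sup>+x. g (x + c) \<partial>lborel) = (\<integral>\<^sup>+x. g x \<partial>lborel)"
proof -
  have "(\<integral>\<^sup>+x. g x \<partial>lborel) = (\<integral>\<^sup>+x. g x \<partial>distr lborel borel ((+) c))"
    by (simp add: lborel_distr_plus)
  also have "\<dots> = (\<integral>\<^sup>+x. g (x + c) \<partial>lborel)"
    by (subst nn_integral_distr) (auto simp: add.commute)
  finally show ?thesis by simp
qed

lemma l1_mass_nonneg: "0 \<le> l1_mass V"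
  unfolding l1_mass_def by (rule Bochner_Integration.integral_nonneg) auto

text \<open>If the integral that defines \<open>l1_mass\<close> does not exist, its value is the
  default 0 and the bound holds as well; thus an estimate of the nonnegative integral is
  enough.\<close>

lemma l1_mass_le:
  assumes "(\<integral>\<^sup>+x. ennreal \<bar>V x\<bar> \<partial>lborel) \<le> ennreal c" "0 \<le> c"
  shows "l1_mass V \<le> c"
proof (cases "integrable lborel (\<lambda>x. \<bar>V x\<bar>)")
  case True
  then have "ennreal (l1_mass V) = (\<integral>\<^sup>+x. ennreal \<bar>V x\<bar> \<partial>lborel)"
    unfolding l1_mass_def by (intro nn_integral_eq_integral[symmetric]) auto
  with assms show ?thesis by (metis ennreal_le_iff)
next
  case False
  then show ?thesis using assms by (simp add: l1_mass_def not_integrable_integral_eq)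
qed

lemma nn_integral_decay_weight_le:
  fixes v :: "'a::euclidean_space \<Rightarrow> real"
  assumes "\<And>x. \<bar>v x\<bar> \<le> K * decay_weight x" "K \<ge> 0"
  shows "(\<integral>\<^sup>+x. ennreal \<bar>v x\<bar> \<partial>lborel) \<le> ennreal (K * (LINT x|lborel. decay_weight (x::'a)))"
proof -
  have "(\<integral>\<^sup>+x. ennreal \<bar>v x\<bar> \<partial>lborel) \<le> (\<integral>\<^sup>+x. ennreal (K * decay_weight (x::'a)) \<partial>lborel)"
    using assms by (intro nn_integral_mono ennreal_leI) auto
  also have "\<dots> = ennreal (LINT x|lborel. K * decay_weight (x::'a))"
    using integrable_decay_weight assms(2)
    by (intro nn_integral_eq_integral) (auto intro: mult_nonneg_nonneg less_imp_le decay_weight_pos)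
  finally show ?thesis by simp
qed

text \<open>Since the weight is at most 1, its square is bounded by the weight itself and the L1
  estimate applies to the square of v.\<close>

lemma nn_integral_square_decay_weight_le:
  fixes v :: "'a::euclidean_space \<Rightarrow> real"
  assumes "\<And>x. \<bar>v x\<bar> \<le> K * decay_weight x" "K \<ge> 0"
  shows "(\<integral>\<^sup>+x. ennreal ((v x)\<^sup>2) \<partial>lborel) \<le> ennreal (K\<^sup>2 * (LINT x|lborel. decay_weight (x::'a)))"
proof -
  have "\<bar>(v x)\<^sup>2\<bar> \<le> K\<^sup>2 * decay_weight x" for x
  proof -
    have "(v x)\<^sup>2 \<le> (K * decay_weight x)\<^sup>2"
      using assms(1)[of x] by (metis abs_ge_zero power2_abs power_mono)
    also have "\<dots> \<le> K\<^sup>2 * decay_weight x"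
      using decay_weight_le_1[of x] decay_weight_pos[of x]
      by (auto simp: power_mult_distrib power2_eq_square[of "decay_weight x"] intro!: mult_left_mono mult_left_le)
    finally show ?thesis by simp
  qed
  from nn_integral_decay_weight_le[OF this] show ?thesis by simp
qed

lemma lborel_integral_decay_weight_nonneg: "0 \<le> (LINT x|lborel. decay_weight (x::'a::euclidean_space))"
  by (rule Bochner_Integration.integral_nonneg) (simp add: less_imp_le decay_weight_pos)

section \<open>Norms of the particle field and of its discrete gradient\<close>

lemma measurable_particle_projection [measurable]:
  assumes "h > 0"
  shows "particle_projection N a h p \<in> borel_measurable borel"
proof -
  note eq = indicator_cell_of[OF assms, of a]
  have "particle_projection N a h p = (\<lambda>x.
    (\<Sum>i<N. snd (p i) * (if cell_index a h x = cell_index a h (fst (p i)) then 1 else 0))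
      / (real N * h ^ CARD('a)))"
    by (rule ext) (simp add: particle_projection_eq[OF assms] eq)
  also have "\<dots> \<in> borel_measurable borel" by measurable
  finally show ?thesis .
qed

text \<open>Each particle contributes at most Z / (N h^d), and only on its own cell of volume h^d.
  Adding N such terms gives the supremum bound Z / h^d and the mass bound Z; the product of the two
  bounds the integral of the square.\<close>

lemma particle_projection_bounds:
  fixes a :: "real ^ 'd"
  assumes h: "h > 0" and N: "N \<ge> 1" and w: "\<And>i. i < N \<Longrightarrow> \<bar>snd (p i)\<bar> \<le> Z"
  shows "\<bar>particle_projection N a h p x\<bar> \<le> Z / h ^ CARD('d)"
    and "(\<integral>\<^sup>+x. ennreal \<bar>particle_projection N a h p x\<bar> \<partial>lborel) \<le> ennreal Z"
    and "(\<integral>\<^sup>+x. ennreal ((particle_projection N a h p x)\<^sup>2) \<partial>lborel) \<le> ennreal (Z\<^sup>2 / h ^ CARD('d))"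
proof -
  have Z: "Z \<ge> 0" using w[of 0] N by linarith
  have hd: "h ^ CARD('d) > 0" using h by simp
  have Np: "real N > 0" using N by simp
  have B: "\<bar>particle_projection N a h p x\<bar>
      \<le> (\<Sum>i<N. Z / (real N * h ^ CARD('d)) * indicator (cell_of a h (fst (p i))) x)" for x
  proof -
    have "\<bar>\<Sum>i<N. snd (p i) * indicator (cell_of a h x) (fst (p i))\<bar>
        \<le> (\<Sum>i<N. Z * indicator (cell_of a h (fst (p i))) x)"
      using w by (intro order_trans[OF sum_abs] sum_mono)
        (auto simp: abs_mult indicator_def mem_grid_cell_iff[OF h])
    then show ?thesis
      unfolding particle_projection_eq[OF h] sum_distrib_left[symmetric]
      using divide_right_mono[of _ _ "real N * h ^ CARD('d)"] hd Np
      by (simp add: abs_mult del: sum_mult_indicator)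
  qed
  show 1: "\<bar>particle_projection N a h p x\<bar> \<le> Z / h ^ CARD('d)" for x
  proof -
    have "(\<Sum>i<N. Z / (real N * h ^ CARD('d)) * indicator (cell_of a h (fst (p i))) x)
        \<le> (\<Sum>i<N. Z / (real N * h ^ CARD('d)))"
      using Z hd Np by (intro sum_mono) (auto simp: indicator_def)
    with B[of x] show ?thesis using Np by simp
  qed
  have "(\<integral>\<^sup>+x. ennreal \<bar>particle_projection N a h p x\<bar> \<partial>lborel)
      \<le> (\<integral>\<^sup>+x. (\<Sum>i<N. ennreal (Z / (real N * h ^ CARD('d))) * indicator (cell_of a h (fst (p i))) x) \<partial>lborel)"
  proof (intro nn_integral_mono)
    fix x :: "real ^ 'd"
    have "ennreal (\<Sum>i<N. Z / (real N * h ^ CARD('d)) * indicator (cell_of a h (fst (p i))) x)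
      = (\<Sum>i<N. ennreal (Z / (real N * h ^ CARD('d)) * indicator (cell_of a h (fst (p i))) x))"
      using Z hd Np by (intro sum_ennreal[symmetric]) auto
    also have "\<dots> = (\<Sum>i<N. ennreal (Z / (real N * h ^ CARD('d))) * indicator (cell_of a h (fst (p i))) x)"
      by (intro sum.cong) (auto simp: indicator_def)
    finally show "ennreal \<bar>particle_projection N a h p x\<bar> \<le> \<dots>"
      using B[of x] by (metis ennreal_leI)
  qed
  also have "\<dots> = (\<Sum>i<N. ennreal (Z / (real N * h ^ CARD('d))) * ennreal (h ^ CARD('d)))"
    using h by (subst nn_integral_sum) (auto simp: nn_integral_cmult emeasure_grid_cell)
  also have "\<dots> = (\<Sum>i<N. ennreal (Z / real N))"
  proof -
    have "ennreal (Z / (real N * h ^ CARD('d))) * ennreal (h ^ CARD('d))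
        = ennreal (Z / (real N * h ^ CARD('d)) * h ^ CARD('d))"
      by (rule ennreal_mult[symmetric]) (use Z hd Np in auto)
    also have "Z / (real N * h ^ CARD('d)) * h ^ CARD('d) = Z / real N"
      using h by simp
    finally show ?thesis by (simp only:)
  qed
  also have "\<dots> = ennreal Z"
    using Z Np by (simp add: ennreal_of_nat_eq_real_of_nat ennreal_mult[symmetric])
  finally show 2: "(\<integral>\<^sup>+x. ennreal \<bar>particle_projection N a h p x\<bar> \<partial>lborel) \<le> ennreal Z" .
  have "(\<integral>\<^sup>+x. ennreal ((particle_projection N a h p x)\<^sup>2) \<partial>lborel)
    \<le> (\<integral>\<^sup>+x. ennreal (Z / h ^ CARD('d)) * ennreal \<bar>particle_projection N a h p x\<bar> \<partial>lborel)"
  proof (intro nn_integral_mono)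
    fix x :: "real ^ 'd"
    have "(particle_projection N a h p x)\<^sup>2 = \<bar>particle_projection N a h p x\<bar> * \<bar>particle_projection N a h p x\<bar>"
      by (simp add: power2_eq_square)
    also have "\<dots> \<le> Z / h ^ CARD('d) * \<bar>particle_projection N a h p x\<bar>"
      by (intro mult_right_mono 1) auto
    finally show "ennreal ((particle_projection N a h p x)\<^sup>2)
      \<le> ennreal (Z / h ^ CARD('d)) * ennreal \<bar>particle_projection N a h p x\<bar>"
      using Z hd by (subst ennreal_mult[symmetric]) (auto intro!: ennreal_leI)
  qed
  also have "\<dots> = ennreal (Z / h ^ CARD('d)) * (\<integral>\<^sup>+x. ennreal \<bar>particle_projection N a h p x\<bar> \<partial>lborel)"
    using h by (intro nn_integral_cmult) measurable
  also have "\<dots> \<le> ennreal (Z / h ^ CARD('d)) * ennreal Z" by (intro mult_left_mono 2) auto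
  also have "\<dots> = ennreal (Z\<^sup>2 / h ^ CARD('d))"
    using Z hd by (simp add: ennreal_mult[symmetric] power2_eq_square)
  finally show "(\<integral>\<^sup>+x. ennreal ((particle_projection N a h p x)\<^sup>2) \<partial>lborel) \<le> ennreal (Z\<^sup>2 / h ^ CARD('d))" .
qed

text \<open>By translation invariance each central difference has mass at most (Z + Z) / (2 h) = Z /
  h, and there are d components. A factor 1 / h is the price of taking the discrete gradient of a
  piecewise constant field.\<close>

lemma nn_integral_discrete_grad_le:
  fixes v :: "real ^ 'd \<Rightarrow> real"
  assumes [measurable]: "v \<in> borel_measurable borel" and h: "h > 0" and Z: "Z \<ge> 0"
    and v: "(\<integral>\<^sup>+x. ennreal \<bar>v x\<bar> \<partial>lborel) \<le> ennreal Z"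
  shows "(\<integral>\<^sup>+x. ennreal (norm (discrete_grad h v x)) \<partial>lborel) \<le> ennreal (real CARD('d) * Z / h)"
proof -
  have c: "1 / (2 * h) \<ge> 0" using h by simp
  have "(\<integral>\<^sup>+x. ennreal (norm (discrete_grad h v x)) \<partial>lborel)
    \<le> (\<integral>\<^sup>+x. (\<Sum>j\<in>UNIV. ennreal (1 / (2 * h)) * (ennreal \<bar>v (x + h *\<^sub>R axis j 1)\<bar>
          + ennreal \<bar>v (x + - (h *\<^sub>R axis j 1))\<bar>)) \<partial>lborel)"
  proof (intro nn_integral_mono)
    fix x :: "real ^ 'd"
    have "norm (discrete_grad h v x) \<le> (\<Sum>j\<in>UNIV. \<bar>discrete_grad h v x $ j\<bar>)" by (rule norm_le_l1_cart)
    also have "\<dots> \<le> (\<Sum>j\<in>UNIV. 1 / (2 * h) * (\<bar>v (x + h *\<^sub>R axis j 1)\<bar> + \<bar>v (x + - (h *\<^sub>R axis j 1))\<bar>))"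
      using h by (intro sum_mono) (auto simp: discrete_grad_def divide_simps)
    finally have "ennreal (norm (discrete_grad h v x))
      \<le> ennreal (\<Sum>j\<in>UNIV. 1 / (2 * h) * (\<bar>v (x + h *\<^sub>R axis j 1)\<bar> + \<bar>v (x + - (h *\<^sub>R axis j 1))\<bar>))"
      by (rule ennreal_leI)
    also have "\<dots> = (\<Sum>j\<in>UNIV. ennreal (1 / (2 * h) * (\<bar>v (x + h *\<^sub>R axis j 1)\<bar> + \<bar>v (x + - (h *\<^sub>R axis j 1))\<bar>)))"
      using h by (intro sum_ennreal[symmetric]) auto
    also have "\<dots> = (\<Sum>j\<in>UNIV. ennreal (1 / (2 * h)) * (ennreal \<bar>v (x + h *\<^sub>R axis j 1)\<bar>
          + ennreal \<bar>v (x + - (h *\<^sub>R axis j 1))\<bar>))"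
      by (intro sum.cong refl, subst ennreal_mult[OF c]) (auto simp: ennreal_plus)
    finally show "ennreal (norm (discrete_grad h v x)) \<le> \<dots>" .
  qed
  also have "\<dots> = (\<Sum>j\<in>(UNIV::'d set). ennreal (1 / (2 * h)) * ((\<integral>\<^sup>+x. ennreal \<bar>v x\<bar> \<partial>lborel) + (\<integral>\<^sup>+x. ennreal \<bar>v x\<bar> \<partial>lborel)))"
    by (subst nn_integral_sum, simp, intro sum.cong refl,
        subst nn_integral_cmult, simp, subst nn_integral_add, simp, simp,
        subst (1 2) nn_integral_lborel_translation[of "\<lambda>x. ennreal \<bar>v x\<bar>"]) simp_all
  also have "\<dots> \<le> (\<Sum>j\<in>(UNIV::'d set). ennreal (1 / (2 * h)) * (ennreal Z + ennreal Z))"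
    by (intro sum_mono mult_left_mono add_mono v) auto
  also have "\<dots> = ennreal (real CARD('d) * Z / h)"
    using Z h by (simp add: ennreal_mult[symmetric] ennreal_plus[symmetric]
        ennreal_of_nat_eq_real_of_nat del: ennreal_plus)
  finally show ?thesis .
qed

lemma measurable_discrete_grad [measurable]:
  fixes v :: "real ^ 'd \<Rightarrow> real"
  assumes [measurable]: "v \<in> borel_measurable borel"
  shows "discrete_grad h v \<in> borel_measurable borel"
proof (rule borel_measurable_euclidean_space[THEN iffD2], intro ballI)
  fix i :: "real ^ 'd" assume "i \<in> Basis"
  then obtain j where i: "i = axis j 1" by (auto simp: Basis_vec_def)
  have "(\<lambda>x. discrete_grad h v x \<bullet> i)
      = (\<lambda>x. (v (x + h *\<^sub>R axis j 1) - v (x - h *\<^sub>R axis j 1)) / (2 * h))"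
    by (simp add: i inner_axis discrete_grad_def)
  also have "\<dots> \<in> borel_measurable borel" by measurable
  finally show "(\<lambda>x. discrete_grad h v x \<bullet> i) \<in> borel_measurable borel" .
qed

text \<open>Jensen's inequality for the average over S, obtained from the Cauchy-Schwarz inequality:
  the indicator is written as its own square, and the second copy is paired with g.\<close>

lemma square_average_le:
  fixes g :: "'a::euclidean_space \<Rightarrow> real"
  assumes [measurable]: "g \<in> borel_measurable borel" "S \<in> sets borel"
    and em: "emeasure lborel S = ennreal s" and s: "s > 0"
    and int: "integrable lborel (\<lambda>y. indicator S y * g y)"
  shows "ennreal (((LINT y|lborel. indicator S y * g y) / s)\<^sup>2)
    \<le> ennreal (1 / s) * (\<integral>\<^sup>+y. ennreal ((g y)\<^sup>2) * indicator S y \<partial>lborel)"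
proof -
  let ?I = "LINT y|lborel. indicator S y * g y"
  let ?J = "\<integral>\<^sup>+y. ennreal ((g y)\<^sup>2) * indicator S y \<partial>lborel"
  have "ennreal \<bar>?I\<bar> \<le> (\<integral>\<^sup>+y. ennreal (norm (indicator S y * g y)) \<partial>lborel)"
    using integral_norm_bound_ennreal[OF int] by simp
  also have "\<dots> = (\<integral>\<^sup>+y. (ennreal \<bar>g y\<bar> * indicator S y) * indicator S y \<partial>lborel)"
    by (intro nn_integral_cong) (auto simp: abs_mult split: split_indicator)
  finally have "ennreal \<bar>?I\<bar> ^ 2 \<le> (\<integral>\<^sup>+y. (ennreal \<bar>g y\<bar> * indicator S y) * indicator S y \<partial>lborel)\<^sup>2"
    by (intro power_mono) auto
  also have "\<dots> \<le> (\<integral>\<^sup>+y. (ennreal \<bar>g y\<bar> * indicator S y)\<^sup>2 \<partial>lborel) * (\<integral>\<^sup>+y. (indicator S y)\<^sup>2 \<partial>lborel)"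
    by (rule Cauchy_Schwarz_nn_integral) measurable
  also have "(\<integral>\<^sup>+y. (indicator S y)\<^sup>2 \<partial>lborel) = (\<integral>\<^sup>+y. indicator S y \<partial>lborel)"
    by (intro nn_integral_cong) (auto split: split_indicator)
  also have "\<dots> = ennreal s" by (simp add: em)
  also have "(\<integral>\<^sup>+y. (ennreal \<bar>g y\<bar> * indicator S y)\<^sup>2 \<partial>lborel) = ?J"
    by (intro nn_integral_cong) (auto simp: ennreal_power split: split_indicator)
  finally have I: "ennreal (?I\<^sup>2) \<le> ?J * ennreal s"
    by (simp add: ennreal_power)
  have "ennreal ((?I / s)\<^sup>2) = ennreal (1 / s\<^sup>2) * ennreal (?I\<^sup>2)"
    by (simp add: ennreal_mult[symmetric] power_divide)
  also have "\<dots> \<le> ennreal (1 / s\<^sup>2) * (?J * ennreal s)" by (intro mult_left_mono I) auto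
  also have "\<dots> = (ennreal (1 / s\<^sup>2) * ennreal s) * ?J" by (simp only: mult_ac)
  also have "ennreal (1 / s\<^sup>2) * ennreal s = ennreal (1 / s)"
    using s by (subst ennreal_mult[symmetric]) (auto simp: power2_eq_square)
  finally show ?thesis .
qed

text \<open>The same counting over cells with a parameter \<omega>. The shift by c accounts for the
  motion of the particles: the cell is tested at the moved position y - c, and the shift disappears
  by translation invariance.\<close>

lemma nn_integral_cells:
  fixes a c :: "real ^ 'd" and G :: "'w \<times> (real ^ 'd) \<Rightarrow> ennreal"
  assumes "sigma_finite_measure M" and G[measurable]: "G \<in> borel_measurable (M \<Otimes>\<^sub>M borel)" and h: "h > 0"
  shows "(\<integral>\<^sup>+x. (\<integral>\<^sup>+\<omega>. (\<integral>\<^sup>+y. G (\<omega>, y) * indicator (cell_of a h x) (y - c) \<partial>lborel) \<partial>M) \<partial>lborel)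
    = ennreal (h ^ CARD('d)) * (\<integral>\<^sup>+\<omega>. (\<integral>\<^sup>+y. G (\<omega>, y) \<partial>lborel) \<partial>M)"
proof -
  interpret M: sigma_finite_measure M by fact
  interpret pair_sigma_finite M "lborel :: (real ^ 'd) measure" ..
  note eq = indicator_cell_of[OF h, of a]
  have "(\<integral>\<^sup>+x. (\<integral>\<^sup>+\<omega>. (\<integral>\<^sup>+y. G (\<omega>, y) * indicator (cell_of a h x) (y - c) \<partial>lborel) \<partial>M) \<partial>lborel)
    = (\<integral>\<^sup>+\<omega>. (\<integral>\<^sup>+x. (\<integral>\<^sup>+y. G (\<omega>, y) * indicator (cell_of a h x) (y - c) \<partial>lborel) \<partial>lborel) \<partial>M)"
    unfolding eq by (rule Fubini') measurable
  also have "\<dots> = (\<integral>\<^sup>+\<omega>. ennreal (h ^ CARD('d)) * (\<integral>\<^sup>+y. G (\<omega>, y) \<partial>lborel) \<partial>M)"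
  proof (intro nn_integral_cong)
    fix \<omega> assume "\<omega> \<in> space M"
    then have m[measurable]: "(\<lambda>y. G (\<omega>, y)) \<in> borel_measurable borel" by measurable
    have "(\<integral>\<^sup>+y. G (\<omega>, y) * indicator (cell_of a h x) (y - c) \<partial>lborel)
      = (\<integral>\<^sup>+z. G (\<omega>, z + c) * indicator (cell_of a h x) z \<partial>lborel)" for x
    proof -
      have "(\<lambda>y. G (\<omega>, y) * indicator (cell_of a h x) (y - c)) \<in> borel_measurable borel"
        unfolding eq by measurable
      from nn_integral_lborel_translation[OF this, of c] show ?thesis by simp
    qed
    then have "(\<integral>\<^sup>+x. (\<integral>\<^sup>+y. G (\<omega>, y) * indicator (cell_of a h x) (y - c) \<partial>lborel) \<partial>lborel)
      = ennreal (h ^ CARD('d)) * (\<integral>\<^sup>+z. G (\<omega>, z + c) \<partial>lborel)"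
      by (simp add: cell_average_nn_integral[OF _ h])
    then show "(\<integral>\<^sup>+x. (\<integral>\<^sup>+y. G (\<omega>, y) * indicator (cell_of a h x) (y - c) \<partial>lborel) \<partial>lborel)
      = ennreal (h ^ CARD('d)) * (\<integral>\<^sup>+y. G (\<omega>, y) \<partial>lborel)"
      using nn_integral_lborel_translation[OF m, of c] by simp
  qed
  also have "\<dots> = ennreal (h ^ CARD('d)) * (\<integral>\<^sup>+\<omega>. (\<integral>\<^sup>+y. G (\<omega>, y) \<partial>lborel) \<partial>M)"
    by (rule nn_integral_cmult) measurable
  finally show ?thesis .
qed

section \<open>Elementary inequalities\<close>

lemma young_square:
  fixes x y \<delta> :: real
  assumes "\<delta> > 0"
  shows "(x + y)\<^sup>2 \<le> (1 + \<delta>) * x\<^sup>2 + (1 + 1 / \<delta>) * y\<^sup>2"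
proof -
  have "0 \<le> (\<delta> * x - y)\<^sup>2 / \<delta>" using assms by simp
  also have "\<dots> = \<delta> * x\<^sup>2 - 2 * x * y + y\<^sup>2 / \<delta>"
    using assms by (simp add: power2_eq_square field_simps)
  finally show ?thesis by (simp add: power2_eq_square algebra_simps)
qed

lemma exp_ge_power_div_fact: "(x::real) \<ge> 0 \<Longrightarrow> x ^ n / fact n \<le> exp x"
proof -
  assume x: "x \<ge> 0"
  have "(\<Sum>k\<in>{n}. x ^ k /\<^sub>R fact k) \<le> (\<Sum>k. x ^ k /\<^sub>R fact k)"
    using x by (intro sum_le_suminf sums_summable[OF exp_converges]) auto
  also have "\<dots> = exp x" by (rule sums_unique[OF exp_converges, symmetric])
  finally show ?thesis by (simp add: divide_inverse mult.commute)
qed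

text \<open>For h \<le> 1, (1 + 1 / h)^p \<le> 2^p (1 / h^2)^p. The series of exp (c / h^2) is
  compared with its term of order p + 1, not p: the surplus factor c / h^2 is what leaves room for
  h^2 on the right.\<close>

lemma exp_beats_power:
  fixes c h K :: real
  assumes c: "c > 0" and h: "0 < h" "h \<le> 1" and K: "K \<ge> 0"
  shows "K * (1 + 1 / h) ^ p \<le> exp (c / h\<^sup>2) * (K * 2 ^ p * fact (Suc p) / c ^ Suc p * h\<^sup>2)"
proof -
  have g: "1 \<le> 1 / h" using h by simp
  have "(1 + 1 / h) ^ p \<le> (2 * (1 / h)) ^ p" using g by (intro power_mono) auto
  also have "\<dots> = 2 ^ p * (1 / h) ^ p" by (rule power_mult_distrib)
  also have "(1 / h) ^ p \<le> ((1 / h)\<^sup>2) ^ p"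
    using power_increasing[of p "2 * p" "1 / h"] g by (simp only: power_mult)
  finally have "K * (1 + 1 / h) ^ p \<le> K * (2 ^ p * ((1 / h)\<^sup>2) ^ p)"
    using K by (simp add: mult_left_mono)
  also have "\<dots> = (c / h\<^sup>2) ^ Suc p / fact (Suc p) * (K * 2 ^ p * fact (Suc p) / c ^ Suc p * h\<^sup>2)"
    using c h by (simp add: power_divide power_mult_distrib del: fact_Suc)
  also have "\<dots> \<le> exp (c / h\<^sup>2) * (K * 2 ^ p * fact (Suc p) / c ^ Suc p * h\<^sup>2)"
    using c h K by (intro mult_right_mono exp_ge_power_div_fact) auto
  finally show ?thesis .
qed

section \<open>Deterministic bounds\<close>

text \<open>Only the data on which the constants may depend are fixed here. N, h, the grid and the
  draws stay quantified inside the lemmas, which keeps the constants uniform in them.\<close>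

locale spm_problem =
  fixes f :: "'d::finite nonlinearity" and b :: "real ^ 'd" and u0 :: "real ^ 'd \<Rightarrow> real"
    and T \<tau> A Lf :: real
  assumes f_measurable: "\<And>t. t \<in> {0..T} \<Longrightarrow> (\<lambda>(x, r, v). f t x r v) \<in> borel_measurable borel"
    and Lf_pos: "Lf > 0" and lipschitz: "lipschitz_nonlinearity T Lf f"
    and smooth_U: "\<And>m. real m * \<tau> \<le> T \<Longrightarrow> smooth_decaying 2 (lawson_euler f b u0 \<tau> m)"
    and smooth_source: "\<And>m. real m * \<tau> \<le> T \<Longrightarrow>
         smooth_decaying 2 (source f (real m * \<tau>) (lawson_euler f b u0 \<tau> m))"
    and A_gt_1: "A > 1" and \<tau>_pos: "\<tau> > 0" and T_pos: "T > 0"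
begin

abbreviation "U \<equiv> lawson_euler f b u0 \<tau>"

lemma time_in: "real m * \<tau> \<le> T \<Longrightarrow> real m * \<tau> \<in> {0..T}"
  using \<tau>_pos by simp

lemma time_mono: "real m * \<tau> \<le> T \<Longrightarrow> j \<le> m \<Longrightarrow> real j * \<tau> \<le> T"
  using \<tau>_pos by (meson mult_right_mono of_nat_le_iff order_trans less_imp_le)

text \<open>The factor, up to constants, by which one step can increase the mass. The term 1 / h
  stems from the discrete gradient and is absent when f ignores its gradient argument.\<close>

definition grad_cost :: "real \<Rightarrow> real" where
  "grad_cost h = (if gradient_independent T f then 1 else 1 + 1 / h)"

lemma grad_cost_ge_1: "h > 0 \<Longrightarrow> 1 \<le> grad_cost h"
  by (simp add: grad_cost_def)

lemma lipschitz_sum: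
  assumes "t \<in> {0..T}"
  shows "\<bar>f t x r v - f t x r' v'\<bar> \<le> Lf * (\<bar>r - r'\<bar> + norm (v - v'))"
proof -
  have "\<bar>f t x r v - f t x r' v'\<bar> \<le> Lf * sqrt (\<bar>r - r'\<bar>\<^sup>2 + (norm (v - v'))\<^sup>2)"
    using lipschitz assms by (auto simp: lipschitz_nonlinearity_def)
  also have "\<dots> \<le> Lf * (\<bar>r - r'\<bar> + norm (v - v'))"
    using sqrt_sum_squares_le_sum_abs[of "\<bar>r - r'\<bar>" "norm (v - v')"] Lf_pos
    by (intro mult_left_mono) auto
  finally show ?thesis .
qed

lemma gradient_independent_lipschitz:
  assumes "gradient_independent T f" "t \<in> {0..T}"
  shows "\<bar>f t x r v - f t x r' v'\<bar> \<le> Lf * \<bar>r - r'\<bar>"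
proof -
  have "f t x r' v' = f t x r' v" using assms by (auto simp: gradient_independent_def)
  with lipschitz_sum[OF assms(2), of x r v r' v] show ?thesis by simp
qed

text \<open>The Lipschitz condition controls only differences of f. The size of f at u = 0, v = 0 is
  found by comparison with the source along the Lawson-Euler solution, where the source, U and its
  gradient all decay.\<close>

lemma f_growth:
  assumes m: "real m * \<tau> \<le> T"
  obtains K where "K \<ge> 0" "\<And>x r v. \<bar>f (real m * \<tau>) x r v\<bar> \<le> K * decay_weight x
    + Lf * (\<bar>r\<bar> + (if gradient_independent T f then 0 else norm v))"
proof -
  let ?t = "real m * \<tau>"
  obtain K1 where K1: "K1 \<ge> 0" "\<And>x. \<bar>source f ?t (U m) x\<bar> \<le> K1 * decay_weight x"
    using smooth_decaying_bound[OF smooth_source[OF m]] by metis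
  obtain K2 where K2: "K2 \<ge> 0" "\<And>x. \<bar>U m x\<bar> \<le> K2 * decay_weight x"
    using smooth_decaying_bound[OF smooth_U[OF m]] by metis
  have "smooth_decaying (Suc 1) (U m)" using smooth_U[OF m] by (simp add: numeral_2_eq_2)
  then obtain K3 where K3: "K3 \<ge> 0" "\<And>x. norm (grad (U m) x) \<le> K3 * decay_weight x"
    by (rule smooth_decaying_partials_bound) (blast intro: order_trans[OF norm_grad_le])
  have f0: "\<bar>f ?t x 0 0\<bar> \<le> (K1 + Lf * (K2 + K3)) * decay_weight x" for x
  proof -
    have "\<bar>f ?t x 0 0 - source f ?t (U m) x\<bar> \<le> Lf * (\<bar>U m x\<bar> + norm (grad (U m) x))"
      using lipschitz_sum[OF time_in[OF m], of x 0 0 "U m x" "grad (U m) x"]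
      by (simp add: source_def)
    also have "\<dots> \<le> Lf * (K2 * decay_weight x + K3 * decay_weight x)"
      using Lf_pos K2 K3 by (intro mult_left_mono add_mono) auto
    finally show ?thesis using K1(2)[of x] by (simp add: algebra_simps)
  qed
  have "\<bar>f ?t x r v\<bar> \<le> (K1 + Lf * (K2 + K3)) * decay_weight x
    + Lf * (\<bar>r\<bar> + (if gradient_independent T f then 0 else norm v))" for x r v
  proof (cases "gradient_independent T f")
    case True
    then show ?thesis
      using gradient_independent_lipschitz[OF True time_in[OF m], of x r v 0 0] f0[of x] by simp
  next
    case False
    then show ?thesis
      using lipschitz_sum[OF time_in[OF m], of x r v 0 0] f0[of x] by simp
  qed
  then show ?thesis using that[of "K1 + Lf * (K2 + K3)"] K1 K2 K3 Lf_pos by simp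
qed

text \<open>Integrates \<open>f_growth\<close>, with K independent of h, v and Z. The restriction to
  m > 0 is due to the first step, which evaluates f at the exact gradient of the datum and not at a
  discrete one.\<close>

lemma predictor_mass_le:
  assumes m: "real m * \<tau> \<le> T" "m > 0"
  obtains K where "K \<ge> 0"
    "\<And>h v Z. \<lbrakk>h > 0; v \<in> borel_measurable borel; Z \<ge> 0; (\<integral>\<^sup>+x. ennreal \<bar>v x\<bar> \<partial>lborel) \<le> ennreal Z\<rbrakk>
      \<Longrightarrow> (\<integral>\<^sup>+x. ennreal \<bar>spm_predictor f \<tau> h m v x\<bar> \<partial>lborel) \<le> ennreal (K * (1 + Z) * grad_cost h)"
proof -
  obtain K where K: "K \<ge> 0" "\<And>x r v. \<bar>f (real m * \<tau>) x r v\<bar> \<le> K * decay_weight x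
    + Lf * (\<bar>r\<bar> + (if gradient_independent T f then 0 else norm v))"
    using f_growth[OF m(1)] by metis
  define K' where "K' = 1 + \<tau> * (K * (LINT x|lborel. decay_weight (x::real ^ 'd)) + Lf + Lf * real CARD('d))"
  note w0 = lborel_integral_decay_weight_nonneg[where 'a = "real^'d"]
  have K': "K' \<ge> 0"
    using \<tau>_pos K(1) Lf_pos w0 unfolding K'_def
    by (intro add_nonneg_nonneg mult_nonneg_nonneg) auto
  show ?thesis
  proof (rule that[OF K'])
    fix h :: real and v :: "real ^ 'd \<Rightarrow> real" and Z :: real
    assume h: "h > 0" and [measurable]: "v \<in> borel_measurable borel" and Z: "Z \<ge> 0"
      and v: "(\<integral>\<^sup>+x. ennreal \<bar>v x\<bar> \<partial>lborel) \<le> ennreal Z"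
    \<comment> \<open>The switch \<open>c\<close> removes the discrete gradient for
      gradient-independent f; in both cases c / h \<le> \<open>grad_cost h\<close>.\<close>
    define c where "c = (if gradient_independent T f then 0 else (1::real))"
    have c: "c \<ge> 0" by (simp add: c_def)
    have "(\<integral>\<^sup>+x. ennreal \<bar>spm_predictor f \<tau> h m v x\<bar> \<partial>lborel)
      \<le> (\<integral>\<^sup>+x. ennreal (1 + \<tau> * Lf) * ennreal \<bar>v x\<bar> + (ennreal (\<tau> * K) * ennreal (decay_weight x)
          + ennreal (\<tau> * Lf * c) * ennreal (norm (discrete_grad h v x))) \<partial>lborel)"
    proof (intro nn_integral_mono)
      fix x :: "real ^ 'd"
      have "\<bar>spm_predictor f \<tau> h m v x\<bar> \<le> \<bar>v x\<bar> + \<tau> * \<bar>f (real m * \<tau>) x (v x) (discrete_grad h v x)\<bar>"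
        using m(2) \<tau>_pos by (simp add: spm_predictor_def abs_mult order_trans[OF abs_triangle_ineq])
      also have "\<dots> \<le> \<bar>v x\<bar> + \<tau> * (K * decay_weight x + Lf * (\<bar>v x\<bar> + c * norm (discrete_grad h v x)))"
        using K(2)[of x "v x" "discrete_grad h v x"] \<tau>_pos
        by (intro add_left_mono mult_left_mono) (auto simp: c_def split: if_splits)
      also have "\<dots> = (1 + \<tau> * Lf) * \<bar>v x\<bar> + (\<tau> * K * decay_weight x
          + \<tau> * Lf * c * norm (discrete_grad h v x))" by (simp add: algebra_simps)
      finally have "ennreal \<bar>spm_predictor f \<tau> h m v x\<bar> \<le> ennreal \<dots>" by (rule ennreal_leI)
      also have "\<dots> = ennreal (1 + \<tau> * Lf) * ennreal \<bar>v x\<bar> + (ennreal (\<tau> * K) * ennreal (decay_weight x)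
          + ennreal (\<tau> * Lf * c) * ennreal (norm (discrete_grad h v x)))"
        using \<tau>_pos Lf_pos K(1) c less_imp_le[OF decay_weight_pos[of x]]
        by (simp add: ennreal_mult)
      finally show "ennreal \<bar>spm_predictor f \<tau> h m v x\<bar> \<le> \<dots>" .
    qed
    also have "\<dots> = ennreal (1 + \<tau> * Lf) * (\<integral>\<^sup>+x. ennreal \<bar>v x\<bar> \<partial>lborel)
        + (ennreal (\<tau> * K) * (\<integral>\<^sup>+x. ennreal (decay_weight (x::real^'d)) \<partial>lborel)
          + ennreal (\<tau> * Lf * c) * (\<integral>\<^sup>+x. ennreal (norm (discrete_grad h v x)) \<partial>lborel))"
      by (subst nn_integral_add, measurable, subst nn_integral_add, measurable)
        (simp add: nn_integral_cmult)
    also have "\<dots> \<le> ennreal (1 + \<tau> * Lf) * ennreal Z + (ennreal (\<tau> * K) * ennreal (LINT x|lborel. decay_weight (x::real ^ 'd))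
          + ennreal (\<tau> * Lf * c) * ennreal (real CARD('d) * Z / h))"
      using nn_integral_decay_weight_le[of "decay_weight::real^'d\<Rightarrow>real" 1]
        nn_integral_discrete_grad_le[OF _ h Z v] v
      by (intro add_mono mult_left_mono) (auto simp: less_imp_le[OF decay_weight_pos] abs_of_pos[OF decay_weight_pos])
    also have "\<dots> = ennreal ((1 + \<tau> * Lf) * Z + (\<tau> * K * (LINT x|lborel. decay_weight (x::real ^ 'd)) + \<tau> * Lf * c * (real CARD('d) * Z / h)))"
      using \<tau>_pos Lf_pos K(1) c h Z w0 by (simp add: ennreal_mult' del: times_divide_eq_right)
    also have "\<dots> \<le> ennreal (K' * (1 + Z) * grad_cost h)"
    proof (rule ennreal_leI)
      let ?D = "real CARD('d)"
      have ch: "c / h \<le> grad_cost h" "1 \<le> grad_cost h" using h by (auto simp: c_def grad_cost_def)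
      have "(1 + \<tau> * Lf) * Z * 1 \<le> (1 + \<tau> * Lf) * (1 + Z) * grad_cost h"
        using \<tau>_pos Lf_pos Z ch by (intro mult_mono) auto
      moreover have "\<tau> * K * (LINT x|lborel. decay_weight (x::real ^ 'd)) * 1 \<le> \<tau> * K * (LINT x|lborel. decay_weight (x::real ^ 'd)) * ((1 + Z) * grad_cost h)"
        using \<tau>_pos K(1) Z ch w0 mult_mono[of 1 "1 + Z" 1 "grad_cost h"]
        by (intro mult_left_mono mult_nonneg_nonneg) auto
      moreover have "\<tau> * Lf * ?D * (Z * (c / h)) \<le> \<tau> * Lf * ?D * ((1 + Z) * grad_cost h)"
        using \<tau>_pos Lf_pos Z ch c h by (intro mult_left_mono mult_mono) auto
      ultimately show "(1 + \<tau> * Lf) * Z + (\<tau> * K * (LINT x|lborel. decay_weight (x::real ^ 'd)) + \<tau> * Lf * c * (?D * Z / h)) \<le> K' * (1 + Z) * grad_cost h"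
        by (simp add: K'_def algebra_simps)
    qed
    finally show "(\<integral>\<^sup>+x. ennreal \<bar>spm_predictor f \<tau> h m v x\<bar> \<partial>lborel) \<le> ennreal (K' * (1 + Z) * grad_cost h)" .
  qed
qed

text \<open>An inequality and not an equality: where the predictor vanishes at the drawn point, its
  sign quotient is 0 / 0 = 0 and so is the weight.\<close>

lemma spm_particles_weight:
  "\<bar>snd (spm_particles f b u0 \<tau> N a h y (Suc m) i)\<bar> \<le> spm_Z f b u0 \<tau> N a h y m"
proof -
  have "\<bar>l1_mass V * (r / \<bar>r\<bar>)\<bar> \<le> l1_mass V" for V :: "real ^ 'd \<Rightarrow> real" and r :: real
    using l1_mass_nonneg[of V] by (cases "r = 0") (auto simp: abs_mult)
  then show ?thesis
    by (simp add: spm_Z_def spm_solution_def Let_def)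
qed

text \<open>Induction over the steps for an arbitrary array y of positions, hence without
  probability. The new weights are bounded by the old normalization constant, so the new field has
  at most that mass, and the predictor enlarges it by at most a factor of order
  \<open>grad_cost h\<close>.\<close>

lemma spm_Z_bound:
  assumes "real m * \<tau> \<le> T"
  shows "\<exists>K\<ge>0. \<forall>N\<ge>1. \<forall>h>0. \<forall>a y.
    (\<integral>\<^sup>+x. ennreal \<bar>spm_predictor f \<tau> h m (spm_solution f b u0 \<tau> N a h y m) x\<bar> \<partial>lborel)
      \<le> ennreal (K * grad_cost h ^ m)"
  using assms
proof (induction m)
  case 0
  obtain K1 where K1: "K1 \<ge> 0" "\<And>x. \<bar>source f 0 u0 x\<bar> \<le> K1 * decay_weight x"
    using smooth_decaying_bound[OF smooth_source[of 0]] T_pos by auto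
  obtain K2 where K2: "K2 \<ge> 0" "\<And>x. \<bar>u0 x\<bar> \<le> K2 * decay_weight x"
    using smooth_decaying_bound[OF smooth_U[of 0]] T_pos by auto
  have "\<bar>u0 x + \<tau> * source f 0 u0 x\<bar> \<le> (K2 + \<tau> * K1) * decay_weight x" for x
  proof -
    have "\<bar>u0 x + \<tau> * source f 0 u0 x\<bar> \<le> \<bar>u0 x\<bar> + \<tau> * \<bar>source f 0 u0 x\<bar>"
      using \<tau>_pos by (simp add: abs_mult order_trans[OF abs_triangle_ineq])
    also have "\<dots> \<le> K2 * decay_weight x + \<tau> * (K1 * decay_weight x)"
      using K1 K2 \<tau>_pos by (intro add_mono mult_left_mono) auto
    finally show ?thesis by (simp add: algebra_simps)
  qed
  from nn_integral_decay_weight_le[OF this] K1 K2 \<tau>_pos lborel_integral_decay_weight_nonneg[where 'a = "real^'d"]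
  show ?case
    by (intro exI[of _ "(K2 + \<tau> * K1) * (LINT x|lborel. decay_weight (x::real ^ 'd))"]) (simp add: spm_predictor_def spm_solution_def spm_field_def)
next
  case (Suc m)
  then obtain K where K: "K \<ge> 0" and KZ: "\<And>N h a y. N \<ge> 1 \<Longrightarrow> h > 0 \<Longrightarrow>
    (\<integral>\<^sup>+x. ennreal \<bar>spm_predictor f \<tau> h m (spm_solution f b u0 \<tau> N a h y m) x\<bar> \<partial>lborel)
      \<le> ennreal (K * grad_cost h ^ m)"
    using time_mono[of "Suc m" m] by auto
  obtain K' where K': "K' \<ge> 0"
    "\<And>h v Z. \<lbrakk>h > 0; v \<in> borel_measurable borel; Z \<ge> 0; (\<integral>\<^sup>+x. ennreal \<bar>v x\<bar> \<partial>lborel) \<le> ennreal Z\<rbrakk>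
      \<Longrightarrow> (\<integral>\<^sup>+x. ennreal \<bar>spm_predictor f \<tau> h (Suc m) v x\<bar> \<partial>lborel) \<le> ennreal (K' * (1 + Z) * grad_cost h)"
    using predictor_mass_le[OF Suc.prems] by (metis zero_less_Suc)
  have "(\<integral>\<^sup>+x. ennreal \<bar>spm_predictor f \<tau> h (Suc m) (spm_solution f b u0 \<tau> N a h y (Suc m)) x\<bar> \<partial>lborel)
      \<le> ennreal (K' * (1 + K) * grad_cost h ^ Suc m)" if N: "N \<ge> 1" and h: "h > 0" for N h a y
  proof -
    define p where "p = spm_particles f b u0 \<tau> N a h y (Suc m)"
    define Z where "Z = spm_Z f b u0 \<tau> N a h y m"
    have g: "1 \<le> grad_cost h ^ m" using grad_cost_ge_1[OF h] by (rule one_le_power)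
    have Z: "Z \<ge> 0" "Z \<le> K * grad_cost h ^ m"
      using l1_mass_le[OF KZ[OF N h]] l1_mass_nonneg K g by (auto simp: Z_def spm_Z_def)
    have sol: "spm_solution f b u0 \<tau> N a h y (Suc m) = particle_projection N a h p"
      by (simp add: spm_solution_def spm_field_def p_def)
    have w: "\<And>i. i < N \<Longrightarrow> \<bar>snd (p i)\<bar> \<le> Z"
      using spm_particles_weight unfolding p_def Z_def by blast
    have "(\<integral>\<^sup>+x. ennreal \<bar>spm_predictor f \<tau> h (Suc m) (spm_solution f b u0 \<tau> N a h y (Suc m)) x\<bar> \<partial>lborel)
      \<le> ennreal (K' * (1 + Z) * grad_cost h)"
      unfolding sol
      by (rule K'(2)[OF h _ Z(1) particle_projection_bounds(2)[OF h N w]]) (use h in measurable)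
    also have "\<dots> \<le> ennreal (K' * (1 + K) * grad_cost h ^ Suc m)"
    proof (rule ennreal_leI)
      have "1 + Z \<le> (1 + K) * grad_cost h ^ m" using Z g by (simp add: algebra_simps)
      then have "K' * (1 + Z) * grad_cost h \<le> K' * ((1 + K) * grad_cost h ^ m) * grad_cost h"
        using K' grad_cost_ge_1[OF h] by (intro mult_right_mono mult_left_mono) auto
      then show "K' * (1 + Z) * grad_cost h \<le> K' * (1 + K) * grad_cost h ^ Suc m"
        by (simp add: mult_ac)
    qed
    finally show ?thesis .
  qed
  then show ?case using K K' by (intro exI[of _ "K' * (1 + K)"]) auto
qed

text \<open>U and the particle field are estimated separately, with no cancellation between them.
  The result holds for all positions and is of use where a power of 1 / h can be absorbed.\<close>

lemma crude_error_bound: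
  assumes m: "real m * \<tau> \<le> T"
  obtains K p where "K > 0" "\<And>N h a y. \<lbrakk>N \<ge> 1; h > 0\<rbrakk> \<Longrightarrow>
    l2_norm_sq (\<lambda>x. U m x - spm_solution f b u0 \<tau> N a h y m x) \<le> ennreal (K * (1 + 1 / h) ^ p)"
proof (cases m)
  case 0
  then show ?thesis
    by (intro that[of 1 0]) (simp_all add: l2_norm_sq_def spm_solution_def spm_field_def)
next
  case (Suc n)
  obtain K where K: "K \<ge> 0" and KZ: "\<And>N h a y. N \<ge> 1 \<Longrightarrow> h > 0 \<Longrightarrow>
    (\<integral>\<^sup>+x. ennreal \<bar>spm_predictor f \<tau> h n (spm_solution f b u0 \<tau> N a h y n) x\<bar> \<partial>lborel)
      \<le> ennreal (K * grad_cost h ^ n)"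
    using spm_Z_bound[OF time_mono[OF m, of n]] Suc by auto
  obtain K2 where K2: "K2 \<ge> 0" "\<And>x. \<bar>U m x\<bar> \<le> K2 * decay_weight x"
    using smooth_decaying_bound[OF smooth_U[OF m]] by metis
  have [measurable]: "U m \<in> borel_measurable borel"
    using smooth_decaying_imp(2)[OF smooth_U[OF m]] by (rule borel_measurable_continuous_onI)
  let ?d = "CARD('d)"
  define C where "C = 2 * (K2\<^sup>2 * (LINT x|lborel. decay_weight (x::real ^ 'd))) + 2 * K\<^sup>2 + 1"
  have C: "C > 0"
    using lborel_integral_decay_weight_nonneg[where 'a = "real^'d"] by (auto simp: C_def intro!: add_nonneg_pos)
  show ?thesis
  \<comment> \<open>The field at time m = n + 1 carries weights bounded by the normalization
    constant of step n. Its square accounts for the exponent 2 n, and the volume of a cell for the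
    dimension.\<close>
  proof (rule that[OF C, of "2 * n + ?d"])
    fix N h a y assume N: "N \<ge> (1::nat)" and h: "h > (0::real)"
    define p where "p = spm_particles f b u0 \<tau> N a h y m"
    define Z where "Z = spm_Z f b u0 \<tau> N a h y n"
    have g1: "1 \<le> grad_cost h ^ n" using grad_cost_ge_1[OF h] by (rule one_le_power)
    have Z: "Z \<ge> 0" "Z \<le> K * grad_cost h ^ n"
      using l1_mass_le[OF KZ[OF N h]] l1_mass_nonneg K g1 by (auto simp: Z_def spm_Z_def)
    have sol: "spm_solution f b u0 \<tau> N a h y m = particle_projection N a h p"
      using Suc by (simp add: spm_solution_def spm_field_def p_def)
    have w: "\<And>i. i < N \<Longrightarrow> \<bar>snd (p i)\<bar> \<le> Z"
      using spm_particles_weight unfolding p_def Z_def Suc by blast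
    have [measurable]: "particle_projection N a h p \<in> borel_measurable borel"
      using h by measurable
    have "l2_norm_sq (\<lambda>x. U m x - spm_solution f b u0 \<tau> N a h y m x)
      \<le> (\<integral>\<^sup>+x. 2 * ennreal ((U m x)\<^sup>2) + 2 * ennreal ((particle_projection N a h p x)\<^sup>2) \<partial>lborel)"
      unfolding l2_norm_sq_def sol
    proof (intro nn_integral_mono)
      fix x
      let ?u = "U m x" and ?v = "particle_projection N a h p x"
      have "(?u - ?v)\<^sup>2 \<le> 2 * ?u\<^sup>2 + 2 * ?v\<^sup>2"
        using sum_squares_bound[of ?u "- ?v"] by (simp add: power2_eq_square algebra_simps)
      then have "ennreal ((?u - ?v)\<^sup>2) \<le> ennreal (2 * ?u\<^sup>2 + 2 * ?v\<^sup>2)" by (rule ennreal_leI)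
      then show "ennreal ((norm (?u - ?v))\<^sup>2) \<le> 2 * ennreal (?u\<^sup>2) + 2 * ennreal (?v\<^sup>2)"
        by (simp add: ennreal_plus ennreal_mult)
    qed
    also have "\<dots> = 2 * (\<integral>\<^sup>+x. ennreal ((U m x)\<^sup>2) \<partial>lborel) + 2 * (\<integral>\<^sup>+x. ennreal ((particle_projection N a h p x)\<^sup>2) \<partial>lborel)"
      by (subst nn_integral_add) (auto simp: nn_integral_cmult)
    also have "\<dots> \<le> 2 * ennreal (K2\<^sup>2 * (LINT x|lborel. decay_weight (x::real ^ 'd))) + 2 * ennreal (Z\<^sup>2 / h ^ ?d)"
      using nn_integral_square_decay_weight_le[OF K2(2,1)] particle_projection_bounds(3)[OF h N w]
      by (intro add_mono mult_left_mono) auto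
    also have "\<dots> = ennreal (2 * (K2\<^sup>2 * (LINT x|lborel. decay_weight (x::real ^ 'd))) + 2 * (Z\<^sup>2 / h ^ ?d))"
      using h lborel_integral_decay_weight_nonneg[where 'a = "real^'d"]
      by (subst ennreal_plus) (auto simp: ennreal_mult' simp del: times_divide_eq_right ennreal_plus)
    also have "\<dots> \<le> ennreal (C * (1 + 1 / h) ^ (2 * n + ?d))"
    proof (rule ennreal_leI)
      let ?g = "1 + 1 / h"
      have g: "1 \<le> ?g" "0 \<le> 1 / h" using h by auto
      have "Z\<^sup>2 \<le> (K * grad_cost h ^ n)\<^sup>2" using Z by (intro power_mono) auto
      also have "\<dots> \<le> (K * ?g ^ n)\<^sup>2"
        using K g g1 h grad_cost_ge_1[OF h]
        by (intro power_mono mult_left_mono mult_nonneg_nonneg zero_le_power) (auto simp: grad_cost_def)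
      finally have "Z\<^sup>2 \<le> K\<^sup>2 * ?g ^ (2 * n)" by (simp add: power_mult_distrib power_mult[symmetric] mult.commute)
      moreover have "(1 / h) ^ ?d \<le> ?g ^ ?d" using g by (intro power_mono) auto
      ultimately have "Z\<^sup>2 * (1 / h) ^ ?d \<le> (K\<^sup>2 * ?g ^ (2 * n)) * ?g ^ ?d"
        using h by (intro mult_mono) auto
      then have "2 * (Z\<^sup>2 / h ^ ?d) \<le> 2 * K\<^sup>2 * ?g ^ (2 * n + ?d)"
        by (simp add: power_add power_divide mult_ac)
      moreover have "(2 * (K2\<^sup>2 * (LINT x|lborel. decay_weight (x::real ^ 'd))) + 1) * 1 \<le> (2 * (K2\<^sup>2 * (LINT x|lborel. decay_weight (x::real ^ 'd))) + 1) * ?g ^ (2 * n + ?d)"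
        using g lborel_integral_decay_weight_nonneg[where 'a = "real^'d"]
        by (intro mult_left_mono one_le_power) auto
      ultimately show "2 * (K2\<^sup>2 * (LINT x|lborel. decay_weight (x::real ^ 'd))) + 2 * (Z\<^sup>2 / h ^ ?d) \<le> C * ?g ^ (2 * n + ?d)"
        by (simp add: C_def algebra_simps)
    qed
    finally show "l2_norm_sq (\<lambda>x. U m x - spm_solution f b u0 \<tau> N a h y m x)
      \<le> ennreal (C * (1 + 1 / h) ^ (2 * n + ?d))" .
  qed
qed

end

section \<open>Second moments of conditionally independent draws\<close>

text \<open>Rectangles form an intersection-stable generator, and by finiteness the constant
  sequence with value the whole space is an admissible exhaustion.\<close>

lemma measure_eqI_rectangles:
  assumes sets_M: "sets \<mu> = sets (A \<Otimes>\<^sub>M B)" and sets_N: "sets \<nu> = sets (A \<Otimes>\<^sub>M B)"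
    and fin: "finite_measure \<mu>"
    and eq: "\<And>a b. a \<in> sets A \<Longrightarrow> b \<in> sets B \<Longrightarrow> emeasure \<mu> (a \<times> b) = emeasure \<nu> (a \<times> b)"
  shows "\<mu> = \<nu>"
proof (rule measure_eqI_generator_eq[where \<Omega> = "space A \<times> space B"
      and E = "{a \<times> b | a b. a \<in> sets A \<and> b \<in> sets B}" and A = "\<lambda>_. space A \<times> space B"])
  show "Int_stable {a \<times> b |a b. a \<in> sets A \<and> b \<in> sets B}" by (rule Int_stable_pair_measure_generator)
  show "{a \<times> b |a b. a \<in> sets A \<and> b \<in> sets B} \<subseteq> Pow (space A \<times> space B)"
    using sets.space_closed[of A] sets.space_closed[of B] by auto
  show "emeasure \<mu> (space A \<times> space B) \<noteq> \<infinity>"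
    using finite_measure.emeasure_finite[OF fin] by auto
qed (auto simp: sets_M sets_N sets_pair_measure eq)

text \<open>The two-factor statement is used twice: once for the outer product, and once, with the
  third set held fixed, to pass from boxes a \<times> b to all measurable sets of the inner
  product.\<close>

lemma measure_eqI_triple_rectangles:
  assumes sets_M: "sets \<mu> = sets ((A \<Otimes>\<^sub>M B) \<Otimes>\<^sub>M C)" and sets_N: "sets \<nu> = sets ((A \<Otimes>\<^sub>M B) \<Otimes>\<^sub>M C)"
    and fin: "finite_measure \<mu>"
    and eq: "\<And>a b c. a \<in> sets A \<Longrightarrow> b \<in> sets B \<Longrightarrow> c \<in> sets C \<Longrightarrow>
      emeasure \<mu> ((a \<times> b) \<times> c) = emeasure \<nu> ((a \<times> b) \<times> c)"
  shows "\<mu> = \<nu>"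
proof (rule measure_eqI_rectangles[OF sets_M sets_N fin])
  fix x c assume x: "x \<in> sets (A \<Otimes>\<^sub>M B)" and c[measurable]: "c \<in> sets C"
  \<comment> \<open>Restricting to third coordinates in c and projecting onto the first two turns y
    \<mapsto> \<theta> (y \<times> c) into a measure.\<close>
  define slice where "slice \<theta> = distr (density \<theta> (indicator (space (A \<Otimes>\<^sub>M B) \<times> c))) (A \<Otimes>\<^sub>M B) fst"
    for \<theta> :: "(('a \<times> 'b) \<times> 'c) measure"
  have em: "emeasure (slice \<theta>) y = emeasure \<theta> (y \<times> c)"
    if sets[measurable_cong]: "sets \<theta> = sets ((A \<Otimes>\<^sub>M B) \<Otimes>\<^sub>M C)" and y[measurable]: "y \<in> sets (A \<Otimes>\<^sub>M B)" for \<theta> y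
  proof -
    have sp: "space \<theta> = space (A \<Otimes>\<^sub>M B) \<times> space C"
      using sets_eq_imp_space_eq[OF sets] by (simp add: space_pair_measure)
    have "emeasure (slice \<theta>) y = emeasure (density \<theta> (indicator (space (A \<Otimes>\<^sub>M B) \<times> c))) (fst -` y \<inter> space \<theta>)"
      unfolding slice_def by (subst emeasure_distr) auto
    also have "\<dots> = (\<integral>\<^sup>+z. indicator (space (A \<Otimes>\<^sub>M B) \<times> c) z * indicator (fst -` y \<inter> space \<theta>) z \<partial>\<theta>)"
      by (rule emeasure_density) measurable
    also have "\<dots> = (\<integral>\<^sup>+z. indicator (y \<times> c) z \<partial>\<theta>)"
      using sets.sets_into_space[OF y] sets.sets_into_space[OF c]
      by (intro nn_integral_cong) (auto simp: indicator_def sp)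
    also have "\<dots> = emeasure \<theta> (y \<times> c)" by (rule nn_integral_indicator) measurable
    finally show ?thesis .
  qed
  have "slice \<mu> = slice \<nu>"
  proof (rule measure_eqI_rectangles)
    show "sets (slice \<mu>) = sets (A \<Otimes>\<^sub>M B)" "sets (slice \<nu>) = sets (A \<Otimes>\<^sub>M B)" by (auto simp: slice_def)
    show "finite_measure (slice \<mu>)"
    proof
      have "emeasure (slice \<mu>) (space (slice \<mu>)) = emeasure \<mu> (space (A \<Otimes>\<^sub>M B) \<times> c)"
        using em[OF sets_M sets.top] by (simp add: slice_def)
      then show "emeasure (slice \<mu>) (space (slice \<mu>)) \<noteq> \<infinity>"
        using finite_measure.emeasure_finite[OF fin] by auto
    qed
    fix a b assume "a \<in> sets A" "b \<in> sets B"
    then show "emeasure (slice \<mu>) (a \<times> b) = emeasure (slice \<nu>) (a \<times> b)"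
      using c by (simp add: em sets_M sets_N eq)
  qed
  then show "emeasure \<mu> (x \<times> c) = emeasure \<nu> (x \<times> c)"
    using em[OF sets_M x] em[OF sets_N x] by simp
qed

text \<open>One relocation step in abstract form: \<pi> is the current particle system, \<Phi> the
  signed predictor as a function of it, and the Y i are the new draws. The deterministic bound K on
  the mass keeps the expectations in the moment estimates finite.\<close>

locale weighted_draws = prob_space M for M :: "'w measure" +
  fixes P :: "'p measure" and \<pi> :: "'w \<Rightarrow> 'p" and \<Phi> :: "'p \<Rightarrow> real ^ 'd::finite \<Rightarrow> real"
    and Y :: "nat \<Rightarrow> 'w \<Rightarrow> real ^ 'd" and N :: nat and K :: real
  assumes meas_\<pi> [measurable]: "\<pi> \<in> M \<rightarrow>\<^sub>M P"
    and meas_\<Phi> [measurable]: "case_prod \<Phi> \<in> borel_measurable (P \<Otimes>\<^sub>M borel)"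
    and meas_Y: "\<And>i. i < N \<Longrightarrow> Y i \<in> borel_measurable M"
    and N_pos: "N \<ge> 1" and K_nonneg: "K \<ge> 0"
    and mass_le: "\<And>\<omega>. (\<integral>\<^sup>+x. ennreal \<bar>\<Phi> (\<pi> \<omega>) x\<bar> \<partial>lborel) \<le> ennreal K"
    and draws: "\<And>S. (\<And>i. i < N \<Longrightarrow> S i \<in> sets borel) \<Longrightarrow>
       AE \<omega> in M. l1_mass (\<Phi> (\<pi> \<omega>)) > 0 \<longrightarrow>
           real_cond_exp M (vimage_algebra (space M) \<pi> P) (\<lambda>\<omega>'. \<Prod>i<N. indicator (S i) (Y i \<omega>')) \<omega> =
           (\<Prod>i<N. LINT x:S i|lborel. \<bar>\<Phi> (\<pi> \<omega>) x\<bar> / l1_mass (\<Phi> (\<pi> \<omega>)))"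
begin

definition "Z \<omega> = l1_mass (\<Phi> (\<pi> \<omega>))"

definition "mass S \<omega> = (LINT x|lborel. indicator S x * \<bar>\<Phi> (\<pi> \<omega>) x\<bar>)"

text \<open>The conditional mean of the weight of one draw, counted only if the draw falls into S.
  For a cell S this is, up to the volume, the cell average of the predictor.\<close>

definition "flux S \<omega> = (LINT x|lborel. indicator S x * \<Phi> (\<pi> \<omega>) x)"

lemma meas_\<Phi>' [measurable (raw)]:
  assumes "g \<in> L \<rightarrow>\<^sub>M P" "k \<in> L \<rightarrow>\<^sub>M borel"
  shows "(\<lambda>x. \<Phi> (g x) (k x)) \<in> borel_measurable L"
  using measurable_compose[OF measurable_Pair[OF assms] meas_\<Phi>] by simp

lemma integrable_\<Phi>: assumes \<omega>: "\<omega> \<in> space M" shows "integrable lborel (\<Phi> (\<pi> \<omega>))"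
proof (rule integrableI_bounded)
  have "\<pi> \<omega> \<in> space P" using \<omega> by (rule measurable_space[OF meas_\<pi>])
  then show "\<Phi> (\<pi> \<omega>) \<in> borel_measurable lborel" by measurable
  show "(\<integral>\<^sup>+x. ennreal (norm (\<Phi> (\<pi> \<omega>) x)) \<partial>lborel) < \<infinity>"
    using mass_le[of \<omega>] by (auto intro: le_less_trans)
qed

lemma integrable_indicator_\<Phi>:
  assumes \<omega>: "\<omega> \<in> space M" and [measurable]: "S \<in> sets borel"
  shows "integrable lborel (\<lambda>x. indicator S x * \<bar>\<Phi> (\<pi> \<omega>) x\<bar>)"
    "integrable lborel (\<lambda>x. indicator S x * \<Phi> (\<pi> \<omega>) x)"
  using integrable_mult_indicator[of S lborel, OF _ integrable_abs[OF integrable_\<Phi>[OF \<omega>]]]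
    integrable_mult_indicator[of S lborel, OF _ integrable_\<Phi>[OF \<omega>]] assms(2)
  by (simp_all only: sets_lborel real_scaleR_def)

lemma Z_nonneg: "0 \<le> Z \<omega>" by (simp add: Z_def l1_mass_nonneg)

lemma Z_le: "Z \<omega> \<le> K"
  unfolding Z_def by (rule l1_mass_le[OF mass_le K_nonneg])

lemma mass_UNIV: "mass UNIV \<omega> = Z \<omega>"
  by (simp add: mass_def Z_def l1_mass_def)

lemma mass_nonneg: "0 \<le> mass S \<omega>"
  unfolding mass_def by (rule Bochner_Integration.integral_nonneg) auto

lemma mass_le_Z:
  assumes "\<omega> \<in> space M" "S \<in> sets borel" shows "mass S \<omega> \<le> Z \<omega>"
  unfolding mass_UNIV[symmetric] mass_def
  using assms by (intro integral_mono integrable_indicator_\<Phi>) (auto simp: indicator_def)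

lemma abs_flux_le:
  assumes "\<omega> \<in> space M" "S \<in> sets borel" shows "\<bar>flux S \<omega>\<bar> \<le> mass S \<omega>"
  unfolding mass_def flux_def
  by (rule order_trans[OF integral_abs_bound]) (simp add: abs_mult)

lemma nn_integral_mass:
  assumes \<omega>: "\<omega> \<in> space M" and [measurable]: "S \<in> sets borel"
  shows "(\<integral>\<^sup>+x. ennreal \<bar>\<Phi> (\<pi> \<omega>) x\<bar> * indicator S x \<partial>lborel) = ennreal (mass S \<omega>)"
proof -
  have "(\<integral>\<^sup>+x. ennreal \<bar>\<Phi> (\<pi> \<omega>) x\<bar> * indicator S x \<partial>lborel)
      = (\<integral>\<^sup>+x. ennreal (indicator S x * \<bar>\<Phi> (\<pi> \<omega>) x\<bar>) \<partial>lborel)"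
    by (intro nn_integral_cong) (auto simp: indicator_def)
  then show ?thesis
    unfolding mass_def by (simp add: nn_integral_eq_integral integrable_indicator_\<Phi>[OF \<omega>])
qed

lemma meas_mass [measurable]: 
  assumes [measurable]: "S \<in> sets borel" shows "mass S \<in> borel_measurable M"
  unfolding mass_def by measurable

lemma meas_flux [measurable]: 
  assumes [measurable]: "S \<in> sets borel" shows "flux S \<in> borel_measurable M"
  unfolding flux_def by measurable

lemma meas_Z [measurable]: "Z \<in> borel_measurable M"
  using meas_mass[of UNIV] unfolding mass_UNIV[abs_def] by simp

section \<open>Joint laws of the particle system and one or two draws\<close>

lemma integrable_bounded:
  fixes g :: "'w \<Rightarrow> real"
  assumes "g \<in> borel_measurable M" "\<And>\<omega>. \<omega> \<in> space M \<Longrightarrow> \<bar>g \<omega>\<bar> \<le> B"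
  shows "integrable M g"
  by (rule integrable_const_bound[where B = B]) (use assms in auto)

text \<open>The factor \<open>Z \<omega> ^ e\<close> with \<open>e > 0\<close> removes the event \<open>Z \<omega> = 0\<close>, on which nothing is known about the
  draws and \<open>mass (S i) \<omega> / Z \<omega>\<close> is the junk value \<open>0\<close>.\<close>

lemma rectangle_law:
  assumes A[measurable]: "A \<in> sets P" and S: "\<And>i. i < N \<Longrightarrow> S i \<in> sets borel" and e: "e > 0"
  shows "(LINT \<omega>|M. indicator A (\<pi> \<omega>) * Z \<omega> ^ e * (\<Prod>i<N. indicator (S i) (Y i \<omega>)))
    = (LINT \<omega>|M. indicator A (\<pi> \<omega>) * Z \<omega> ^ e * (\<Prod>i<N. mass (S i) \<omega> / Z \<omega>))"
proof -
  define F where "F = vimage_algebra (space M) \<pi> P"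
  have sub: "subalgebra M F"
    unfolding subalgebra_def F_def by (simp add: sets_image_in_sets[OF refl meas_\<pi>])
  interpret F: finite_measure_subalgebra M F by standard (rule sub)
  have \<pi>F[measurable]: "\<pi> \<in> F \<rightarrow>\<^sub>M P"
    unfolding F_def by (rule measurable_vimage_algebra1) (use measurable_space[OF meas_\<pi>] in auto)
  have ZF[measurable]: "Z \<in> borel_measurable F"
    unfolding Z_def l1_mass_def by measurable
  have draws_S: "AE \<omega> in M. l1_mass (\<Phi> (\<pi> \<omega>)) > 0 \<longrightarrow>
           real_cond_exp M F (\<lambda>\<omega>'. \<Prod>i<N. indicator (S i) (Y i \<omega>')) \<omega> =
           (\<Prod>i<N. LINT x:S i|lborel. \<bar>\<Phi> (\<pi> \<omega>) x\<bar> / l1_mass (\<Phi> (\<pi> \<omega>)))"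
    unfolding F_def by (rule draws) (rule S)
  define G where "G \<omega> = (\<Prod>i<N. indicator (S i) (Y i \<omega>) :: real)" for \<omega>
  have G[measurable]: "G \<in> borel_measurable M"
    unfolding G_def using S meas_Y by measurable
  have G01: "\<bar>G \<omega>\<bar> \<le> 1" for \<omega>
    unfolding G_def abs_prod by (intro prod_le_1) auto
  have "(LINT \<omega>|M. indicator A (\<pi> \<omega>) * Z \<omega> ^ e * G \<omega>)
      = (LINT \<omega>|M. indicator A (\<pi> \<omega>) * Z \<omega> ^ e * real_cond_exp M F G \<omega>)"
  \<comment> \<open>The factor in front of \<open>G\<close> depends on \<omega> only through \<pi>
    and is therefore measurable for the conditioning algebra; this permits replacing
    \<open>G\<close> by its conditional expectation.\<close>
  proof (rule F.real_cond_exp_intg(2)[symmetric])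
    show "integrable M (\<lambda>\<omega>. indicator A (\<pi> \<omega>) * Z \<omega> ^ e * G \<omega>)"
    proof (rule integrable_bounded)
      fix \<omega>
      have "\<bar>indicator A (\<pi> \<omega>) * Z \<omega> ^ e * G \<omega>\<bar> \<le> 1 * K ^ e * 1"
        unfolding abs_mult using Z_nonneg Z_le G01 K_nonneg
        by (intro mult_mono) (auto simp: power_abs intro!: power_mono)
      then show "\<bar>indicator A (\<pi> \<omega>) * Z \<omega> ^ e * G \<omega>\<bar> \<le> K ^ e" by simp
    qed measurable
  qed measurable
  also have "\<dots> = (LINT \<omega>|M. indicator A (\<pi> \<omega>) * Z \<omega> ^ e * (\<Prod>i<N. mass (S i) \<omega> / Z \<omega>))"
  proof (rule integral_cong_AE)
    show "AE \<omega> in M. indicator A (\<pi> \<omega>) * Z \<omega> ^ e * real_cond_exp M F G \<omega>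
        = indicator A (\<pi> \<omega>) * Z \<omega> ^ e * (\<Prod>i<N. mass (S i) \<omega> / Z \<omega>)"
      using draws_S
    proof eventually_elim
      case (elim \<omega>)
      show ?case
      proof (cases "Z \<omega> > 0")
        case True
        have "real_cond_exp M F G \<omega> = (\<Prod>i<N. LINT x:S i|lborel. \<bar>\<Phi> (\<pi> \<omega>) x\<bar> / Z \<omega>)"
          using elim True by (simp add: Z_def F_def G_def[abs_def])
        also have "\<dots> = (\<Prod>i<N. mass (S i) \<omega> / Z \<omega>)"
          by (simp add: set_lebesgue_integral_def mass_def)
        finally show ?thesis by simp
      next
        case False
        then have "Z \<omega> = 0" using Z_nonneg[of \<omega>] by simp
        then show ?thesis using e by simp
      qed
    qed
    have "\<And>i. i < N \<Longrightarrow> mass (S i) \<in> borel_measurable M" using S by measurable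
    then show "(\<lambda>\<omega>. indicator A (\<pi> \<omega>) * Z \<omega> ^ e * (\<Prod>i<N. mass (S i) \<omega> / Z \<omega>)) \<in> borel_measurable M"
      by measurable
  qed measurable
  finally show ?thesis by (simp add: G_def)
qed

text \<open>If Z vanishes, then so does \<open>mass\<close>, which is at most Z; the default value
  of the quotient does no harm.\<close>

lemma mass_div_Z: "\<omega> \<in> space M \<Longrightarrow> S \<in> sets borel \<Longrightarrow> Z \<omega> * (mass S \<omega> / Z \<omega>) = mass S \<omega>"
  using mass_le_Z[of \<omega> S] mass_nonneg[of S \<omega>] by auto

text \<open>All other draws are left free by giving them the whole space, whose conditional
  probability is 1 where Z \<noteq> 0. One factor Z clears the one remaining denominator.\<close>

lemma single_rectangle:
  assumes A: "A \<in> sets P" and S: "S \<in> sets borel" and i: "i < N"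
  shows "(LINT \<omega>|M. indicator A (\<pi> \<omega>) * Z \<omega> * indicator S (Y i \<omega>))
    = (LINT \<omega>|M. indicator A (\<pi> \<omega>) * mass S \<omega>)"
proof -
  define S' where "S' k = (if k = i then S else UNIV)" for k
  have S': "S' k \<in> sets borel" for k using S by (simp add: S'_def)
  have 1: "(\<Prod>k<N. indicator (S' k) (Y k \<omega>)) = (indicator S (Y i \<omega>) :: real)" for \<omega>
    using i by (subst prod.remove[of _ i]) (auto simp: S'_def)
  have 2: "Z \<omega> * (\<Prod>k<N. mass (S' k) \<omega> / Z \<omega>) = mass S \<omega>" if "\<omega> \<in> space M" for \<omega>
  proof -
    have "(\<Prod>k<N. mass (S' k) \<omega> / Z \<omega>) = mass S \<omega> / Z \<omega> * (\<Prod>k\<in>{..<N} - {i}. mass (S' k) \<omega> / Z \<omega>)"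
      using i by (subst prod.remove[of _ i]) (auto simp: S'_def)
    moreover have "(\<Prod>k\<in>{..<N} - {i}. mass (S' k) \<omega> / Z \<omega>) = 1" if "Z \<omega> \<noteq> 0"
      using that by (intro prod.neutral) (auto simp: S'_def mass_UNIV)
    ultimately show ?thesis using mass_div_Z[OF that S] by (cases "Z \<omega> = 0") auto
  qed
  have "(LINT \<omega>|M. indicator A (\<pi> \<omega>) * Z \<omega> * indicator S (Y i \<omega>))
    = (LINT \<omega>|M. indicator A (\<pi> \<omega>) * Z \<omega> ^ 1 * (\<Prod>k<N. mass (S' k) \<omega> / Z \<omega>))"
    by (subst rectangle_law[OF A S', symmetric]) (simp_all add: 1)
  also have "\<dots> = (LINT \<omega>|M. indicator A (\<pi> \<omega>) * mass S \<omega>)"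
    by (intro Bochner_Integration.integral_cong refl) (simp add: 2 mult.assoc)
  finally show ?thesis .
qed

text \<open>Conditional independence of two distinct draws, with the other draws left free. The
  power Z^2 matches the two denominators.\<close>

lemma pair_rectangle:
  assumes A: "A \<in> sets P" and S: "S \<in> sets borel" "R \<in> sets borel" and i: "i < N" "l < N" "i \<noteq> l"
  shows "(LINT \<omega>|M. indicator A (\<pi> \<omega>) * (Z \<omega>)\<^sup>2 * (indicator S (Y i \<omega>) * indicator R (Y l \<omega>)))
    = (LINT \<omega>|M. indicator A (\<pi> \<omega>) * (mass S \<omega> * mass R \<omega>))"
proof -
  define S' where "S' k = (if k = i then S else if k = l then R else UNIV)" for k
  have S': "S' k \<in> sets borel" for k using S by (simp add: S'_def)
  have rem: "(\<Prod>k<N. g k) = g i * (g l * (\<Prod>k\<in>{..<N} - {i} - {l}. g k))" for g :: "nat \<Rightarrow> real"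
    using i by (simp add: prod.remove[of "{..<N}" i] prod.remove[of "{..<N} - {i}" l])
  have 1: "(\<Prod>k<N. indicator (S' k) (Y k \<omega>)) = (indicator S (Y i \<omega>) * indicator R (Y l \<omega>) :: real)" for \<omega>
    unfolding rem using i by (auto simp: S'_def)
  have 2: "(Z \<omega>)\<^sup>2 * (\<Prod>k<N. mass (S' k) \<omega> / Z \<omega>) = mass S \<omega> * mass R \<omega>" if "\<omega> \<in> space M" for \<omega>
  proof -
    have "(\<Prod>k\<in>{..<N} - {i} - {l}. mass (S' k) \<omega> / Z \<omega>) = 1" if "Z \<omega> \<noteq> 0"
      using that by (intro prod.neutral) (auto simp: S'_def mass_UNIV)
    then have "(\<Prod>k<N. mass (S' k) \<omega> / Z \<omega>) = mass S \<omega> / Z \<omega> * (mass R \<omega> / Z \<omega>)" if "Z \<omega> \<noteq> 0"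
      unfolding rem using i that by (simp add: S'_def)
    then show ?thesis
      using mass_div_Z[OF that S(1)] mass_div_Z[OF that S(2)]
      by (cases "Z \<omega> = 0") (auto simp: power2_eq_square)
  qed
  have "(LINT \<omega>|M. indicator A (\<pi> \<omega>) * (Z \<omega>)\<^sup>2 * (indicator S (Y i \<omega>) * indicator R (Y l \<omega>)))
    = (LINT \<omega>|M. indicator A (\<pi> \<omega>) * (Z \<omega>)\<^sup>2 * (\<Prod>k<N. mass (S' k) \<omega> / Z \<omega>))"
    by (subst rectangle_law[OF A S', symmetric]) (simp_all add: 1)
  also have "\<dots> = (LINT \<omega>|M. indicator A (\<pi> \<omega>) * (mass S \<omega> * mass R \<omega>))"
    by (intro Bochner_Integration.integral_cong refl) (simp add: 2 mult.assoc)
  finally show ?thesis .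
qed

lemma nn_integral_eq_expectation:
  assumes "g \<in> borel_measurable M" "\<And>\<omega>. \<omega> \<in> space M \<Longrightarrow> 0 \<le> g \<omega>" "\<And>\<omega>. \<omega> \<in> space M \<Longrightarrow> g \<omega> \<le> B"
  shows "(\<integral>\<^sup>+\<omega>. ennreal (g \<omega>) \<partial>M) = ennreal (LINT \<omega>|M. g \<omega>)"
proof (rule nn_integral_eq_integral)
  show "integrable M g" using assms by (intro integrable_bounded[where B = B]) auto
  show "AE \<omega> in M. 0 \<le> g \<omega>" using assms by (intro AE_I2) auto
qed

lemma nn_integral_\<Phi>_pair:
  assumes [measurable]: "g \<in> borel_measurable (M \<Otimes>\<^sub>M lborel)"
  shows "(\<integral>\<^sup>+z. ennreal \<bar>\<Phi> (\<pi> (fst z)) (snd z)\<bar> * g z \<partial>(M \<Otimes>\<^sub>M lborel))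
    = (\<integral>\<^sup>+\<omega>. (\<integral>\<^sup>+y. ennreal \<bar>\<Phi> (\<pi> \<omega>) y\<bar> * g (\<omega>, y) \<partial>lborel) \<partial>M)"
proof -
  have "(\<lambda>z. ennreal \<bar>\<Phi> (\<pi> (fst z)) (snd z)\<bar> * g z) \<in> borel_measurable (M \<Otimes>\<^sub>M lborel)"
    by measurable
  from lborel.nn_integral_fst[OF this] show ?thesis by simp
qed

text \<open>The weight of a draw is the sign of \<open>\<Phi> (\<pi> \<omega>)\<close> at the drawn point and so depends jointly on the
  conditioning variable and the draw. This is why the product form of the conditional law has to be
  extended from rectangles to functions on the product space.\<close>

lemma single_law:
  assumes i: "i < N" and g[measurable]: "g \<in> borel_measurable (P \<Otimes>\<^sub>M borel)" and g1: "\<And>z. \<bar>g z\<bar> \<le> (1::real)"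
  shows "(LINT \<omega>|M. Z \<omega> * g (\<pi> \<omega>, Y i \<omega>)) = (LINT \<omega>|M. LINT y|lborel. \<bar>\<Phi> (\<pi> \<omega>) y\<bar> * g (\<pi> \<omega>, y))"
proof -
  note meas_Y[OF i, measurable]
  \<comment> \<open>\<mu> is the law of the particle system and the draw under M weighted by Z;
    \<nu> is what it should be, the law in which the draw has density |\<Phi>|, not normalized. Both
    give the same value to every rectangle by \<open>single_rectangle\<close>.\<close>
  define \<mu> where "\<mu> = distr (density M (\<lambda>\<omega>. ennreal (Z \<omega>))) (P \<Otimes>\<^sub>M borel) (\<lambda>\<omega>. (\<pi> \<omega>, Y i \<omega>))"
  define \<nu> where "\<nu> = distr (density (M \<Otimes>\<^sub>M lborel) (\<lambda>z. ennreal \<bar>\<Phi> (\<pi> (fst z)) (snd z)\<bar>))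
    (P \<Otimes>\<^sub>M borel) (\<lambda>z. (\<pi> (fst z), snd z))"
  interpret prod: pair_sigma_finite M lborel ..
  have "\<mu> = \<nu>"
  proof (rule measure_eqI_rectangles)
    show "sets \<mu> = sets (P \<Otimes>\<^sub>M borel)" "sets \<nu> = sets (P \<Otimes>\<^sub>M borel)" by (simp_all add: \<mu>_def \<nu>_def)
    have em: "emeasure \<mu> X = (\<integral>\<^sup>+\<omega>. ennreal (Z \<omega>) * indicator X (\<pi> \<omega>, Y i \<omega>) \<partial>M)"
      if [measurable]: "X \<in> sets (P \<Otimes>\<^sub>M borel)" for X
      unfolding \<mu>_def
      by (subst nn_integral_indicator[symmetric], simp, subst nn_integral_distr, simp, simp,
          subst nn_integral_density) simp_all
    have en: "emeasure \<nu> X = (\<integral>\<^sup>+\<omega>. (\<integral>\<^sup>+y. ennreal \<bar>\<Phi> (\<pi> \<omega>) y\<bar> * indicator X (\<pi> \<omega>, y) \<partial>lborel) \<partial>M)"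
      if [measurable]: "X \<in> sets (P \<Otimes>\<^sub>M borel)" for X
      unfolding \<nu>_def
      by (subst nn_integral_indicator[symmetric], simp, subst nn_integral_distr, measurable,
          subst nn_integral_density, measurable, subst nn_integral_\<Phi>_pair, measurable)
    show "finite_measure \<mu>"
    proof
      have "space \<mu> = space (P \<Otimes>\<^sub>M borel)" by (simp add: \<mu>_def)
      then have "emeasure \<mu> (space \<mu>)
          = (\<integral>\<^sup>+\<omega>. ennreal (Z \<omega>) * indicator (space (P \<Otimes>\<^sub>M borel)) (\<pi> \<omega>, Y i \<omega>) \<partial>M)"
        by (simp add: em)
      also have "\<dots> \<le> (\<integral>\<^sup>+\<omega>. ennreal K \<partial>M)"
        using Z_le by (intro nn_integral_mono) (auto intro!: ennreal_leI split: split_indicator)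
      also have "\<dots> < \<infinity>" by (simp add: emeasure_space_1)
      finally show "emeasure \<mu> (space \<mu>) \<noteq> \<infinity>" by simp
    qed
    fix A S assume A[measurable]: "A \<in> sets P" and S[measurable]: "S \<in> sets (borel :: (real^'d) measure)"
    have "emeasure \<mu> (A \<times> S) = (\<integral>\<^sup>+\<omega>. ennreal (indicator A (\<pi> \<omega>) * Z \<omega> * indicator S (Y i \<omega>)) \<partial>M)"
      by (subst em) (auto intro!: nn_integral_cong split: split_indicator)
    also have "\<dots> = ennreal (LINT \<omega>|M. indicator A (\<pi> \<omega>) * Z \<omega> * indicator S (Y i \<omega>))"
      using Z_nonneg Z_le K_nonneg
      by (intro nn_integral_eq_expectation[where B = K]) (auto split: split_indicator)
    also have "\<dots> = ennreal (LINT \<omega>|M. indicator A (\<pi> \<omega>) * mass S \<omega>)"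
      by (simp add: single_rectangle[OF A S i])
    also have "\<dots> = (\<integral>\<^sup>+\<omega>. ennreal (indicator A (\<pi> \<omega>) * mass S \<omega>) \<partial>M)"
      using mass_nonneg order_trans[OF mass_le_Z Z_le] K_nonneg
      by (intro nn_integral_eq_expectation[symmetric, where B = K]) (auto split: split_indicator)
    also have "\<dots> = (\<integral>\<^sup>+\<omega>. (\<integral>\<^sup>+y. ennreal \<bar>\<Phi> (\<pi> \<omega>) y\<bar> * indicator (A \<times> S) (\<pi> \<omega>, y) \<partial>lborel) \<partial>M)"
      by (intro nn_integral_cong) (auto simp: nn_integral_mass indicator_times split: split_indicator)
    also have "\<dots> = emeasure \<nu> (A \<times> S)" by (subst en) simp_all
    finally show "emeasure \<mu> (A \<times> S) = emeasure \<nu> (A \<times> S)" .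
  qed
  have "(LINT \<omega>|M. Z \<omega> * g (\<pi> \<omega>, Y i \<omega>)) = integral\<^sup>L \<mu> g"
    unfolding \<mu>_def by (subst integral_distr, simp, simp, subst integral_density) (simp_all add: Z_nonneg)
  also have "\<dots> = (\<integral>z. \<bar>\<Phi> (\<pi> (fst z)) (snd z)\<bar> * g (\<pi> (fst z), snd z) \<partial>(M \<Otimes>\<^sub>M lborel))"
    unfolding \<open>\<mu> = \<nu>\<close> \<nu>_def by (subst integral_distr, measurable, subst integral_density, measurable)
  also have "\<dots> = (LINT \<omega>|M. LINT y|lborel. \<bar>\<Phi> (\<pi> \<omega>) y\<bar> * g (\<pi> \<omega>, y))"
  proof (subst prod.integral_fst'[symmetric])
    show "integrable (M \<Otimes>\<^sub>M lborel) (\<lambda>z. \<bar>\<Phi> (\<pi> (fst z)) (snd z)\<bar> * g (\<pi> (fst z), snd z))"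
    proof (rule integrableI_bounded)
      have "(\<integral>\<^sup>+z. ennreal (norm (\<bar>\<Phi> (\<pi> (fst z)) (snd z)\<bar> * g (\<pi> (fst z), snd z))) \<partial>(M \<Otimes>\<^sub>M lborel))
        \<le> (\<integral>\<^sup>+z. ennreal \<bar>\<Phi> (\<pi> (fst z)) (snd z)\<bar> * 1 \<partial>(M \<Otimes>\<^sub>M lborel))"
        using g1 by (intro nn_integral_mono) (auto simp: abs_mult intro!: ennreal_leI mult_left_le)
      also have "\<dots> \<le> (\<integral>\<^sup>+\<omega>. ennreal K \<partial>M)"
        using mass_le by (subst nn_integral_\<Phi>_pair, simp, intro nn_integral_mono) simp
      also have "\<dots> < \<infinity>" by (simp add: emeasure_space_1)
      finally show "(\<integral>\<^sup>+z. ennreal (norm (\<bar>\<Phi> (\<pi> (fst z)) (snd z)\<bar> * g (\<pi> (fst z), snd z))) \<partial>(M \<Otimes>\<^sub>M lborel)) < \<infinity>" .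
    qed measurable
  qed simp
  finally show ?thesis .
qed

lemma nn_integral_\<Phi>_triple:
  assumes [measurable]: "g \<in> borel_measurable ((M \<Otimes>\<^sub>M lborel) \<Otimes>\<^sub>M lborel)"
  shows "(\<integral>\<^sup>+z. ennreal \<bar>\<Phi> (\<pi> (fst (fst z))) (snd (fst z))\<bar> * ennreal \<bar>\<Phi> (\<pi> (fst (fst z))) (snd z)\<bar> * g z
      \<partial>((M \<Otimes>\<^sub>M lborel) \<Otimes>\<^sub>M lborel))
    = (\<integral>\<^sup>+\<omega>. (\<integral>\<^sup>+y. ennreal \<bar>\<Phi> (\<pi> \<omega>) y\<bar> * (\<integral>\<^sup>+y'. ennreal \<bar>\<Phi> (\<pi> \<omega>) y'\<bar> * g ((\<omega>, y), y') \<partial>lborel)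
        \<partial>lborel) \<partial>M)"
proof -
  have 1: "(\<lambda>z. ennreal \<bar>\<Phi> (\<pi> (fst (fst z))) (snd (fst z))\<bar> * ennreal \<bar>\<Phi> (\<pi> (fst (fst z))) (snd z)\<bar> * g z)
      \<in> borel_measurable ((M \<Otimes>\<^sub>M lborel) \<Otimes>\<^sub>M lborel)"
    by measurable
  have 2: "(\<lambda>z. \<integral>\<^sup>+y'. ennreal \<bar>\<Phi> (\<pi> (fst z)) y'\<bar> * g (z, y') \<partial>lborel) \<in> borel_measurable (M \<Otimes>\<^sub>M lborel)"
    by measurable
  have 3: "(\<lambda>y'. ennreal \<bar>\<Phi> (\<pi> (fst z)) y'\<bar> * g (z, y')) \<in> borel_measurable lborel"
    if "z \<in> space (M \<Otimes>\<^sub>M lborel)" for z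
    using that by measurable
  have "(\<integral>\<^sup>+z. ennreal \<bar>\<Phi> (\<pi> (fst (fst z))) (snd (fst z))\<bar> * ennreal \<bar>\<Phi> (\<pi> (fst (fst z))) (snd z)\<bar> * g z
      \<partial>((M \<Otimes>\<^sub>M lborel) \<Otimes>\<^sub>M lborel))
    = (\<integral>\<^sup>+z. (\<integral>\<^sup>+y'. ennreal \<bar>\<Phi> (\<pi> (fst z)) (snd z)\<bar> * (ennreal \<bar>\<Phi> (\<pi> (fst z)) y'\<bar> * g (z, y')) \<partial>lborel)
        \<partial>(M \<Otimes>\<^sub>M lborel))"
    using lborel.nn_integral_fst[OF 1] by (simp add: mult.assoc)
  also have "\<dots> = (\<integral>\<^sup>+z. ennreal \<bar>\<Phi> (\<pi> (fst z)) (snd z)\<bar> * (\<integral>\<^sup>+y'. ennreal \<bar>\<Phi> (\<pi> (fst z)) y'\<bar> * g (z, y') \<partial>lborel)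
        \<partial>(M \<Otimes>\<^sub>M lborel))"
    by (intro nn_integral_cong nn_integral_cmult 3)
  finally show ?thesis using nn_integral_\<Phi>_pair[OF 2] by simp
qed

text \<open>The argument for one draw, on a product of three factors and with weight Z^2: the two
  draws then have the joint density |\<Phi> y| |\<Phi> y'|. The test function may involve the
  particle system and both draws at once, as a product of two particle weights does.\<close>

lemma pair_law:
  assumes i: "i < N" "l < N" "i \<noteq> l" and g[measurable]: "g \<in> borel_measurable ((P \<Otimes>\<^sub>M borel) \<Otimes>\<^sub>M borel)"
    and g1: "\<And>z. \<bar>g z\<bar> \<le> (1::real)"
  shows "(LINT \<omega>|M. (Z \<omega>)\<^sup>2 * g ((\<pi> \<omega>, Y i \<omega>), Y l \<omega>))
    = (LINT \<omega>|M. LINT y|lborel. LINT y'|lborel. \<bar>\<Phi> (\<pi> \<omega>) y\<bar> * \<bar>\<Phi> (\<pi> \<omega>) y'\<bar> * g ((\<pi> \<omega>, y), y'))"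
proof -
  note meas_Y[OF i(1), measurable] meas_Y[OF i(2), measurable]
  let ?MX = "M \<Otimes>\<^sub>M (lborel :: (real^'d) measure)"
  let ?MXX = "?MX \<Otimes>\<^sub>M (lborel :: (real^'d) measure)"
  let ?PB = "P \<Otimes>\<^sub>M (borel :: (real^'d) measure)"
  let ?PBB = "?PB \<Otimes>\<^sub>M (borel :: (real^'d) measure)"
  let ?w = "\<lambda>z. \<bar>\<Phi> (\<pi> (fst (fst z))) (snd (fst z))\<bar> * \<bar>\<Phi> (\<pi> (fst (fst z))) (snd z)\<bar>"
  let ?T = "\<lambda>z. ((\<pi> (fst (fst z)), snd (fst z)), snd z)"
  define \<mu> where "\<mu> = distr (density M (\<lambda>\<omega>. ennreal ((Z \<omega>)\<^sup>2))) ?PBB (\<lambda>\<omega>. ((\<pi> \<omega>, Y i \<omega>), Y l \<omega>))"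
  define \<nu> where "\<nu> = distr (density ?MXX (\<lambda>z. ennreal (?w z))) ?PBB ?T"
  interpret outer: pair_sigma_finite M "lborel :: (real^'d) measure" ..
  interpret inner: pair_sigma_finite ?MX "lborel :: (real^'d) measure" ..
  have Z2: "(Z \<omega>)\<^sup>2 \<le> K\<^sup>2" for \<omega> using Z_nonneg Z_le by (intro power_mono)
  have "\<mu> = \<nu>"
  proof (rule measure_eqI_triple_rectangles)
    show "sets \<mu> = sets ?PBB" "sets \<nu> = sets ?PBB" by (simp_all add: \<mu>_def \<nu>_def)
    have em: "emeasure \<mu> X = (\<integral>\<^sup>+\<omega>. ennreal ((Z \<omega>)\<^sup>2) * indicator X ((\<pi> \<omega>, Y i \<omega>), Y l \<omega>) \<partial>M)"
      if [measurable]: "X \<in> sets ?PBB" for X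
      unfolding \<mu>_def
      by (subst nn_integral_indicator[symmetric], simp, subst nn_integral_distr, simp, simp,
          subst nn_integral_density) simp_all
    have en: "emeasure \<nu> X = (\<integral>\<^sup>+\<omega>. (\<integral>\<^sup>+y. ennreal \<bar>\<Phi> (\<pi> \<omega>) y\<bar> * (\<integral>\<^sup>+y'. ennreal \<bar>\<Phi> (\<pi> \<omega>) y'\<bar> *
        indicator X ((\<pi> \<omega>, y), y') \<partial>lborel) \<partial>lborel) \<partial>M)"
      if [measurable]: "X \<in> sets ?PBB" for X
    proof -
      have "emeasure \<nu> X = (\<integral>\<^sup>+z. ennreal (?w z) * indicator X (?T z) \<partial>?MXX)"
        unfolding \<nu>_def
        by (subst nn_integral_indicator[symmetric], simp, subst nn_integral_distr, measurable,
            subst nn_integral_density, measurable)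
      then show ?thesis
        by (simp add: ennreal_mult nn_integral_\<Phi>_triple)
    qed
    show "finite_measure \<mu>"
    proof
      have "space \<mu> = space ?PBB" by (simp add: \<mu>_def)
      then have "emeasure \<mu> (space \<mu>)
          = (\<integral>\<^sup>+\<omega>. ennreal ((Z \<omega>)\<^sup>2) * indicator (space ?PBB) ((\<pi> \<omega>, Y i \<omega>), Y l \<omega>) \<partial>M)"
        by (simp add: em)
      also have "\<dots> \<le> (\<integral>\<^sup>+\<omega>. ennreal (K\<^sup>2) \<partial>M)"
        using Z2 by (intro nn_integral_mono) (auto intro!: ennreal_leI split: split_indicator)
      also have "\<dots> < \<infinity>" by (simp add: emeasure_space_1)
      finally show "emeasure \<mu> (space \<mu>) \<noteq> \<infinity>" by simp
    qed
    fix A S R assume A[measurable]: "A \<in> sets P" and S[measurable]: "S \<in> sets (borel :: (real^'d) measure)"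
      and R[measurable]: "R \<in> sets (borel :: (real^'d) measure)"
    have "emeasure \<mu> ((A \<times> S) \<times> R)
      = (\<integral>\<^sup>+\<omega>. ennreal (indicator A (\<pi> \<omega>) * (Z \<omega>)\<^sup>2 * (indicator S (Y i \<omega>) * indicator R (Y l \<omega>))) \<partial>M)"
      by (subst em) (auto intro!: nn_integral_cong split: split_indicator)
    also have "\<dots> = ennreal (LINT \<omega>|M. indicator A (\<pi> \<omega>) * (Z \<omega>)\<^sup>2 * (indicator S (Y i \<omega>) * indicator R (Y l \<omega>)))"
      using Z2 K_nonneg
      by (intro nn_integral_eq_expectation[where B = "K\<^sup>2"]) (auto split: split_indicator)
    also have "\<dots> = ennreal (LINT \<omega>|M. indicator A (\<pi> \<omega>) * (mass S \<omega> * mass R \<omega>))"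
      by (simp add: pair_rectangle[OF A S R i])
    also have "\<dots> = (\<integral>\<^sup>+\<omega>. ennreal (indicator A (\<pi> \<omega>) * (mass S \<omega> * mass R \<omega>)) \<partial>M)"
    proof (intro nn_integral_eq_expectation[symmetric, where B = "K * K"])
      fix \<omega> assume "\<omega> \<in> space M"
      then have "mass S \<omega> * mass R \<omega> \<le> K * K"
        using mass_nonneg order_trans[OF mass_le_Z Z_le] K_nonneg S R by (intro mult_mono) auto
      then show "indicator A (\<pi> \<omega>) * (mass S \<omega> * mass R \<omega>) \<le> K * K"
        using K_nonneg by (auto split: split_indicator)
    qed (auto simp: mass_nonneg split: split_indicator)
    also have "\<dots> = (\<integral>\<^sup>+\<omega>. (\<integral>\<^sup>+y. ennreal \<bar>\<Phi> (\<pi> \<omega>) y\<bar> * (\<integral>\<^sup>+y'. ennreal \<bar>\<Phi> (\<pi> \<omega>) y'\<bar> *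
        indicator ((A \<times> S) \<times> R) ((\<pi> \<omega>, y), y') \<partial>lborel) \<partial>lborel) \<partial>M)"
    proof (intro nn_integral_cong)
      fix \<omega> assume \<omega>[measurable]: "\<omega> \<in> space M"
      have [measurable]: "\<pi> \<omega> \<in> space P" using \<omega> by (rule measurable_space[OF meas_\<pi>])
      have "(\<integral>\<^sup>+y. ennreal \<bar>\<Phi> (\<pi> \<omega>) y\<bar> * (\<integral>\<^sup>+y'. ennreal \<bar>\<Phi> (\<pi> \<omega>) y'\<bar> *
          indicator ((A \<times> S) \<times> R) ((\<pi> \<omega>, y), y') \<partial>lborel) \<partial>lborel)
        = (\<integral>\<^sup>+y. indicator A (\<pi> \<omega>) * ennreal (mass R \<omega>) * (ennreal \<bar>\<Phi> (\<pi> \<omega>) y\<bar> * indicator S y) \<partial>lborel)"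
        using nn_integral_mass[OF \<omega> R]
        by (intro nn_integral_cong) (auto simp: indicator_times mult_ac split: split_indicator)
      also have "\<dots> = indicator A (\<pi> \<omega>) * ennreal (mass R \<omega>) * ennreal (mass S \<omega>)"
        using nn_integral_mass[OF \<omega> S] by (subst nn_integral_cmult) auto
      also have "\<dots> = ennreal (indicator A (\<pi> \<omega>) * (mass S \<omega> * mass R \<omega>))"
        by (auto simp: ennreal_mult mass_nonneg mult.commute split: split_indicator)
      finally show "ennreal (indicator A (\<pi> \<omega>) * (mass S \<omega> * mass R \<omega>)) = (\<integral>\<^sup>+y. ennreal \<bar>\<Phi> (\<pi> \<omega>) y\<bar> *
          (\<integral>\<^sup>+y'. ennreal \<bar>\<Phi> (\<pi> \<omega>) y'\<bar> * indicator ((A \<times> S) \<times> R) ((\<pi> \<omega>, y), y') \<partial>lborel) \<partial>lborel)" ..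
    qed
    also have "\<dots> = emeasure \<nu> ((A \<times> S) \<times> R)" by (subst en) simp_all
    finally show "emeasure \<mu> ((A \<times> S) \<times> R) = emeasure \<nu> ((A \<times> S) \<times> R)" .
  qed
  have int: "integrable ?MXX (\<lambda>z. ?w z * g (?T z))"
  proof (rule integrableI_bounded)
    have "(\<integral>\<^sup>+z. ennreal (norm (?w z * g (?T z))) \<partial>?MXX)
      \<le> (\<integral>\<^sup>+z. ennreal \<bar>\<Phi> (\<pi> (fst (fst z))) (snd (fst z))\<bar> * ennreal \<bar>\<Phi> (\<pi> (fst (fst z))) (snd z)\<bar> * 1 \<partial>?MXX)"
      using g1 by (intro nn_integral_mono)
        (auto simp: abs_mult ennreal_mult[symmetric] intro!: ennreal_leI mult_left_le)
    also have "\<dots> \<le> (\<integral>\<^sup>+\<omega>. ennreal (K * K) \<partial>M)"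
    proof (subst nn_integral_\<Phi>_triple)
      show "(\<integral>\<^sup>+\<omega>. (\<integral>\<^sup>+y. ennreal \<bar>\<Phi> (\<pi> \<omega>) y\<bar> * (\<integral>\<^sup>+y'. ennreal \<bar>\<Phi> (\<pi> \<omega>) y'\<bar> * 1 \<partial>lborel) \<partial>lborel) \<partial>M)
        \<le> (\<integral>\<^sup>+\<omega>. ennreal (K * K) \<partial>M)"
      proof (intro nn_integral_mono)
        fix \<omega> assume \<omega>: "\<omega> \<in> space M"
        have [measurable]: "\<pi> \<omega> \<in> space P" using \<omega> by (rule measurable_space[OF meas_\<pi>])
        have "(\<integral>\<^sup>+y. ennreal \<bar>\<Phi> (\<pi> \<omega>) y\<bar> * (\<integral>\<^sup>+y'. ennreal \<bar>\<Phi> (\<pi> \<omega>) y'\<bar> * 1 \<partial>lborel) \<partial>lborel)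
          = (\<integral>\<^sup>+y. ennreal \<bar>\<Phi> (\<pi> \<omega>) y\<bar> \<partial>lborel) * (\<integral>\<^sup>+y'. ennreal \<bar>\<Phi> (\<pi> \<omega>) y'\<bar> \<partial>lborel)"
          by (subst nn_integral_multc) auto
        also have "\<dots> \<le> ennreal K * ennreal K" by (intro mult_mono mass_le) auto
        finally show "(\<integral>\<^sup>+y. ennreal \<bar>\<Phi> (\<pi> \<omega>) y\<bar> * (\<integral>\<^sup>+y'. ennreal \<bar>\<Phi> (\<pi> \<omega>) y'\<bar> * 1 \<partial>lborel) \<partial>lborel) \<le> ennreal (K * K)"
          using K_nonneg by (simp add: ennreal_mult)
      qed
    qed simp
    also have "\<dots> < \<infinity>" by (simp add: emeasure_space_1)
    finally show "(\<integral>\<^sup>+z. ennreal (norm (?w z * g (?T z))) \<partial>?MXX) < \<infinity>" .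
  qed measurable
  have "(LINT \<omega>|M. (Z \<omega>)\<^sup>2 * g ((\<pi> \<omega>, Y i \<omega>), Y l \<omega>)) = integral\<^sup>L \<mu> g"
    unfolding \<mu>_def by (subst integral_distr, simp, simp, subst integral_density) simp_all
  also have "\<dots> = (\<integral>z. ?w z * g (?T z) \<partial>?MXX)"
    unfolding \<open>\<mu> = \<nu>\<close> \<nu>_def by (subst integral_distr, measurable, subst integral_density, measurable)
  also have "\<dots> = (\<integral>z. (LINT y'|lborel. ?w (z, y') * g (?T (z, y'))) \<partial>?MX)"
    by (rule inner.integral_fst'[OF int, symmetric])
  also have "\<dots> = (LINT \<omega>|M. LINT y|lborel. LINT y'|lborel. ?w ((\<omega>, y), y') * g (?T ((\<omega>, y), y')))"
    by (rule outer.integral_fst'[OF inner.integrable_fst'[OF int], symmetric])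
  finally show ?thesis by simp
qed

text \<open>The contribution of particle i to the set S. Here \<open>sgn\<close> is the quotient
  \<Phi> / |\<Phi>| from the weights, including the value 0 where \<Phi> vanishes.\<close>

definition "sample S i \<omega> = Z \<omega> * (sgn (\<Phi> (\<pi> \<omega>) (Y i \<omega>)) * indicator S (Y i \<omega>))"

lemma abs_sgn_indicator_le_1: "\<bar>sgn (r::real) * indicator S y\<bar> \<le> 1"
  by (simp add: abs_mult abs_sgn_eq)

lemma meas_sample:
  assumes [measurable]: "S \<in> sets borel" and i: "i < N"
  shows "sample S i \<in> borel_measurable M"
proof -
  note meas_Y[OF i, measurable]
  show ?thesis unfolding sample_def by measurable
qed

lemma abs_sample_le: "\<bar>sample S i \<omega>\<bar> \<le> Z \<omega> * indicator S (Y i \<omega>)"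
  using Z_nonneg[of \<omega>] by (auto simp: sample_def abs_mult abs_sgn_eq)

lemma abs_sample_le_K: "\<bar>sample S i \<omega>\<bar> \<le> K"
  using abs_sample_le[of S i \<omega>] Z_le[of \<omega>] K_nonneg by (auto split: split_indicator_asm)

text \<open>Unbiasedness of the weights: the density |\<Phi>| and the sign combine to
  \<Phi>.\<close>

lemma expectation_sample:
  assumes S[measurable]: "S \<in> sets borel" and i: "i < N"
  shows "(LINT \<omega>|M. sample S i \<omega>) = (LINT \<omega>|M. flux S \<omega>)"
proof -
  let ?g = "\<lambda>z. sgn (\<Phi> (fst z) (snd z)) * indicator S (snd z)"
  have "(LINT \<omega>|M. sample S i \<omega>) = (LINT \<omega>|M. LINT y|lborel. \<bar>\<Phi> (\<pi> \<omega>) y\<bar> * ?g (\<pi> \<omega>, y))"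
    unfolding sample_def
    using single_law[OF i, of ?g, OF _ abs_sgn_indicator_le_1] by simp
  also have "(\<lambda>\<omega>. LINT y|lborel. \<bar>\<Phi> (\<pi> \<omega>) y\<bar> * ?g (\<pi> \<omega>, y)) = flux S"
    unfolding flux_def
  proof (intro ext Bochner_Integration.integral_cong refl)
    have "\<bar>r\<bar> * (sgn r * x) = x * (\<bar>r\<bar> * sgn r)" for r x :: real by (simp only: mult_ac)
    then show "\<bar>\<Phi> (\<pi> \<omega>) y\<bar> * ?g (\<pi> \<omega>, y) = indicator S y * \<Phi> (\<pi> \<omega>) y" for \<omega> y
      by (simp add: abs_mult_sgn)
  qed
  finally show ?thesis .
qed

text \<open>Independence is only conditional, so the result is the expectation of the squared
  conditional mean; the samples may stay correlated through the particle system.\<close>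

lemma expectation_sample_mult:
  assumes S[measurable]: "S \<in> sets borel" and i: "i < N" "l < N" "i \<noteq> l"
  shows "(LINT \<omega>|M. sample S i \<omega> * sample S l \<omega>) = (LINT \<omega>|M. (flux S \<omega>)\<^sup>2)"
proof -
  let ?s = "\<lambda>p y. sgn (\<Phi> p y) * indicator S y"
  let ?g = "\<lambda>z. ?s (fst (fst z)) (snd (fst z)) * ?s (fst (fst z)) (snd z)"
  have "(LINT \<omega>|M. sample S i \<omega> * sample S l \<omega>) = (LINT \<omega>|M. (Z \<omega>)\<^sup>2 * ?g ((\<pi> \<omega>, Y i \<omega>), Y l \<omega>))"
    unfolding sample_def by (intro Bochner_Integration.integral_cong refl) (simp add: power2_eq_square mult_ac)
  also have "\<dots> = (LINT \<omega>|M. LINT y|lborel. LINT y'|lborel. \<bar>\<Phi> (\<pi> \<omega>) y\<bar> * \<bar>\<Phi> (\<pi> \<omega>) y'\<bar> * ?g ((\<pi> \<omega>, y), y'))"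
  proof (rule pair_law[OF i])
    show "\<bar>?g z\<bar> \<le> 1" for z
      unfolding abs_mult[of "?s _ _" "?s _ _"] by (intro mult_le_one abs_sgn_indicator_le_1) auto
  qed measurable
  also have "\<dots> = (LINT \<omega>|M. LINT y|lborel. LINT y'|lborel. (indicator S y * \<Phi> (\<pi> \<omega>) y) * (indicator S y' * \<Phi> (\<pi> \<omega>) y'))"
  proof (intro Bochner_Integration.integral_cong refl)
    have "\<bar>r\<bar> * \<bar>q\<bar> * (sgn r * x * (sgn q * z)) = (x * (\<bar>r\<bar> * sgn r)) * (z * (\<bar>q\<bar> * sgn q))"
      for r q x z :: real by (simp only: mult_ac)
    then show "\<bar>\<Phi> (\<pi> \<omega>) y\<bar> * \<bar>\<Phi> (\<pi> \<omega>) y'\<bar> * ?g ((\<pi> \<omega>, y), y')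
        = (indicator S y * \<Phi> (\<pi> \<omega>) y) * (indicator S y' * \<Phi> (\<pi> \<omega>) y')" for \<omega> y y'
      by (simp add: abs_mult_sgn)
  qed
  also have "\<dots> = (LINT \<omega>|M. (flux S \<omega>)\<^sup>2)"
    by (simp add: flux_def power2_eq_square)
  finally show ?thesis .
qed

text \<open>The square removes the sign. Of the two factors Z, one is the weight in
  \<open>single_law\<close>, and the other is put into the test function, which may depend on the
  particle system.\<close>

lemma expectation_sample_square:
  assumes S[measurable]: "S \<in> sets borel" and i: "i < N"
  shows "(LINT \<omega>|M. (sample S i \<omega>)\<^sup>2) \<le> (LINT \<omega>|M. Z \<omega> * mass S \<omega>)"
proof -
  note meas_Y[OF i, measurable] meas_sample[OF S i, measurable]
  have "(LINT \<omega>|M. (sample S i \<omega>)\<^sup>2) \<le> (LINT \<omega>|M. (Z \<omega>)\<^sup>2 * indicator S (Y i \<omega>))"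
  proof (rule integral_mono)
    show "integrable M (\<lambda>\<omega>. (sample S i \<omega>)\<^sup>2)"
      using abs_sample_le_K by (intro integrable_bounded[where B = "K\<^sup>2"]) (auto intro: power2_le_iff_abs_le[THEN iffD2] simp: K_nonneg)
    show "integrable M (\<lambda>\<omega>. (Z \<omega>)\<^sup>2 * indicator S (Y i \<omega>))"
      using Z_nonneg Z_le K_nonneg
      by (intro integrable_bounded[where B = "K\<^sup>2"]) (auto split: split_indicator intro!: power_mono)
    fix \<omega>
    have "\<bar>sample S i \<omega>\<bar>\<^sup>2 \<le> (Z \<omega> * indicator S (Y i \<omega>))\<^sup>2"
      by (intro power_mono abs_sample_le) auto
    then show "(sample S i \<omega>)\<^sup>2 \<le> (Z \<omega>)\<^sup>2 * indicator S (Y i \<omega>)"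
      by (auto split: split_indicator_asm)
  qed
  also have "\<dots> = (LINT \<omega>|M. Z \<omega> * mass S \<omega>)"
  proof (cases "K = 0")
    case True
    then have "Z \<omega> = 0" for \<omega> using Z_nonneg[of \<omega>] Z_le[of \<omega>] by simp
    then show ?thesis by simp
  next
    case False
    then have K: "K > 0" using K_nonneg by simp
    have [measurable]: "(\<lambda>p. l1_mass (\<Phi> p)) \<in> borel_measurable P" unfolding l1_mass_def by measurable
    \<comment> \<open>\<open>single_law\<close> asks for a test function bounded by 1 on the whole
      product space, but Z \<le> K is known only at the points \<pi> \<omega>. Dividing by K and
      truncating to [0, 1] changes nothing at these points.\<close>
    let ?g = "\<lambda>z. max 0 (min 1 (l1_mass (\<Phi> (fst z)) / K)) * indicator S (snd z) :: real"
    have g: "?g (\<pi> \<omega>, y) = Z \<omega> / K * indicator S y" for \<omega> y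
    proof -
      have "0 \<le> Z \<omega> / K" "Z \<omega> / K \<le> 1" using Z_nonneg[of \<omega>] Z_le[of \<omega>] K by auto
      then show ?thesis by (simp add: Z_def)
    qed
    have "(LINT \<omega>|M. Z \<omega> * ?g (\<pi> \<omega>, Y i \<omega>)) = (LINT \<omega>|M. LINT y|lborel. \<bar>\<Phi> (\<pi> \<omega>) y\<bar> * ?g (\<pi> \<omega>, y))"
    proof (rule single_law[OF i])
      show "\<bar>?g z\<bar> \<le> 1" for z by (cases "snd z \<in> S") auto
    qed measurable
    moreover have "(LINT y|lborel. \<bar>\<Phi> (\<pi> \<omega>) y\<bar> * (Z \<omega> / K * indicator S y)) = Z \<omega> * mass S \<omega> / K" for \<omega>
      unfolding mass_def times_divide_eq_left[symmetric]
      by (subst integral_mult_right_zero[symmetric]) (simp add: mult_ac)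
    moreover have "Z \<omega> * (Z \<omega> / K * indicator S (Y i \<omega>)) = (Z \<omega>)\<^sup>2 * indicator S (Y i \<omega>) / K" for \<omega>
      by (simp add: power2_eq_square)
    ultimately have "(LINT \<omega>|M. (Z \<omega>)\<^sup>2 * indicator S (Y i \<omega>) / K) = (LINT \<omega>|M. Z \<omega> * mass S \<omega> / K)"
      unfolding g by (simp only:)
    then show ?thesis using K by (simp only: integral_divide_zero) simp
  qed
  finally show ?thesis .
qed

text \<open>Decomposition into bias and variance around an arbitrary c. The linear term is exact by
  unbiasedness, the cross terms produce the squared conditional mean, and only the N diagonal terms
  produce variance, which leaves 1 / N after division by N^2.\<close>

lemma expectation_square_error:
  assumes S[measurable]: "S \<in> sets borel" and s: "s > 0"
  shows "(LINT \<omega>|M. ((\<Sum>i<N. sample S i \<omega>) / (real N * s) - c)\<^sup>2)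
    \<le> (LINT \<omega>|M. (flux S \<omega> / s - c)\<^sup>2) + (LINT \<omega>|M. Z \<omega> * mass S \<omega>) / (real N * s\<^sup>2)"
proof -
  have Np: "real N > 0" using N_pos by simp
  define X where "X \<omega> = (\<Sum>i<N. sample S i \<omega>)" for \<omega>
  have ms: "i < N \<Longrightarrow> sample S i \<in> borel_measurable M" for i by (rule meas_sample[OF S])
  have is1: "i < N \<Longrightarrow> integrable M (sample S i)" for i
    using ms abs_sample_le_K by (intro integrable_bounded[where B = K]) auto
  have is2: "integrable M (\<lambda>\<omega>. sample S i \<omega> * sample S l \<omega>)" if "i < N" "l < N" for i l
  proof (rule integrable_bounded[where B = "K * K"])
    show "(\<lambda>\<omega>. sample S i \<omega> * sample S l \<omega>) \<in> borel_measurable M" using ms that by measurable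
    show "\<bar>sample S i \<omega> * sample S l \<omega>\<bar> \<le> K * K" for \<omega>
      unfolding abs_mult using abs_sample_le_K K_nonneg by (intro mult_mono) auto
  qed
  have flux_le: "\<bar>flux S \<omega>\<bar> \<le> K" if "\<omega> \<in> space M" for \<omega>
    using abs_flux_le[OF that S] mass_le_Z[OF that S] Z_le[of \<omega>] by linarith
  have if1: "integrable M (flux S)" using flux_le by (intro integrable_bounded[where B = K]) auto
  have if2: "integrable M (\<lambda>\<omega>. (flux S \<omega>)\<^sup>2)"
    using flux_le by (intro integrable_bounded[where B = "K\<^sup>2"]) (auto intro: power2_le_iff_abs_le[THEN iffD2] simp: K_nonneg)
  have X2: "(X \<omega>)\<^sup>2 = (\<Sum>i<N. \<Sum>l<N. sample S i \<omega> * sample S l \<omega>)" for \<omega>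
    by (simp add: X_def power2_eq_square sum_product)
  have iX1: "integrable M X" unfolding X_def using is1 by auto
  have iX2: "integrable M (\<lambda>\<omega>. (X \<omega>)\<^sup>2)" unfolding X2
    by (intro Bochner_Integration.integrable_sum is2) auto
  define E1 where "E1 = (LINT \<omega>|M. flux S \<omega>)"
  define E2 where "E2 = (LINT \<omega>|M. (flux S \<omega>)\<^sup>2)"
  define Q where "Q = (LINT \<omega>|M. Z \<omega> * mass S \<omega>)"
  have E2: "E2 \<ge> 0" unfolding E2_def by (rule Bochner_Integration.integral_nonneg) simp
  have EX1: "(LINT \<omega>|M. X \<omega>) = real N * E1"
    unfolding X_def E1_def using is1 expectation_sample[OF S] by (subst Bochner_Integration.integral_sum) auto
  have EX2: "(LINT \<omega>|M. (X \<omega>)\<^sup>2) \<le> (real N)\<^sup>2 * E2 + real N * Q"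
  proof -
    have "(LINT \<omega>|M. (X \<omega>)\<^sup>2) = (\<Sum>i<N. \<Sum>l<N. LINT \<omega>|M. sample S i \<omega> * sample S l \<omega>)"
    proof -
      have "(LINT \<omega>|M. (X \<omega>)\<^sup>2) = (\<Sum>i<N. LINT \<omega>|M. (\<Sum>l<N. sample S i \<omega> * sample S l \<omega>))"
        unfolding X2 by (intro Bochner_Integration.integral_sum Bochner_Integration.integrable_sum is2) auto
      also have "\<dots> = (\<Sum>i<N. \<Sum>l<N. LINT \<omega>|M. sample S i \<omega> * sample S l \<omega>)"
        by (intro sum.cong refl Bochner_Integration.integral_sum is2) auto
      finally show ?thesis .
    qed
    \<comment> \<open>\<open>E2\<close> is added on the diagonal too, which is allowed since it is
      nonnegative. The double sum then contains exactly N^2 copies of it and the leading terms match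
      without a remainder.\<close>
    also have "\<dots> \<le> (\<Sum>i<N. \<Sum>l<N. E2 + (if l = i then Q else 0))"
    proof (intro sum_mono)
      fix i l assume "i \<in> {..<N}" "l \<in> {..<N}"
      then show "(LINT \<omega>|M. sample S i \<omega> * sample S l \<omega>) \<le> E2 + (if l = i then Q else 0)"
      proof (cases "l = i")
        case True
        have "(LINT \<omega>|M. sample S i \<omega> * sample S i \<omega>) \<le> Q"
          using expectation_sample_square[OF S, of i] \<open>i \<in> {..<N}\<close> by (simp add: Q_def power2_eq_square)
        with True E2 show ?thesis by simp
      next
        case False
        then show ?thesis
          using expectation_sample_mult[OF S, of i l] \<open>i \<in> {..<N}\<close> \<open>l \<in> {..<N}\<close> by (simp add: E2_def)
      qed
    qed
    also have "\<dots> = (real N)\<^sup>2 * E2 + real N * Q"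
      by (simp add: sum.distrib power2_eq_square algebra_simps)
    finally show ?thesis .
  qed
  have sq: "(x / k - c)\<^sup>2 = x\<^sup>2 * (1 / k\<^sup>2) + (x * (- 2 * c / k) + c\<^sup>2)" for x k :: real
    by (simp add: power2_diff power_divide)
  have "(LINT \<omega>|M. (X \<omega> / (real N * s) - c)\<^sup>2)
      = (LINT \<omega>|M. (X \<omega>)\<^sup>2 * (1 / (real N * s)\<^sup>2) + (X \<omega> * (- 2 * c / (real N * s)) + c\<^sup>2))"
    by (simp only: sq)
  also have "\<dots> = (LINT \<omega>|M. (X \<omega>)\<^sup>2) / (real N * s)\<^sup>2 - 2 * c * (LINT \<omega>|M. X \<omega>) / (real N * s) + c\<^sup>2"
    using iX1 iX2 by (simp add: prob_space)
  also have "\<dots> \<le> ((real N)\<^sup>2 * E2 + real N * Q) / (real N * s)\<^sup>2 - 2 * c * (real N * E1) / (real N * s) + c\<^sup>2"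
    unfolding EX1 using EX2 by (intro add_right_mono diff_right_mono divide_right_mono) auto
  also have "\<dots> = (E2 * (1 / s\<^sup>2) + (E1 * (- 2 * c / s) + c\<^sup>2)) + Q / (real N * s\<^sup>2)"
  proof -
    have "((real N)\<^sup>2 * E2 + real N * Q) / (real N * s)\<^sup>2 = E2 * (1 / s\<^sup>2) + Q / (real N * s\<^sup>2)"
      using Np by (simp add: add_divide_distrib power_mult_distrib power2_eq_square)
    moreover have "2 * c * (real N * E1) / (real N * s) = - (E1 * (- 2 * c / s))"
      using Np by simp
    ultimately show ?thesis by simp
  qed
  also have "E2 * (1 / s\<^sup>2) + (E1 * (- 2 * c / s) + c\<^sup>2)
      = (LINT \<omega>|M. (flux S \<omega>)\<^sup>2 * (1 / s\<^sup>2) + (flux S \<omega> * (- 2 * c / s) + c\<^sup>2))"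
    unfolding E1_def E2_def using if1 if2 by (simp add: prob_space)
  also have "\<dots> = (LINT \<omega>|M. (flux S \<omega> / s - c)\<^sup>2)"
    by (simp only: sq)
  finally show ?thesis unfolding X_def Q_def .
qed

text \<open>The same estimate for nonnegative integrals, ready to be integrated over x by Tonelli.
  Boundedness of all integrands justifies the passage.\<close>

lemma nn_expectation_square_error:
  assumes S[measurable]: "S \<in> sets borel" and s: "s > 0"
  shows "(\<integral>\<^sup>+\<omega>. ennreal (((\<Sum>i<N. sample S i \<omega>) / (real N * s) - c)\<^sup>2) \<partial>M)
    \<le> (\<integral>\<^sup>+\<omega>. ennreal ((flux S \<omega> / s - c)\<^sup>2) \<partial>M) + (\<integral>\<^sup>+\<omega>. ennreal (Z \<omega> * mass S \<omega> / (real N * s\<^sup>2)) \<partial>M)"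
proof -
  have Np: "real N > 0" using N_pos by simp
  have ms[measurable]: "i < N \<Longrightarrow> sample S i \<in> borel_measurable M" for i by (rule meas_sample[OF S])
  have sq: "(x / k - c)\<^sup>2 \<le> (B / k + \<bar>c\<bar>)\<^sup>2" if "\<bar>x\<bar> \<le> B" "k > 0" for x k B :: real
  proof -
    have "\<bar>x / k\<bar> \<le> B / k" using that by (simp add: divide_right_mono)
    then show ?thesis by (intro abs_le_square_iff[THEN iffD1]) linarith
  qed
  have flux_le: "\<bar>flux S \<omega>\<bar> \<le> K" if "\<omega> \<in> space M" for \<omega>
    using abs_flux_le[OF that S] mass_le_Z[OF that S] Z_le[of \<omega>] by linarith
  have sum_le: "\<bar>\<Sum>i<N. sample S i \<omega>\<bar> \<le> real N * K" for \<omega>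
    using sum_mono[of "{..<N}" "\<lambda>i. \<bar>sample S i \<omega>\<bar>" "\<lambda>_. K"] abs_sample_le_K
    by (intro order_trans[OF sum_abs]) simp
  have 1: "(\<integral>\<^sup>+\<omega>. ennreal (((\<Sum>i<N. sample S i \<omega>) / (real N * s) - c)\<^sup>2) \<partial>M)
    = ennreal (LINT \<omega>|M. ((\<Sum>i<N. sample S i \<omega>) / (real N * s) - c)\<^sup>2)"
  proof (rule nn_integral_eq_expectation)
    show "((\<Sum>i<N. sample S i \<omega>) / (real N * s) - c)\<^sup>2 \<le> (real N * K / (real N * s) + \<bar>c\<bar>)\<^sup>2" for \<omega>
      using Np s by (intro sq sum_le) simp
  qed auto
  have 2: "(\<integral>\<^sup>+\<omega>. ennreal ((flux S \<omega> / s - c)\<^sup>2) \<partial>M) = ennreal (LINT \<omega>|M. (flux S \<omega> / s - c)\<^sup>2)"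
    using sq[OF flux_le s] by (intro nn_integral_eq_expectation[where B = "(K / s + \<bar>c\<bar>)\<^sup>2"]) auto
  have 3: "(\<integral>\<^sup>+\<omega>. ennreal (Z \<omega> * mass S \<omega> / (real N * s\<^sup>2)) \<partial>M)
    = ennreal (LINT \<omega>|M. Z \<omega> * mass S \<omega> / (real N * s\<^sup>2))"
  proof (rule nn_integral_eq_expectation[where B = "K * K / (real N * s\<^sup>2)"])
    fix \<omega> assume "\<omega> \<in> space M"
    then have "Z \<omega> * mass S \<omega> \<le> K * K"
      using Z_nonneg Z_le mass_nonneg order_trans[OF mass_le_Z Z_le] K_nonneg S by (intro mult_mono) auto
    then show "Z \<omega> * mass S \<omega> / (real N * s\<^sup>2) \<le> K * K / (real N * s\<^sup>2)"
      using Np s by (intro divide_right_mono) auto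
  qed (use Z_nonneg mass_nonneg in auto)
  have nonneg: "0 \<le> (LINT \<omega>|M. Z \<omega> * mass S \<omega> / (real N * s\<^sup>2))"
    using Z_nonneg mass_nonneg by (intro Bochner_Integration.integral_nonneg) auto
  have "(LINT \<omega>|M. Z \<omega> * mass S \<omega> / (real N * s\<^sup>2)) = (LINT \<omega>|M. Z \<omega> * mass S \<omega>) / (real N * s\<^sup>2)"
    by (rule integral_divide_zero)
  then have "ennreal (LINT \<omega>|M. ((\<Sum>i<N. sample S i \<omega>) / (real N * s) - c)\<^sup>2)
    \<le> ennreal ((LINT \<omega>|M. (flux S \<omega> / s - c)\<^sup>2) + (LINT \<omega>|M. Z \<omega> * mass S \<omega> / (real N * s\<^sup>2)))"
    using expectation_square_error[OF S s, of c] by (intro ennreal_leI) simp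
  also have "\<dots> = ennreal (LINT \<omega>|M. (flux S \<omega> / s - c)\<^sup>2) + ennreal (LINT \<omega>|M. Z \<omega> * mass S \<omega> / (real N * s\<^sup>2))"
    by (rule ennreal_plus[OF Bochner_Integration.integral_nonneg nonneg]) simp
  finally show ?thesis unfolding 1 2 3 .
qed

end

section \<open>One step of the method for a gradient-independent source\<close>

locale spm_run = spm_problem f b u0 T \<tau> A Lf
  for f :: "'d::finite nonlinearity" and b :: "real ^ 'd" and u0 :: "real ^ 'd \<Rightarrow> real"
    and T \<tau> A Lf :: real +
  fixes N :: nat and h :: real and a :: "real ^ 'd" and n :: nat and M :: "'w measure"
    and Y :: "nat \<Rightarrow> nat \<Rightarrow> 'w \<Rightarrow> real ^ 'd"
  assumes N: "N \<ge> 1" and h: "h > 0" and n: "real n * \<tau> \<le> T"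
    and grad_indep: "gradient_independent T f"
    and draws_n: "spm_draws f b u0 \<tau> N a h n M Y"
begin

abbreviation "PP \<equiv> Pi\<^sub>M {..<N} (\<lambda>_::nat. borel :: ((real ^ 'd) \<times> real) measure)"

text \<open>Restricted to the indices below N in order to be a point of the product space
  \<open>PP\<close>; it is the map that generates \<open>particle_algebra\<close>.\<close>

definition "cloud m \<omega> = (\<lambda>i\<in>{..<N}. spm_particles f b u0 \<tau> N a h (\<lambda>j i. Y j i \<omega>) m i)"

text \<open>As a deterministic function of the particle system, the predictor can serve as \<Phi> in
  \<open>weighted_draws\<close>.\<close>

definition "predictor m p = spm_predictor f \<tau> h m (spm_field u0 N a h m p)"

definition "sol m \<omega> = spm_solution f b u0 \<tau> N a h (\<lambda>j i. Y j i \<omega>) m"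

lemma field_cloud: "spm_field u0 N a h m (cloud m \<omega>) = sol m \<omega>"
proof -
  have "particle_projection N a h (\<lambda>i\<in>{..<N}. p i) = particle_projection N a h p" for p
    by (intro ext) (simp add: particle_projection_eq[OF h])
  then show ?thesis by (simp add: cloud_def sol_def spm_solution_def spm_field_def)
qed

lemma predictor_cloud: "predictor m (cloud m \<omega>) = spm_predictor f \<tau> h m (sol m \<omega>)"
  by (simp add: predictor_def field_cloud)

lemma l1_mass_predictor_cloud: "l1_mass (predictor m (cloud m \<omega>)) = spm_Z f b u0 \<tau> N a h (\<lambda>j i. Y j i \<omega>) m"
  by (simp add: predictor_cloud spm_Z_def sol_def)

lemma grad_cost_eq_1: "grad_cost h = 1"
  using grad_indep by (simp add: grad_cost_def)

section \<open>Joint measurability of the method in the randomness and the space variable\<close>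

lemma meas_U: "m \<le> n \<Longrightarrow> U m \<in> borel_measurable borel"
  using smooth_decaying_imp(2)[OF smooth_U[OF time_mono[OF n]]]
  by (rule borel_measurable_continuous_onI)

lemma meas_u0 [measurable]: "u0 \<in> borel_measurable borel"
  using meas_U[of 0] by simp

lemma meas_field [measurable]: "(\<lambda>z. spm_field u0 N a h m (fst z) (snd z)) \<in> borel_measurable (PP \<Otimes>\<^sub>M borel)"
proof (cases "m = 0")
  case True
  then show ?thesis by (simp add: spm_field_def)
next
  case False
  have fs [measurable]: "(fst :: (real^'d) \<times> real \<Rightarrow> _) \<in> borel \<rightarrow>\<^sub>M borel" "(snd :: (real^'d) \<times> real \<Rightarrow> _) \<in> borel \<rightarrow>\<^sub>M borel"
    by (auto intro!: borel_measurable_continuous_onI continuous_intros)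
  note eq = indicator_cell_of[OF h, of a]
  have "(\<lambda>z. spm_field u0 N a h m (fst z) (snd z)) = (\<lambda>z.
    (\<Sum>i<N. snd (fst z i) * (if cell_index a h (snd z) = cell_index a h (fst (fst z i)) then 1 else 0))
      / (real N * h ^ CARD('d)))"
    using False by (intro ext) (simp add: spm_field_def particle_projection_eq[OF h] eq)
  also have "\<dots> \<in> borel_measurable (PP \<Otimes>\<^sub>M borel)"
  proof (intro borel_measurable_divide borel_measurable_sum borel_measurable_times)
    fix i assume "i \<in> {..<N}"
    then have i: "i < N" by simp
    have c[measurable]: "(\<lambda>z. fst z i) \<in> (PP \<Otimes>\<^sub>M (borel :: (real^'d) measure)) \<rightarrow>\<^sub>M borel"
      by (rule measurable_compose[OF measurable_fst measurable_component_singleton]) (use i in simp)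
    show "(\<lambda>z. snd (fst z i)) \<in> borel_measurable (PP \<Otimes>\<^sub>M (borel :: (real^'d) measure))"
      by (rule measurable_compose[OF c fs(2)])
    have [measurable]: "(\<lambda>z. fst (fst z i)) \<in> borel_measurable (PP \<Otimes>\<^sub>M (borel :: (real^'d) measure))"
      by (rule measurable_compose[OF c fs(1)])
    show "(\<lambda>z. if cell_index a h (snd z) = cell_index a h (fst (fst z i)) then 1 else 0 :: real)
      \<in> borel_measurable (PP \<Otimes>\<^sub>M borel)"
      by measurable
  qed auto
  finally show ?thesis .
qed

text \<open>The gradient argument may be set to 0, so that no difference quotient and no factor 1 /
  h enters the estimates below. At m = 0 the predictor is built from the source of the datum and is
  treated apart.\<close>

lemma predictor_eq:
  assumes "m \<le> n" "m > 0"
  shows "predictor m p x = spm_field u0 N a h m p x + \<tau> * f (real m * \<tau>) x (spm_field u0 N a h m p x) 0"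
  using assms grad_indep time_in[OF time_mono[OF n assms(1)]]
  by (auto simp: predictor_def spm_predictor_def gradient_independent_def)

lemma meas_predictor:
  assumes m: "m \<le> n"
  shows "case_prod (predictor m) \<in> borel_measurable (PP \<Otimes>\<^sub>M borel)"
proof (cases "m = 0")
  case True
  have "source f 0 u0 \<in> borel_measurable borel"
    using smooth_decaying_imp(2)[OF smooth_source[of 0]] T_pos
    by (auto intro: borel_measurable_continuous_onI)
  note this[measurable]
  have "(\<lambda>z. u0 (snd z) + \<tau> * source f 0 u0 (snd z)) \<in> borel_measurable (PP \<Otimes>\<^sub>M borel)" by measurable
  then show ?thesis
    by (simp add: True predictor_def[abs_def] spm_predictor_def[abs_def] spm_field_def[abs_def] case_prod_beta')
next
  case False
  let ?v = "\<lambda>z. spm_field u0 N a h m (fst z) (snd z)"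
  have 1: "(\<lambda>(x, r, v). f (real m * \<tau>) x r v) \<in> borel_measurable borel"
    using f_measurable[OF time_in[OF time_mono[OF n m]]] .
  have 2: "(\<lambda>z. (snd z, ?v z, 0 :: real ^ 'd)) \<in> borel_measurable (PP \<Otimes>\<^sub>M borel)"
    by measurable
  have [measurable]: "(\<lambda>z. f (real m * \<tau>) (snd z) (?v z) 0) \<in> borel_measurable (PP \<Otimes>\<^sub>M borel)"
    using measurable_compose[OF 2 1] by simp
  have "(\<lambda>z. ?v z + \<tau> * f (real m * \<tau>) (snd z) (?v z) 0) \<in> borel_measurable (PP \<Otimes>\<^sub>M borel)"
    by measurable
  then show ?thesis
    using False by (simp add: case_prod_beta' predictor_eq[OF m])
qed

lemma meas_predictor' [measurable (raw)]:
  assumes "m \<le> n" "g \<in> L \<rightarrow>\<^sub>M PP" "k \<in> L \<rightarrow>\<^sub>M borel"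
  shows "(\<lambda>x. predictor m (g x) (k x)) \<in> borel_measurable L"
  using measurable_compose[OF measurable_Pair[OF assms(2,3)] meas_predictor[OF assms(1)]] by simp

lemma prob: "prob_space M"
  using draws_n by (simp add: spm_draws_def)

lemma meas_Y: "m < n \<Longrightarrow> i < N \<Longrightarrow> Y m i \<in> borel_measurable M"
  using draws_n by (simp add: spm_draws_def)

lemma particles_Suc:
  "spm_particles f b u0 \<tau> N a h (\<lambda>j i. Y j i \<omega>) (Suc m) i
    = (Y m i \<omega> - \<tau> *\<^sub>R b, l1_mass (predictor m (cloud m \<omega>)) * sgn (predictor m (cloud m \<omega>) (Y m i \<omega>)))"
  by (simp add: predictor_cloud sol_def spm_solution_def real_sgn_eq Let_def)

lemma meas_cloud: "m \<le> n \<Longrightarrow> cloud m \<in> M \<rightarrow>\<^sub>M PP"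
proof (induction m)
  case 0
  show ?case unfolding cloud_def by (rule measurable_restrict) simp
next
  case (Suc m)
  then have [measurable]: "cloud m \<in> M \<rightarrow>\<^sub>M PP" and m: "m \<le> n" "m < n" by auto
  show ?case
    unfolding cloud_def
  proof (rule measurable_restrict)
    fix i assume "i \<in> {..<N}"
    then have [measurable]: "Y m i \<in> borel_measurable M" using meas_Y m by simp
    note meas_predictor'[OF m(1), measurable]
    have [measurable]: "(\<lambda>\<omega>. l1_mass (predictor m (cloud m \<omega>))) \<in> borel_measurable M"
      unfolding l1_mass_def by measurable
    show "(\<lambda>\<omega>. spm_particles f b u0 \<tau> N a h (\<lambda>j i. Y j i \<omega>) (Suc m) i) \<in> M \<rightarrow>\<^sub>M borel"
      unfolding particles_Suc by measurable
  qed
qed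

lemma meas_sol:
  assumes m: "m \<le> n"
  shows "(\<lambda>z. sol m (fst z) (snd z)) \<in> borel_measurable (M \<Otimes>\<^sub>M borel)"
proof -
  note meas_cloud[OF m, measurable]
  have "(\<lambda>z. (cloud m (fst z), snd z)) \<in> M \<Otimes>\<^sub>M borel \<rightarrow>\<^sub>M PP \<Otimes>\<^sub>M (borel :: (real^'d) measure)" by measurable
  from measurable_compose[OF this meas_field[of m]] show ?thesis by (simp add: field_cloud)
qed

text \<open>The bound on the mass is the deterministic one, in which \<open>grad_cost h\<close> is
  1. The conditional law is the assumption on the draws, read as a statement about
  \<open>cloud\<close> and \<open>predictor\<close>.\<close>

lemma weighted_draws_step:
  assumes m: "m < n"
  obtains K where "weighted_draws M PP (cloud m) (predictor m) (Y m) N K"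
proof -
  from m have m': "m \<le> n" by simp
  obtain K where K: "K \<ge> 0" and KZ: "\<forall>N\<ge>1. \<forall>h>0. \<forall>a y.
    (\<integral>\<^sup>+x. ennreal \<bar>spm_predictor f \<tau> h m (spm_solution f b u0 \<tau> N a h y m) x\<bar> \<partial>lborel)
      \<le> ennreal (K * grad_cost h ^ m)"
    using spm_Z_bound[OF time_mono[OF n m']] by blast
  interpret prob_space M by (rule prob)
  have "weighted_draws M PP (cloud m) (predictor m) (Y m) N K"
  proof
    show "cloud m \<in> M \<rightarrow>\<^sub>M PP" by (rule meas_cloud[OF m'])
    show "case_prod (predictor m) \<in> borel_measurable (PP \<Otimes>\<^sub>M borel)" by (rule meas_predictor[OF m'])
    show "\<And>i. i < N \<Longrightarrow> Y m i \<in> borel_measurable M" by (rule meas_Y[OF m])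
    show "1 \<le> N" by (rule N)
    show "0 \<le> K" by (rule K)
    show "(\<integral>\<^sup>+x. ennreal \<bar>predictor m (cloud m \<omega>) x\<bar> \<partial>lborel) \<le> ennreal K" for \<omega>
      using KZ[rule_format, OF N h, of a "\<lambda>j i. Y j i \<omega>"]
      unfolding predictor_cloud sol_def grad_cost_eq_1 by simp
    fix S :: "nat \<Rightarrow> (real ^ 'd) set" assume "\<And>i. i < N \<Longrightarrow> S i \<in> sets borel"
    then have S: "\<forall>i<N. S i \<in> sets borel" by simp
    have "\<forall>m<n. \<forall>S. (\<forall>i<N. S i \<in> sets borel) \<longrightarrow>
        (AE \<omega> in M. spm_Z f b u0 \<tau> N a h (\<lambda>j i. Y j i \<omega>) m > 0 \<longrightarrow>
           real_cond_exp M (particle_algebra f b u0 \<tau> N a h M Y m)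
             (\<lambda>\<omega>'. \<Prod>i<N. indicator (S i) (Y m i \<omega>')) \<omega> =
           (\<Prod>i<N. LINT x:S i|lborel.
              spm_density f b u0 \<tau> N a h (\<lambda>j i. Y j i \<omega>) m x /
              spm_Z f b u0 \<tau> N a h (\<lambda>j i. Y j i \<omega>) m))"
      using draws_n unfolding spm_draws_def by (elim conjE)
    note step = this[THEN spec, THEN mp, OF m, THEN spec, THEN mp, OF S]
    have cloud: "(\<lambda>\<omega>. \<lambda>i\<in>{..<N}. spm_particles f b u0 \<tau> N a h (\<lambda>j i. Y j i \<omega>) m i) = cloud m"
      by (intro ext) (simp add: cloud_def)
    from step show "AE \<omega> in M. 0 < l1_mass (predictor m (cloud m \<omega>)) \<longrightarrow>
        real_cond_exp M (vimage_algebra (space M) (cloud m) PP) (\<lambda>\<omega>'. \<Prod>i<N. indicator (S i) (Y m i \<omega>')) \<omega> =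
        (\<Prod>i<N. LINT x:S i|lborel. \<bar>predictor m (cloud m \<omega>) x\<bar> / l1_mass (predictor m (cloud m \<omega>)))"
      unfolding particle_algebra_def cloud spm_density_def
        l1_mass_predictor_cloud sol_def[symmetric] predictor_cloud[symmetric] .
  qed
  then show ?thesis using that by blast
qed

text \<open>The Lawson-Euler step before transport. Since the particles undergo the same transport,
  exact and stochastic predictors can be compared at the same point.\<close>

definition "exact_predictor m y = U m y + \<tau> * source f (real m * \<tau>) (U m) y"

lemma U_Suc: "U (Suc m) x = exact_predictor m (x + \<tau> *\<^sub>R b)"
  by (simp add: exact_predictor_def transport_def)

text \<open>The Lipschitz condition in u alone. At m = 0 both predictors coincide, because the
  method starts from the exact datum with its exact gradient.\<close>

lemma predictor_error:
  assumes m: "m \<le> n"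
  shows "\<bar>predictor m (cloud m \<omega>) y - exact_predictor m y\<bar> \<le> (1 + \<tau> * Lf) * \<bar>sol m \<omega> y - U m y\<bar>"
proof (cases "m = 0")
  case True
  then show ?thesis
    using \<tau>_pos Lf_pos
    by (simp add: predictor_cloud exact_predictor_def spm_predictor_def sol_def spm_solution_def spm_field_def)
next
  case False
  let ?t = "real m * \<tau>"
  have t: "?t \<in> {0..T}" by (rule time_in[OF time_mono[OF n m]])
  have "\<bar>f ?t y (sol m \<omega> y) 0 - source f ?t (U m) y\<bar> \<le> Lf * \<bar>sol m \<omega> y - U m y\<bar>"
    unfolding source_def by (rule gradient_independent_lipschitz[OF grad_indep t])
  then have "\<tau> * \<bar>f ?t y (sol m \<omega> y) 0 - source f ?t (U m) y\<bar> \<le> \<tau> * (Lf * \<bar>sol m \<omega> y - U m y\<bar>)"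
    using \<tau>_pos by (intro mult_left_mono) auto
  moreover have "predictor m (cloud m \<omega>) y - exact_predictor m y
      = (sol m \<omega> y - U m y) + \<tau> * (f ?t y (sol m \<omega> y) 0 - source f ?t (U m) y)"
    using False by (simp add: predictor_eq[OF m] field_cloud exact_predictor_def algebra_simps)
  moreover have "\<bar>\<tau> * (f ?t y (sol m \<omega> y) 0 - source f ?t (U m) y)\<bar>
      = \<tau> * \<bar>f ?t y (sol m \<omega> y) 0 - source f ?t (U m) y\<bar>"
    using \<tau>_pos by (simp add: abs_mult)
  ultimately have "\<bar>predictor m (cloud m \<omega>) y - exact_predictor m y\<bar>
      \<le> \<bar>sol m \<omega> y - U m y\<bar> + \<tau> * (Lf * \<bar>sol m \<omega> y - U m y\<bar>)"
    by linarith
  then show ?thesis by (simp add: algebra_simps)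
qed

section \<open>Propagation of the mean square error over one step\<close>

definition "error_sq m = (\<integral>\<^sup>+\<omega>. l2_norm_sq (\<lambda>x. U m x - sol m \<omega> x) \<partial>M)"

text \<open>For fixed x the new field is a normalized sum of samples, so its error is a bias plus a
  variance. The bias is split at the cell average of the exact solution; integration over x then
  turns the integrals over cells into integrals over the whole space.\<close>

lemma error_step:
  assumes m: "m < n" and h1: "h \<le> 1" and K: "K \<ge> 0"
    and K_inc: "\<And>x z. norm (z - x) \<le> real CARD('d) \<Longrightarrow>
      \<bar>U (Suc m) z - U (Suc m) x\<bar> \<le> K * norm (z - x) * decay_weight x"
  shows "error_sq (Suc m) \<le> ennreal ((1 + \<tau> * Lf\<^sup>2) * (1 + \<tau> * Lf)\<^sup>2) * error_sq m
    + ennreal ((LINT \<omega>|M. (spm_Z f b u0 \<tau> N a h (\<lambda>k i. Y k i \<omega>) m)\<^sup>2) / (real N * h ^ CARD('d))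
      + (1 + 1 / (\<tau> * Lf\<^sup>2)) * (K * real CARD('d))\<^sup>2 * (LINT x|lborel. decay_weight (x::real^'d)) * h\<^sup>2)"
proof -
  have m': "m \<le> n" "Suc m \<le> n" using m by auto
  obtain K0 where "weighted_draws M PP (cloud m) (predictor m) (Y m) N K0"
    using weighted_draws_step[OF m] .
  then interpret D: weighted_draws M PP "cloud m" "predictor m" "Y m" N K0 .
  interpret pair_sigma_finite M "lborel :: (real ^ 'd) measure" ..
  define s where "s = h ^ CARD('d)"
  define d where "d = real CARD('d)"
  \<comment> \<open>The parameter in Young's inequality. Being proportional to \<tau>, it costs a
    factor at most exp (\<tau> Lf^2) per step on the propagated error; the factor 1 + 1 / \<delta>
    falls on the projection error.\<close>
  define \<delta> where "\<delta> = \<tau> * Lf\<^sup>2"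
  define W where "W = (LINT x|lborel. decay_weight (x::real^'d))"
  \<comment> \<open>The cell of x moved back along the transport: a particle ends in the cell of x
    exactly if its draw lies in \<open>S x\<close>.\<close>
  define S where "S x = {y. y - \<tau> *\<^sub>R b \<in> cell_of a h x}" for x
  define L where "L = (1 + \<tau> * Lf)\<^sup>2"
  have s: "s > 0" using h by (simp add: s_def)
  have Np: "real N > 0" using N by simp
  have \<delta>: "\<delta> > 0" using \<tau>_pos Lf_pos by (simp add: \<delta>_def)
  have W: "W \<ge> 0" unfolding W_def by (rule lborel_integral_decay_weight_nonneg)
  have L: "L \<ge> 0" by (simp add: L_def)
  have S_meas[measurable]: "S x \<in> sets borel" for x
  proof -
    have "S x = (\<lambda>y. y - \<tau> *\<^sub>R b) -` cell_of a h x \<inter> space borel" by (auto simp: S_def)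
    also have "\<dots> \<in> sets borel"
      by (rule measurable_sets[where A = borel]) (use h in measurable)
    finally show ?thesis .
  qed
  have ind_S: "indicator (S x) y = indicator (cell_of a h x) (y - \<tau> *\<^sub>R b)" for x y
    by (simp add: S_def indicator_def)
  have em_S: "emeasure lborel (S x) = ennreal s" for x
  proof -
    have c: "(indicator (cell_of a h x) :: real ^ 'd \<Rightarrow> ennreal) \<in> borel_measurable borel"
      using h by measurable
    have "emeasure lborel (S x) = (\<integral>\<^sup>+y. indicator (S x) y \<partial>lborel)" by simp
    also have "\<dots> = (\<integral>\<^sup>+y. indicator (cell_of a h x) (y + - (\<tau> *\<^sub>R b)) \<partial>lborel)"
      by (simp add: ind_S)
    also have "\<dots> = (\<integral>\<^sup>+y. indicator (cell_of a h x) y \<partial>lborel)"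
      by (rule nn_integral_lborel_translation[OF c])
    also have "\<dots> = ennreal s" using h by (simp add: emeasure_grid_cell s_def)
    finally show ?thesis .
  qed
  have int_S: "integrable lborel (indicator (S x) :: real ^ 'd \<Rightarrow> real)"
    and int_S_eq: "(LINT y|lborel. indicator (S x) y) = s" for x
    using em_S[of x] s by (auto simp: measure_def)
  note meas_U[OF m'(1), measurable] meas_U[OF m'(2), measurable]
    meas_sol[OF m'(1), measurable] meas_sol[OF m'(2), measurable]
  have exact_eq: "exact_predictor m = (\<lambda>y. U (Suc m) (y - \<tau> *\<^sub>R b))"
    unfolding U_Suc by simp
  have exact_meas[measurable]: "exact_predictor m \<in> borel_measurable borel"
    unfolding exact_eq by measurable
  have exact_int: "integrable lborel (\<lambda>y. indicator (S x) y * exact_predictor m y)" for x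
  proof -
    obtain C where C: "C \<ge> 0" "\<And>x. \<bar>U (Suc m) x\<bar> \<le> C * decay_weight x"
      using smooth_decaying_bound[OF smooth_U[OF time_mono[OF n m'(2)]]] by metis
    have "\<bar>exact_predictor m y\<bar> \<le> C" for y
      unfolding exact_eq using C(2)[of "y - \<tau> *\<^sub>R b"] C(1) decay_weight_le_1[of "y - \<tau> *\<^sub>R b"]
      by (meson mult_left_le order_trans)
    then show ?thesis
      by (intro Bochner_Integration.integrable_bound[OF integrable_mult_right[OF int_S[of x], of C]])
        (auto simp: abs_mult intro!: AE_I2 order_trans[OF _ abs_ge_self] split: split_indicator)
  qed
  \<comment> \<open>After the shift this is the average of the next Lawson-Euler solution over the
    cell of x, the value between the conditional mean of the new field and U at x.\<close>
  define avg where "avg x = (LINT y|lborel. indicator (S x) y * exact_predictor m y) / s" for x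
  have avg_error: "(avg x - U (Suc m) x)\<^sup>2 \<le> (K * d)\<^sup>2 * h\<^sup>2 * decay_weight x" for x
  proof -
    have pt: "\<bar>indicator (S x) y * (exact_predictor m y - U (Suc m) x)\<bar>
        \<le> indicator (S x) y * (K * (d * h) * decay_weight x)" for y
    proof (cases "y \<in> S x")
      case True
      then have "norm (y - \<tau> *\<^sub>R b - x) \<le> d * h"
        using norm_diff_cell_of[OF h] by (auto simp: S_def d_def)
      \<comment> \<open>Here h \<le> 1 enters: all of the cell lies within the radius d for which
        the increment bound holds.\<close>
      moreover have "d * h \<le> real CARD('d)"
        using h1 h by (simp add: d_def mult_left_le)
      ultimately have "\<bar>U (Suc m) (y - \<tau> *\<^sub>R b) - U (Suc m) x\<bar> \<le> K * norm (y - \<tau> *\<^sub>R b - x) * decay_weight x"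
        by (intro K_inc) auto
      also have "\<dots> \<le> K * (d * h) * decay_weight x"
        using K \<open>norm (y - \<tau> *\<^sub>R b - x) \<le> d * h\<close> less_imp_le[OF decay_weight_pos[of x]]
        by (intro mult_right_mono mult_left_mono)
      finally show ?thesis using True by (simp add: exact_eq)
    qed simp
    have "avg x - U (Suc m) x = (LINT y|lborel. indicator (S x) y * (exact_predictor m y - U (Suc m) x)) / s"
    proof -
      have "(LINT y|lborel. indicator (S x) y * (exact_predictor m y - U (Suc m) x))
        = (LINT y|lborel. indicator (S x) y * exact_predictor m y - indicator (S x) y * U (Suc m) x)"
        by (simp add: right_diff_distrib)
      also have "\<dots> = (LINT y|lborel. indicator (S x) y * exact_predictor m y) - s * U (Suc m) x"
        using exact_int[of x] int_S[of x] by (simp only: Bochner_Integration.integral_diff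
            integrable_mult_left integral_mult_left_zero int_S_eq)
      finally show ?thesis using s by (simp add: avg_def diff_divide_distrib)
    qed
    also have "\<bar>\<dots>\<bar> \<le> (LINT y|lborel. indicator (S x) y * (K * (d * h) * decay_weight x)) / s"
    proof -
      have "\<bar>LINT y|lborel. indicator (S x) y * (exact_predictor m y - U (Suc m) x)\<bar>
        \<le> (LINT y|lborel. indicator (S x) y * (K * (d * h) * decay_weight x))"
      proof (rule order_trans[OF integral_abs_bound], rule integral_mono')
        have "0 \<le> K * (d * h) * decay_weight x"
          using K h less_imp_le[OF decay_weight_pos[of x]] by (simp add: d_def)
        then show "0 \<le> indicator (S x) y * (K * (d * h) * decay_weight x)" for y by simp
      qed (use pt int_S in \<open>auto intro!: integrable_mult_left\<close>)
      then show ?thesis using s by (simp add: divide_right_mono)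
    qed
    also have "\<dots> = K * (d * h) * decay_weight x"
      using s by (simp only: integral_mult_left_zero int_S_eq) simp
    finally have "(avg x - U (Suc m) x)\<^sup>2 \<le> (K * (d * h) * decay_weight x)\<^sup>2"
      by (simp add: abs_le_square_iff[THEN iffD1] abs_of_nonneg)
    also have "\<dots> = (K * d)\<^sup>2 * h\<^sup>2 * (decay_weight x)\<^sup>2" by (simp add: power_mult_distrib)
    also have "\<dots> \<le> (K * d)\<^sup>2 * h\<^sup>2 * decay_weight x"
      using decay_weight_le_1[of x] less_imp_le[OF decay_weight_pos[of x]]
      by (intro mult_left_mono) (auto simp: power2_eq_square mult_left_le)
    finally show ?thesis .
  qed
  \<comment> \<open>Propagated error and variance are both integrals over the cell of x. Joined in
    one integrand, they are integrated over x in a single application of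
    \<open>nn_integral_cells\<close>.\<close>
  let ?G = "\<lambda>z. ennreal ((1 + \<delta>) * L / s) * ennreal ((U m (snd z) - sol m (fst z) (snd z))\<^sup>2)
    + ennreal (D.Z (fst z) / (real N * s\<^sup>2)) * ennreal \<bar>predictor m (cloud m (fst z)) (snd z)\<bar>"
  have G_meas[measurable]: "?G \<in> borel_measurable (M \<Otimes>\<^sub>M borel)" by measurable
  have sol_Suc: "sol (Suc m) \<omega> x = (\<Sum>i<N. D.sample (S x) i \<omega>) / (real N * s)" for \<omega> x
  proof -
    have "sol (Suc m) \<omega> x = particle_projection N a h (spm_particles f b u0 \<tau> N a h (\<lambda>j i. Y j i \<omega>) (Suc m)) x"
      by (simp only: sol_def spm_solution_def spm_field_def nat.distinct if_False)
    also have "\<dots> = (\<Sum>i<N. D.sample (S x) i \<omega>) / (real N * s)"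
      unfolding particle_projection_eq[OF h] particles_Suc D.sample_def D.Z_def s_def
      by (simp add: ind_S mult.assoc)
    finally show ?thesis .
  qed
  have flux_error: "ennreal ((D.flux (S x) \<omega> / s - U (Suc m) x)\<^sup>2)
      \<le> (\<integral>\<^sup>+y. ennreal ((1 + \<delta>) * L / s) * ennreal ((U m y - sol m \<omega> y)\<^sup>2) * indicator (S x) y \<partial>lborel)
        + ennreal ((1 + 1 / \<delta>) * (K * d)\<^sup>2 * h\<^sup>2 * decay_weight x)" if \<omega>: "\<omega> \<in> space M" for \<omega> x
  proof -
    have [measurable]: "cloud m \<omega> \<in> space PP" using \<omega> by (rule measurable_space[OF D.meas_\<pi>])
    have pm[measurable]: "predictor m (cloud m \<omega>) \<in> borel_measurable borel" by measurable
    have sm[measurable]: "sol m \<omega> \<in> borel_measurable borel"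
      using measurable_compose[OF measurable_Pair1'[OF \<omega>] meas_sol[OF m'(1)]] by simp
    let ?e = "\<lambda>y. predictor m (cloud m \<omega>) y - exact_predictor m y"
    have int: "integrable lborel (\<lambda>y. indicator (S x) y * ?e y)"
      using D.integrable_indicator_\<Phi>(2)[OF \<omega> S_meas[of x]] exact_int[of x]
      by (simp add: right_diff_distrib)
    have "D.flux (S x) \<omega> / s - avg x = (LINT y|lborel. indicator (S x) y * ?e y) / s"
      using D.integrable_indicator_\<Phi>(2)[OF \<omega> S_meas[of x]] exact_int[of x]
      by (simp add: right_diff_distrib D.flux_def avg_def diff_divide_distrib)
    then have "ennreal ((D.flux (S x) \<omega> / s - avg x)\<^sup>2)
      \<le> ennreal (1 / s) * (\<integral>\<^sup>+y. ennreal ((?e y)\<^sup>2) * indicator (S x) y \<partial>lborel)"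
      using square_average_le[OF _ S_meas em_S s int] by simp
    also have "\<dots> \<le> ennreal (1 / s) * (\<integral>\<^sup>+y. ennreal L * (ennreal ((U m y - sol m \<omega> y)\<^sup>2) * indicator (S x) y) \<partial>lborel)"
    proof (intro mult_left_mono nn_integral_mono)
      fix y
      have "\<bar>?e y\<bar>\<^sup>2 \<le> ((1 + \<tau> * Lf) * \<bar>sol m \<omega> y - U m y\<bar>)\<^sup>2"
        by (intro power_mono predictor_error[OF m'(1)]) auto
      then have "(?e y)\<^sup>2 \<le> L * (U m y - sol m \<omega> y)\<^sup>2"
        by (simp add: L_def power_mult_distrib power2_commute)
      then have "ennreal ((?e y)\<^sup>2) \<le> ennreal L * ennreal ((U m y - sol m \<omega> y)\<^sup>2)"
        using L by (simp add: ennreal_mult[symmetric] ennreal_leI)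
      then show "ennreal ((?e y)\<^sup>2) * indicator (S x) y
          \<le> ennreal L * (ennreal ((U m y - sol m \<omega> y)\<^sup>2) * indicator (S x) y)"
        by (simp split: split_indicator)
    qed simp
    also have "\<dots> = ennreal (1 / s) * ennreal L * (\<integral>\<^sup>+y. ennreal ((U m y - sol m \<omega> y)\<^sup>2) * indicator (S x) y \<partial>lborel)"
      by (subst nn_integral_cmult) (auto simp: mult.assoc)
    finally have A: "ennreal ((D.flux (S x) \<omega> / s - avg x)\<^sup>2) \<le> \<dots>" .
    have "(D.flux (S x) \<omega> / s - U (Suc m) x)\<^sup>2
        \<le> (1 + \<delta>) * (D.flux (S x) \<omega> / s - avg x)\<^sup>2 + (1 + 1 / \<delta>) * (avg x - U (Suc m) x)\<^sup>2"
      using young_square[OF \<delta>, of "D.flux (S x) \<omega> / s - avg x" "avg x - U (Suc m) x"] by simp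
    also have "\<dots> \<le> (1 + \<delta>) * (D.flux (S x) \<omega> / s - avg x)\<^sup>2
        + (1 + 1 / \<delta>) * ((K * d)\<^sup>2 * h\<^sup>2 * decay_weight x)"
      using \<delta> by (intro add_left_mono mult_left_mono avg_error) auto
    finally have "ennreal ((D.flux (S x) \<omega> / s - U (Suc m) x)\<^sup>2)
      \<le> ennreal ((1 + \<delta>) * (D.flux (S x) \<omega> / s - avg x)\<^sup>2 + (1 + 1 / \<delta>) * ((K * d)\<^sup>2 * h\<^sup>2 * decay_weight x))"
      by (rule ennreal_leI)
    also have "\<dots> = ennreal (1 + \<delta>) * ennreal ((D.flux (S x) \<omega> / s - avg x)\<^sup>2)
        + ennreal ((1 + 1 / \<delta>) * (K * d)\<^sup>2 * h\<^sup>2 * decay_weight x)"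
      using \<delta> less_imp_le[OF decay_weight_pos[of x]]
      by (subst ennreal_plus) (auto simp: ennreal_mult mult.assoc)
    also have "\<dots> \<le> ennreal (1 + \<delta>) * (ennreal (1 / s) * ennreal L
          * (\<integral>\<^sup>+y. ennreal ((U m y - sol m \<omega> y)\<^sup>2) * indicator (S x) y \<partial>lborel))
        + ennreal ((1 + 1 / \<delta>) * (K * d)\<^sup>2 * h\<^sup>2 * decay_weight x)"
      by (intro add_right_mono mult_left_mono A) auto
    also have "ennreal (1 + \<delta>) * (ennreal (1 / s) * ennreal L
          * (\<integral>\<^sup>+y. ennreal ((U m y - sol m \<omega> y)\<^sup>2) * indicator (S x) y \<partial>lborel))
        = ennreal ((1 + \<delta>) * L / s) * (\<integral>\<^sup>+y. ennreal ((U m y - sol m \<omega> y)\<^sup>2) * indicator (S x) y \<partial>lborel)"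
    proof -
      have "ennreal (1 + \<delta>) * (ennreal (1 / s) * ennreal L) = ennreal ((1 + \<delta>) * L / s)"
        using \<delta> s L ennreal_mult[of "1 + \<delta>" "1 / s * L"] ennreal_mult[of "1 / s" L]
        by (simp del: ennreal_plus)
      then show ?thesis by (simp only: mult.assoc[symmetric])
    qed
    also have "\<dots> = (\<integral>\<^sup>+y. ennreal ((1 + \<delta>) * L / s) * ennreal ((U m y - sol m \<omega> y)\<^sup>2) * indicator (S x) y \<partial>lborel)"
      by (subst nn_integral_cmult[symmetric]) (auto simp: mult.assoc)
    finally show ?thesis .
  qed
  have point: "(\<integral>\<^sup>+\<omega>. ennreal ((U (Suc m) x - sol (Suc m) \<omega> x)\<^sup>2) \<partial>M)
      \<le> (\<integral>\<^sup>+\<omega>. (\<integral>\<^sup>+y. ?G (\<omega>, y) * indicator (cell_of a h x) (y - \<tau> *\<^sub>R b) \<partial>lborel) \<partial>M)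
        + ennreal ((1 + 1 / \<delta>) * (K * d)\<^sup>2 * h\<^sup>2 * decay_weight x)" for x
  proof -
    let ?r = "ennreal ((1 + 1 / \<delta>) * (K * d)\<^sup>2 * h\<^sup>2 * decay_weight x)"
    have "(\<integral>\<^sup>+\<omega>. ennreal ((U (Suc m) x - sol (Suc m) \<omega> x)\<^sup>2) \<partial>M)
      = (\<integral>\<^sup>+\<omega>. ennreal (((\<Sum>i<N. D.sample (S x) i \<omega>) / (real N * s) - U (Suc m) x)\<^sup>2) \<partial>M)"
      by (simp only: sol_Suc power2_commute)
    also have "\<dots> \<le> (\<integral>\<^sup>+\<omega>. ennreal ((D.flux (S x) \<omega> / s - U (Suc m) x)\<^sup>2) \<partial>M)
        + (\<integral>\<^sup>+\<omega>. ennreal (D.Z \<omega> * D.mass (S x) \<omega> / (real N * s\<^sup>2)) \<partial>M)"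
      by (rule D.nn_expectation_square_error[OF S_meas s])
    also have "\<dots> = (\<integral>\<^sup>+\<omega>. ennreal ((D.flux (S x) \<omega> / s - U (Suc m) x)\<^sup>2)
        + ennreal (D.Z \<omega> * D.mass (S x) \<omega> / (real N * s\<^sup>2)) \<partial>M)"
      by (rule nn_integral_add[symmetric]) measurable
    also have "\<dots> \<le> (\<integral>\<^sup>+\<omega>. (\<integral>\<^sup>+y. ?G (\<omega>, y) * indicator (cell_of a h x) (y - \<tau> *\<^sub>R b) \<partial>lborel) + ?r \<partial>M)"
    proof (intro nn_integral_mono)
      fix \<omega> assume \<omega>: "\<omega> \<in> space M"
      have [measurable]: "cloud m \<omega> \<in> space PP" using \<omega> by (rule measurable_space[OF D.meas_\<pi>])
      have pm[measurable]: "predictor m (cloud m \<omega>) \<in> borel_measurable borel" by measurable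
      have sm[measurable]: "sol m \<omega> \<in> borel_measurable borel"
        using measurable_compose[OF measurable_Pair1'[OF \<omega>] meas_sol[OF m'(1)]] by simp
      let ?A = "\<lambda>y. ennreal ((1 + \<delta>) * L / s) * ennreal ((U m y - sol m \<omega> y)\<^sup>2) * indicator (S x) y"
      let ?B = "\<lambda>y. ennreal (D.Z \<omega> / (real N * s\<^sup>2)) * (ennreal \<bar>predictor m (cloud m \<omega>) y\<bar> * indicator (S x) y)"
      have B: "ennreal (D.Z \<omega> * D.mass (S x) \<omega> / (real N * s\<^sup>2)) = (\<integral>\<^sup>+y. ?B y \<partial>lborel)"
      proof -
        have "(\<integral>\<^sup>+y. ?B y \<partial>lborel) = ennreal (D.Z \<omega> / (real N * s\<^sup>2)) * ennreal (D.mass (S x) \<omega>)"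
          by (subst nn_integral_cmult) (auto simp: D.nn_integral_mass[OF \<omega> S_meas])
        also have "\<dots> = ennreal (D.Z \<omega> * D.mass (S x) \<omega> / (real N * s\<^sup>2))"
          using D.Z_nonneg D.mass_nonneg s by (subst ennreal_mult[symmetric]) auto
        finally show ?thesis ..
      qed
      have "(\<integral>\<^sup>+y. ?A y \<partial>lborel) + (\<integral>\<^sup>+y. ?B y \<partial>lborel) = (\<integral>\<^sup>+y. ?A y + ?B y \<partial>lborel)"
        by (rule nn_integral_add[symmetric]) measurable
      also have "\<dots> = (\<integral>\<^sup>+y. ?G (\<omega>, y) * indicator (cell_of a h x) (y - \<tau> *\<^sub>R b) \<partial>lborel)"
        by (intro nn_integral_cong) (simp add: ind_S distrib_right mult.assoc)
      finally have AB: "(\<integral>\<^sup>+y. ?A y \<partial>lborel) + (\<integral>\<^sup>+y. ?B y \<partial>lborel)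
          = (\<integral>\<^sup>+y. ?G (\<omega>, y) * indicator (cell_of a h x) (y - \<tau> *\<^sub>R b) \<partial>lborel)" .
      have "ennreal ((D.flux (S x) \<omega> / s - U (Suc m) x)\<^sup>2) + (\<integral>\<^sup>+y. ?B y \<partial>lborel)
          \<le> ((\<integral>\<^sup>+y. ?A y \<partial>lborel) + ?r) + (\<integral>\<^sup>+y. ?B y \<partial>lborel)"
        by (intro add_right_mono flux_error[OF \<omega>])
      also have "\<dots> = ((\<integral>\<^sup>+y. ?A y \<partial>lborel) + (\<integral>\<^sup>+y. ?B y \<partial>lborel)) + ?r"
        by (simp only: add_ac)
      finally show "ennreal ((D.flux (S x) \<omega> / s - U (Suc m) x)\<^sup>2) + ennreal (D.Z \<omega> * D.mass (S x) \<omega> / (real N * s\<^sup>2))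
        \<le> (\<integral>\<^sup>+y. ?G (\<omega>, y) * indicator (cell_of a h x) (y - \<tau> *\<^sub>R b) \<partial>lborel) + ?r"
        unfolding B AB .
    qed
    also have "\<dots> = (\<integral>\<^sup>+\<omega>. (\<integral>\<^sup>+y. ?G (\<omega>, y) * indicator (cell_of a h x) (y - \<tau> *\<^sub>R b) \<partial>lborel) \<partial>M) + (\<integral>\<^sup>+\<omega>. ?r \<partial>M)"
    proof (rule nn_integral_add)
      have "(\<lambda>z. ?G z * indicator (S x) (snd z)) \<in> borel_measurable (M \<Otimes>\<^sub>M lborel)" by measurable
      from lborel.borel_measurable_nn_integral_fst[OF this]
      show "(\<lambda>\<omega>. \<integral>\<^sup>+y. ?G (\<omega>, y) * indicator (cell_of a h x) (y - \<tau> *\<^sub>R b) \<partial>lborel) \<in> borel_measurable M"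
        by (simp only: snd_conv ind_S)
    qed simp
    finally show ?thesis by (simp add: D.emeasure_space_1)
  qed
  have "error_sq (Suc m) = (\<integral>\<^sup>+\<omega>. (\<integral>\<^sup>+x. ennreal ((U (Suc m) x - sol (Suc m) \<omega> x)\<^sup>2) \<partial>lborel) \<partial>M)"
    by (simp add: error_sq_def l2_norm_sq_def)
  \<comment> \<open>The expectation goes inside, since the bound \<open>point\<close> is available
    for each fixed x.\<close>
  also have "\<dots> = (\<integral>\<^sup>+x. (\<integral>\<^sup>+\<omega>. ennreal ((U (Suc m) x - sol (Suc m) \<omega> x)\<^sup>2) \<partial>M) \<partial>lborel)"
    by (rule Fubini'[symmetric]) (simp only: case_prod_beta', measurable)
  also have "\<dots> \<le> (\<integral>\<^sup>+x. (\<integral>\<^sup>+\<omega>. (\<integral>\<^sup>+y. ?G (\<omega>, y) * indicator (cell_of a h x) (y - \<tau> *\<^sub>R b) \<partial>lborel) \<partial>M)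
        + ennreal ((1 + 1 / \<delta>) * (K * d)\<^sup>2 * h\<^sup>2) * ennreal (decay_weight x) \<partial>lborel)"
  proof (rule nn_integral_mono)
    fix x :: "real ^ 'd"
    have eq: "ennreal ((1 + 1 / \<delta>) * (K * d)\<^sup>2 * h\<^sup>2 * decay_weight x)
        = ennreal ((1 + 1 / \<delta>) * (K * d)\<^sup>2 * h\<^sup>2) * ennreal (decay_weight x)"
      using \<delta> less_imp_le[OF decay_weight_pos[of x]] by (intro ennreal_mult) auto
    show "(\<integral>\<^sup>+\<omega>. ennreal ((U (Suc m) x - sol (Suc m) \<omega> x)\<^sup>2) \<partial>M)
      \<le> (\<integral>\<^sup>+\<omega>. (\<integral>\<^sup>+y. ?G (\<omega>, y) * indicator (cell_of a h x) (y - \<tau> *\<^sub>R b) \<partial>lborel) \<partial>M)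
        + ennreal ((1 + 1 / \<delta>) * (K * d)\<^sup>2 * h\<^sup>2) * ennreal (decay_weight x)"
      using point[of x] unfolding eq .
  qed
  also have "\<dots> = (\<integral>\<^sup>+x. (\<integral>\<^sup>+\<omega>. (\<integral>\<^sup>+y. ?G (\<omega>, y) * indicator (cell_of a h x) (y - \<tau> *\<^sub>R b) \<partial>lborel) \<partial>M) \<partial>lborel)
        + (\<integral>\<^sup>+x. ennreal ((1 + 1 / \<delta>) * (K * d)\<^sup>2 * h\<^sup>2) * ennreal (decay_weight (x::real^'d)) \<partial>lborel)"
  proof (rule nn_integral_add)
    note eq = indicator_cell_of[OF h, of a]
    show "(\<lambda>x. \<integral>\<^sup>+\<omega>. (\<integral>\<^sup>+y. ?G (\<omega>, y) * indicator (cell_of a h x) (y - \<tau> *\<^sub>R b) \<partial>lborel) \<partial>M) \<in> borel_measurable lborel"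
      unfolding eq by measurable
  qed measurable
  also have "(\<integral>\<^sup>+x. ennreal ((1 + 1 / \<delta>) * (K * d)\<^sup>2 * h\<^sup>2) * ennreal (decay_weight (x::real^'d)) \<partial>lborel)
      = ennreal ((1 + 1 / \<delta>) * (K * d)\<^sup>2 * W * h\<^sup>2)"
  proof -
    have "(\<integral>\<^sup>+x. ennreal (decay_weight (x::real^'d)) \<partial>lborel) = ennreal W"
      unfolding W_def using integrable_decay_weight
      by (intro nn_integral_eq_integral) (auto simp: less_imp_le decay_weight_pos)
    then show ?thesis
      using \<delta> W by (subst nn_integral_cmult) (auto simp: ennreal_mult[symmetric] mult_ac)
  qed
  \<comment> \<open>The volume s of a cell appears in front. It cancels the 1 / s of the propagated
    error completely and one of the two factors 1 / s of the variance, which leaves E Z^2 / (N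
    h^d).\<close>
  also have "(\<integral>\<^sup>+x. (\<integral>\<^sup>+\<omega>. (\<integral>\<^sup>+y. ?G (\<omega>, y) * indicator (cell_of a h x) (y - \<tau> *\<^sub>R b) \<partial>lborel) \<partial>M) \<partial>lborel)
      = ennreal s * (\<integral>\<^sup>+\<omega>. (\<integral>\<^sup>+y. ?G (\<omega>, y) \<partial>lborel) \<partial>M)"
    unfolding s_def by (rule nn_integral_cells[OF D.sigma_finite_measure_axioms G_meas[unfolded s_def] h])
  also have "(\<integral>\<^sup>+\<omega>. (\<integral>\<^sup>+y. ?G (\<omega>, y) \<partial>lborel) \<partial>M)
      = (\<integral>\<^sup>+\<omega>. ennreal ((1 + \<delta>) * L / s) * l2_norm_sq (\<lambda>x. U m x - sol m \<omega> x)
          + ennreal ((D.Z \<omega>)\<^sup>2 / (real N * s\<^sup>2)) \<partial>M)"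
  proof (intro nn_integral_cong)
    fix \<omega> assume \<omega>: "\<omega> \<in> space M"
    have [measurable]: "cloud m \<omega> \<in> space PP" using \<omega> by (rule measurable_space[OF D.meas_\<pi>])
    have pm[measurable]: "predictor m (cloud m \<omega>) \<in> borel_measurable borel" by measurable
    have sm[measurable]: "sol m \<omega> \<in> borel_measurable borel"
      using measurable_compose[OF measurable_Pair1'[OF \<omega>] meas_sol[OF m'(1)]] by simp
    have "(\<integral>\<^sup>+y. ?G (\<omega>, y) \<partial>lborel)
      = ennreal ((1 + \<delta>) * L / s) * l2_norm_sq (\<lambda>x. U m x - sol m \<omega> x)
        + ennreal (D.Z \<omega> / (real N * s\<^sup>2)) * (\<integral>\<^sup>+y. ennreal \<bar>predictor m (cloud m \<omega>) y\<bar> \<partial>lborel)"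
      by (simp add: l2_norm_sq_def nn_integral_add nn_integral_cmult)
    also have "(\<integral>\<^sup>+y. ennreal \<bar>predictor m (cloud m \<omega>) y\<bar> \<partial>lborel) = ennreal (D.Z \<omega>)"
      using D.nn_integral_mass[OF \<omega>, of UNIV] by (simp add: D.mass_UNIV)
    also have "ennreal (D.Z \<omega> / (real N * s\<^sup>2)) * ennreal (D.Z \<omega>) = ennreal ((D.Z \<omega>)\<^sup>2 / (real N * s\<^sup>2))"
      using D.Z_nonneg s by (subst ennreal_mult[symmetric]) (auto simp: power2_eq_square)
    finally show "(\<integral>\<^sup>+y. ?G (\<omega>, y) \<partial>lborel) = ennreal ((1 + \<delta>) * L / s) * l2_norm_sq (\<lambda>x. U m x - sol m \<omega> x)
          + ennreal ((D.Z \<omega>)\<^sup>2 / (real N * s\<^sup>2))" .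
  qed
  also have "\<dots> = ennreal ((1 + \<delta>) * L / s) * error_sq m + ennreal ((LINT \<omega>|M. (D.Z \<omega>)\<^sup>2) / (real N * s\<^sup>2))"
  proof -
    have [measurable]: "(\<lambda>\<omega>. l2_norm_sq (\<lambda>x. U m x - sol m \<omega> x)) \<in> borel_measurable M"
      unfolding l2_norm_sq_def by measurable
    have "(\<integral>\<^sup>+\<omega>. ennreal ((D.Z \<omega>)\<^sup>2 / (real N * s\<^sup>2)) \<partial>M) = ennreal (LINT \<omega>|M. (D.Z \<omega>)\<^sup>2 / (real N * s\<^sup>2))"
      using D.Z_nonneg D.Z_le
      by (intro D.nn_integral_eq_expectation[where B = "K0\<^sup>2 / (real N * s\<^sup>2)"])
        (auto intro!: divide_right_mono power_mono)
    then show ?thesis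
      unfolding error_sq_def by (subst nn_integral_add) (auto simp: nn_integral_cmult)
  qed
  also have "ennreal s * (ennreal ((1 + \<delta>) * L / s) * error_sq m + ennreal ((LINT \<omega>|M. (D.Z \<omega>)\<^sup>2) / (real N * s\<^sup>2)))
      = ennreal ((1 + \<delta>) * L) * error_sq m + ennreal ((LINT \<omega>|M. (D.Z \<omega>)\<^sup>2) / (real N * s))"
  proof -
    have "0 \<le> (LINT \<omega>|M. (D.Z \<omega>)\<^sup>2)" by (rule Bochner_Integration.integral_nonneg) simp
    then have "ennreal s * ennreal ((LINT \<omega>|M. (D.Z \<omega>)\<^sup>2) / (real N * s\<^sup>2)) = ennreal ((LINT \<omega>|M. (D.Z \<omega>)\<^sup>2) / (real N * s))"
      using s by (subst ennreal_mult[symmetric]) (auto simp: power2_eq_square)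
    moreover have "ennreal s * ennreal ((1 + \<delta>) * L / s) = ennreal ((1 + \<delta>) * L)"
      using s L \<delta> by (subst ennreal_mult[symmetric]) auto
    ultimately show ?thesis by (simp only: distrib_left mult.assoc[symmetric])
  qed
  finally have "error_sq (Suc m) \<le> ennreal ((1 + \<delta>) * L) * error_sq m
      + ennreal ((LINT \<omega>|M. (D.Z \<omega>)\<^sup>2) / (real N * s)) + ennreal ((1 + 1 / \<delta>) * (K * d)\<^sup>2 * W * h\<^sup>2)" .
  moreover have "ennreal ((LINT \<omega>|M. (D.Z \<omega>)\<^sup>2) / (real N * s)) + ennreal ((1 + 1 / \<delta>) * (K * d)\<^sup>2 * W * h\<^sup>2)
      = ennreal ((LINT \<omega>|M. (D.Z \<omega>)\<^sup>2) / (real N * s) + (1 + 1 / \<delta>) * (K * d)\<^sup>2 * W * h\<^sup>2)"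
    using \<delta> W s by (intro ennreal_plus[symmetric] divide_nonneg_nonneg mult_nonneg_nonneg
        Bochner_Integration.integral_nonneg) auto
  ultimately show ?thesis
    unfolding D.Z_def l1_mass_predictor_cloud s_def d_def \<delta>_def W_def L_def by (simp only: add.assoc)
qed

end

section \<open>The error bound\<close>

context spm_problem begin

text \<open>From 2 \<tau> Lf \<le> \<tau> (1 + Lf^2) one has (1 + \<tau> Lf)^2 \<le> (1 + \<tau>) (1
  + \<tau> Lf^2). The factor 1 + \<tau> accounts for the 1 in B + 1, and the two factors 1 + \<tau>
  Lf^2 for 2 Lf^2 \<le> 2 A Lf^2.\<close>

lemma growth_factor_le:
  "(1 + \<tau> * Lf\<^sup>2) * (1 + \<tau> * Lf)\<^sup>2 \<le> exp (\<tau> * (2 * A * Lf\<^sup>2 + 1))"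
proof -
  have "2 * \<tau> * Lf \<le> \<tau> * (1 + Lf\<^sup>2)"
    using sum_squares_bound[of 1 Lf] \<tau>_pos by simp
  then have "(1 + \<tau> * Lf)\<^sup>2 \<le> (1 + \<tau>) * (1 + \<tau> * Lf\<^sup>2)"
    by (simp add: power2_eq_square algebra_simps)
  also have "\<dots> \<le> exp \<tau> * exp (\<tau> * Lf\<^sup>2)"
    using \<tau>_pos by (intro mult_mono exp_ge_add_one_self) auto
  finally have "(1 + \<tau> * Lf\<^sup>2) * (1 + \<tau> * Lf)\<^sup>2 \<le> exp (\<tau> * Lf\<^sup>2) * (exp \<tau> * exp (\<tau> * Lf\<^sup>2))"
    using \<tau>_pos by (intro mult_mono exp_ge_add_one_self) auto
  also have "\<dots> = exp (\<tau> * (2 * Lf\<^sup>2 + 1))"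
    by (simp add: exp_add[symmetric] algebra_simps)
  also have "\<dots> \<le> exp (\<tau> * (2 * A * Lf\<^sup>2 + 1))"
    using \<tau>_pos A_gt_1 mult_right_mono[of 1 A "Lf\<^sup>2"] by (auto intro!: mult_left_mono)
  finally show ?thesis .
qed

definition sampling_term :: "nat \<Rightarrow> real ^ 'd \<Rightarrow> real \<Rightarrow> 'w measure \<Rightarrow> (nat \<Rightarrow> nat \<Rightarrow> 'w \<Rightarrow> real ^ 'd) \<Rightarrow> nat \<Rightarrow> real" where
  "sampling_term N a h M Y j =
     (LINT \<omega>|M. (spm_Z f b u0 \<tau> N a h (\<lambda>k i. Y k i \<omega>) j)\<^sup>2) / (real N * h ^ CARD('d))"

lemma sampling_term_nonneg: "h > 0 \<Longrightarrow> 0 \<le> sampling_term N a h M Y j"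
  unfolding sampling_term_def
  by (intro divide_nonneg_nonneg Bochner_Integration.integral_nonneg) auto

text \<open>Discrete Gronwall argument for \<open>error_step\<close>, starting from error 0 at time
  0. Each new remainder is multiplied by an exponential that is at least 1, so one factor can stand
  in front of the whole sum.\<close>

lemma gradient_independent_bound:
  assumes m: "real m * \<tau> \<le> T" and gi: "gradient_independent T f"
  shows "\<exists>C\<ge>0. \<forall>N h a (M :: 'w measure) Y. N \<ge> 1 \<longrightarrow> h > 0 \<longrightarrow> h \<le> 1 \<longrightarrow> spm_draws f b u0 \<tau> N a h m M Y \<longrightarrow>
    (\<integral>\<^sup>+\<omega>. l2_norm_sq (\<lambda>x. U m x - spm_solution f b u0 \<tau> N a h (\<lambda>j i. Y j i \<omega>) m x) \<partial>M)
      \<le> ennreal (exp ((2 * A * Lf\<^sup>2 + 1) * T) * (C * h\<^sup>2 + (\<Sum>j<m. sampling_term N a h M Y j)))"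
proof -
  let ?W = "LINT x|lborel. decay_weight (x::real^'d)"
  let ?\<beta> = "2 * A * Lf\<^sup>2 + 1"
  have "\<forall>j<m. \<exists>K\<ge>0. \<forall>x z. norm (z - x) \<le> real CARD('d) \<longrightarrow>
      \<bar>U (Suc j) z - U (Suc j) x\<bar> \<le> K * norm (z - x) * decay_weight x"
  proof (intro allI impI)
    fix j assume "j < m"
    then have "smooth_decaying (Suc 1) (U (Suc j))"
      using smooth_U[OF time_mono[OF m, of "Suc j"]] by (simp only: numeral_2_eq_2 One_nat_def)
    then obtain K where "K \<ge> 0" "\<And>x z. norm (z - x) \<le> real CARD('d) \<Longrightarrow>
        \<bar>U (Suc j) z - U (Suc j) x\<bar> \<le> K * norm (z - x) * decay_weight x"
      by (rule smooth_decaying_increment_bound[where r = "real CARD('d)"]) (rule that)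
    then show "\<exists>K\<ge>0. \<forall>x z. norm (z - x) \<le> real CARD('d) \<longrightarrow>
      \<bar>U (Suc j) z - U (Suc j) x\<bar> \<le> K * norm (z - x) * decay_weight x" by blast
  qed
  then obtain K where K: "\<And>j. j < m \<Longrightarrow> K j \<ge> 0"
    "\<And>j x z. j < m \<Longrightarrow> norm (z - x) \<le> real CARD('d) \<Longrightarrow>
      \<bar>U (Suc j) z - U (Suc j) x\<bar> \<le> K j * norm (z - x) * decay_weight x"
    by metis
  \<comment> \<open>The projection constant of step j, including the Young factor 1 + 1 / (\<tau>
    Lf^2). It depends on the Lawson-Euler solution and \<tau>, not on N or h.\<close>
  define c where "c j = (1 + 1 / (\<tau> * Lf\<^sup>2)) * (K j * real CARD('d))\<^sup>2 * ?W" for j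
  have c: "c j \<ge> 0" for j
    using \<tau>_pos lborel_integral_decay_weight_nonneg[where 'a = "real^'d"] by (simp add: c_def)
  have \<beta>: "?\<beta> \<ge> 0" using A_gt_1 by simp
  have main: "(\<integral>\<^sup>+\<omega>. l2_norm_sq (\<lambda>x. U m x - spm_solution f b u0 \<tau> N a h (\<lambda>j i. Y j i \<omega>) m x) \<partial>M)
      \<le> ennreal (exp (?\<beta> * T) * ((\<Sum>j<m. c j) * h\<^sup>2 + (\<Sum>j<m. sampling_term N a h M Y j)))"
    if N: "N \<ge> 1" and h: "h > 0" "h \<le> 1" and Y: "spm_draws f b u0 \<tau> N a h m M Y"
    for N h a and M :: "'w measure" and Y
  proof -
    interpret run: spm_run f b u0 T \<tau> A Lf N h a m M Y
      by unfold_locales (fact N h m gi Y)+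
    define R where "R j = sampling_term N a h M Y j + c j * h\<^sup>2" for j
    have R: "R j \<ge> 0" for j
      unfolding R_def using sampling_term_nonneg[OF h(1)] c[of j] by (intro add_nonneg_nonneg) auto
    have "run.error_sq i \<le> ennreal (exp (?\<beta> * (real i * \<tau>)) * (\<Sum>j<i. R j))" if "i \<le> m" for i
      using that
    proof (induction i)
      case 0
      show ?case
        by (simp add: run.error_sq_def run.sol_def spm_solution_def spm_field_def l2_norm_sq_def)
    next
      case (Suc i)
      then have i: "i < m" by simp
      let ?S = "\<Sum>j<i. R j"
      have S: "?S \<ge> 0" using R by (intro sum_nonneg)
      let ?G = "(1 + \<tau> * Lf\<^sup>2) * (1 + \<tau> * Lf)\<^sup>2"
      have "run.error_sq (Suc i) \<le> ennreal ?G * run.error_sq i + ennreal (R i)"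
        using run.error_step[OF i h(2) K(1)[OF i] K(2)[OF i]]
        by (simp add: R_def sampling_term_def c_def)
      also have "\<dots> \<le> ennreal (exp (\<tau> * ?\<beta>)) * ennreal (exp (?\<beta> * (real i * \<tau>)) * ?S) + ennreal (R i)"
        using Suc by (intro add_right_mono mult_mono ennreal_leI growth_factor_le) auto
      also have "\<dots> = ennreal (exp (\<tau> * ?\<beta>) * (exp (?\<beta> * (real i * \<tau>)) * ?S) + R i)"
        using S R by (simp add: ennreal_mult'')
      also have "\<dots> \<le> ennreal (exp (?\<beta> * (real (Suc i) * \<tau>)) * (\<Sum>j<Suc i. R j))"
      proof (rule ennreal_leI)
        have e: "exp (\<tau> * ?\<beta>) * exp (?\<beta> * (real i * \<tau>)) = exp (?\<beta> * (real (Suc i) * \<tau>))"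
          unfolding exp_add[symmetric] by (simp add: algebra_simps)
        have "1 \<le> exp (?\<beta> * (real (Suc i) * \<tau>))" using \<beta> \<tau>_pos by simp
        then have "1 * R i \<le> exp (?\<beta> * (real (Suc i) * \<tau>)) * R i"
          by (intro mult_right_mono R)
        moreover have "exp (\<tau> * ?\<beta>) * (exp (?\<beta> * (real i * \<tau>)) * ?S) = exp (?\<beta> * (real (Suc i) * \<tau>)) * ?S"
          unfolding e[symmetric] by (rule mult.assoc[symmetric])
        ultimately show "exp (\<tau> * ?\<beta>) * (exp (?\<beta> * (real i * \<tau>)) * ?S) + R i
            \<le> exp (?\<beta> * (real (Suc i) * \<tau>)) * (\<Sum>j<Suc i. R j)"
          by (simp only: sum.lessThan_Suc distrib_left)
      qed
      finally show ?case .
    qed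
    from this[of m] have "run.error_sq m \<le> ennreal (exp (?\<beta> * (real m * \<tau>)) * (\<Sum>j<m. R j))" by simp
    also have "\<dots> \<le> ennreal (exp (?\<beta> * T) * (\<Sum>j<m. R j))"
      using \<beta> m R by (intro ennreal_leI mult_right_mono sum_nonneg) (auto intro!: mult_left_mono)
    also have "(\<Sum>j<m. R j) = (\<Sum>j<m. c j) * h\<^sup>2 + (\<Sum>j<m. sampling_term N a h M Y j)"
      by (simp add: R_def sum.distrib sum_distrib_right add.commute)
    finally show ?thesis by (simp only: run.error_sq_def run.sol_def)
  qed
  show ?thesis
  proof (intro exI[of _ "\<Sum>j<m. c j"] conjI allI impI)
  qed (use c in \<open>simp add: sum_nonneg\<close>, rule main)
qed

text \<open>Three regimes, each with its own constant; as all terms are nonnegative, the sum of the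
  constants serves in every regime.\<close>

lemma error_bound:
  assumes m: "real m * \<tau> \<le> T"
  shows "\<exists>C\<ge>0. \<forall>N h a (M :: 'w measure) Y. N \<ge> 1 \<longrightarrow> h > 0 \<longrightarrow> spm_draws f b u0 \<tau> N a h m M Y \<longrightarrow>
    (\<integral>\<^sup>+\<omega>. l2_norm_sq (\<lambda>x. U m x - spm_solution f b u0 \<tau> N a h (\<lambda>j i. Y j i \<omega>) m x) \<partial>M)
      \<le> ennreal (exp ((growth_rate T f A Lf h + 1) * T) * (C * h\<^sup>2 + (\<Sum>j<m. sampling_term N a h M Y j)))"
proof -
  obtain K p where K: "K > 0" "\<And>N h a y. \<lbrakk>N \<ge> 1; h > 0\<rbrakk> \<Longrightarrow>
    l2_norm_sq (\<lambda>x. U m x - spm_solution f b u0 \<tau> N a h y m x) \<le> ennreal (K * (1 + 1 / h) ^ p)"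
    using crude_error_bound[OF m] by metis
  \<comment> \<open>The dependence on the gradient is kept as an implication inside the existential,
    so that one constant can be obtained before the cases are known.\<close>
  have "\<exists>C\<ge>0. gradient_independent T f \<longrightarrow> (\<forall>N h a (M :: 'w measure) Y. N \<ge> 1 \<longrightarrow> h > 0 \<longrightarrow> h \<le> 1 \<longrightarrow>
    spm_draws f b u0 \<tau> N a h m M Y \<longrightarrow>
    (\<integral>\<^sup>+\<omega>. l2_norm_sq (\<lambda>x. U m x - spm_solution f b u0 \<tau> N a h (\<lambda>j i. Y j i \<omega>) m x) \<partial>M)
      \<le> ennreal (exp ((2 * A * Lf\<^sup>2 + 1) * T) * (C * h\<^sup>2 + (\<Sum>j<m. sampling_term N a h M Y j))))"
  proof (cases "gradient_independent T f")
    case True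
    show ?thesis using gradient_independent_bound[OF m True, where 'w = 'w] by (simp only: True simp_thms)
  next
    case False
    then show ?thesis by (intro exI[of _ 0] conjI impI) simp_all
  qed
  then obtain C1 where C1': "0 \<le> C1 \<and> (gradient_independent T f \<longrightarrow> (\<forall>N h a (M :: 'w measure) Y. N \<ge> 1 \<longrightarrow> h > 0 \<longrightarrow> h \<le> 1 \<longrightarrow>
    spm_draws f b u0 \<tau> N a h m M Y \<longrightarrow>
    (\<integral>\<^sup>+\<omega>. l2_norm_sq (\<lambda>x. U m x - spm_solution f b u0 \<tau> N a h (\<lambda>j i. Y j i \<omega>) m x) \<partial>M)
      \<le> ennreal (exp ((2 * A * Lf\<^sup>2 + 1) * T) * (C1 * h\<^sup>2 + (\<Sum>j<m. sampling_term N a h M Y j)))))" ..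
  note C1 = C1'[THEN conjunct1] and fine = C1'[THEN conjunct2, rule_format]
  \<comment> \<open>The coefficient of 1 / h^2 in \<open>growth_rate\<close> times T for f depending
    on the gradient; the rest of the exponent is nonnegative.\<close>
  define c where "c = 4 * A * Lf\<^sup>2 * T"
  have c: "c > 0" using A_gt_1 Lf_pos T_pos by (simp add: c_def)
  \<comment> \<open>For h \<ge> 1, both 1 + 1 / h \<le> 2 and 1 \<le> h^2. \<open>C3\<close> is the
    constant of \<open>exp_beats_power\<close>, for h \<le> 1.\<close>
  define C2 where "C2 = K * 2 ^ p"
  define C3 where "C3 = K * 2 ^ p * fact (Suc p) / c ^ Suc p"
  have C2: "C2 \<ge> 0" and C3: "C3 \<ge> 0" using K(1) c by (simp_all add: C2_def C3_def)
  have main: "(\<integral>\<^sup>+\<omega>. l2_norm_sq (\<lambda>x. U m x - spm_solution f b u0 \<tau> N a h (\<lambda>j i. Y j i \<omega>) m x) \<partial>M)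
      \<le> ennreal (exp ((growth_rate T f A Lf h + 1) * T) * ((C1 + C2 + C3) * h\<^sup>2 + (\<Sum>j<m. sampling_term N a h M Y j)))"
    if N: "N \<ge> 1" and h: "h > 0" and Y: "spm_draws f b u0 \<tau> N a h m M Y"
    for N h a and M :: "'w measure" and Y
  proof -
    let ?E = "exp ((growth_rate T f A Lf h + 1) * T)"
    let ?s = "\<Sum>j<m. sampling_term N a h M Y j"
    let ?err = "\<integral>\<^sup>+\<omega>. l2_norm_sq (\<lambda>x. U m x - spm_solution f b u0 \<tau> N a h (\<lambda>j i. Y j i \<omega>) m x) \<partial>M"
    interpret prob_space M using Y by (simp add: spm_draws_def)
    have s: "?s \<ge> 0" using sampling_term_nonneg[OF h] by (intro sum_nonneg)
    have gr: "growth_rate T f A Lf h \<ge> 0" using A_gt_1 h by (simp add: growth_rate_def)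
    have "?err \<le> (\<integral>\<^sup>+\<omega>. ennreal (K * (1 + 1 / h) ^ p) \<partial>M)"
      by (intro nn_integral_mono K(2) N h)
    then have crude: "?err \<le> ennreal (K * (1 + 1 / h) ^ p)" by (simp add: emeasure_space_1)
    consider "1 \<le> h" | "h \<le> 1" "gradient_independent T f" | "h \<le> 1" "\<not> gradient_independent T f" by linarith
    then show ?thesis
    proof cases
      case 1
      have "K * (1 + 1 / h) ^ p \<le> K * 2 ^ p * 1"
        using 1 K(1) by (auto intro!: mult_left_mono power_mono)
      also have "\<dots> \<le> C2 * h\<^sup>2"
        using 1 C2 unfolding C2_def[symmetric] by (intro mult_left_mono one_le_power)
      also have "\<dots> \<le> 1 * ((C1 + C2 + C3) * h\<^sup>2 + ?s)"
        using C1 C3 s by (simp add: distrib_right)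
      also have "\<dots> \<le> ?E * ((C1 + C2 + C3) * h\<^sup>2 + ?s)"
        using gr T_pos C1 C2 C3 s by (intro mult_right_mono) auto
      finally show ?thesis using crude by (meson ennreal_leI order_trans)
    next
      case 2
      have "exp ((2 * A * Lf\<^sup>2 + 1) * T) * (C1 * h\<^sup>2 + ?s) \<le> ?E * ((C1 + C2 + C3) * h\<^sup>2 + ?s)"
        using 2 C1 C2 C3 s by (intro mult_mono) (auto simp: growth_rate_def distrib_right)
      then show ?thesis using fine[OF 2(2) N h 2(1) Y] by (meson ennreal_leI order_trans)
    next
      case 3
      have "K * (1 + 1 / h) ^ p \<le> exp (c / h\<^sup>2) * (C3 * h\<^sup>2)"
        unfolding C3_def by (rule exp_beats_power[OF c h 3(1) less_imp_le[OF K(1)]])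
      also have "\<dots> \<le> ?E * ((C1 + C2 + C3) * h\<^sup>2 + ?s)"
      proof (rule mult_mono)
        have "(growth_rate T f A Lf h + 1) * T = c / h\<^sup>2 + (2 * A * Lf\<^sup>2 + 1) * T"
          using 3 h by (simp add: growth_rate_def c_def field_simps)
        moreover have "(2 * A * Lf\<^sup>2 + 1) * T \<ge> 0" using A_gt_1 T_pos by simp
        ultimately show "exp (c / h\<^sup>2) \<le> ?E" by simp
      qed (use C1 C2 C3 s in \<open>auto simp: distrib_right\<close>)
      finally show ?thesis using crude by (meson ennreal_leI order_trans)
    qed
  qed
  show ?thesis
  proof (intro exI[of _ "C1 + C2 + C3"] conjI allI impI)
  qed (use C1 C2 C3 in simp, rule main)
qed

end

theorem theorem1:
  fixes f :: "'d::finite nonlinearity"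
    and b :: "real ^ 'd"
    and u0 :: "real ^ 'd \<Rightarrow> real"
    and u :: "real \<Rightarrow> real ^ 'd \<Rightarrow> real"
    and T \<tau> A Lf :: real
  assumes "T > 0"
    and "in_L2 u0"
    and f_measurable: "\<And>t. t \<in> {0..T} \<Longrightarrow> (\<lambda>(x, r, v). f t x r v) \<in> borel_measurable borel"
    and A1: "Lf > 0" "lipschitz_nonlinearity T Lf f"
    and A2_exact: "cauchy_solution f b u0 T u" "\<And>t. t \<in> {0..T} \<Longrightarrow> smooth_decaying 2 (u t)"
    and A2_lawson_euler:
      "\<And>m. real m * \<tau> \<le> T \<Longrightarrow> smooth_decaying 2 (lawson_euler f b u0 \<tau> m)"
      "\<And>m. real m * \<tau> \<le> T \<Longrightarrow>
         smooth_decaying 2 (source f (real m * \<tau>) (lawson_euler f b u0 \<tau> m))"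
    and "A > 1" and "\<tau> > 0" and "\<tau> \<le> A - 1"
  shows "\<exists>C1>0. \<forall>(N::nat) (h::real) (a::real ^ 'd) (m::nat) (M::'w measure) Y.
    N \<ge> 1 \<longrightarrow> h > 0 \<longrightarrow> real m * \<tau> \<le> T \<longrightarrow> spm_draws f b u0 \<tau> N a h m M Y \<longrightarrow>
    (\<integral>\<^sup>+ \<omega>. l2_norm_sq (\<lambda>x. lawson_euler f b u0 \<tau> m x
                              - spm_solution f b u0 \<tau> N a h (\<lambda>j i. Y j i \<omega>) m x) \<partial>M)
    \<le> ennreal (exp ((growth_rate T f A Lf h + 1) * T) *
        (A * C1 * h\<^sup>2 +
         (\<Sum>j<m. (LINT \<omega>|M. (spm_Z f b u0 \<tau> N a h (\<lambda>k i. Y k i \<omega>) j)\<^sup>2)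
                    / (real N * h ^ CARD('d))
                  + (sqrt (real CARD('d)) / pi)\<^sup>2 * h1_seminorm_sq (lawson_euler f b u0 \<tau> j) * h\<^sup>2)))"
proof -
  interpret spm_problem f b u0 T \<tau> A Lf
    by unfold_locales (rule assms; assumption?)+
  have "\<forall>m. \<exists>C\<ge>0. real m * \<tau> \<le> T \<longrightarrow> (\<forall>N h a (M :: 'w measure) Y. N \<ge> 1 \<longrightarrow> h > 0 \<longrightarrow>
    spm_draws f b u0 \<tau> N a h m M Y \<longrightarrow>
    (\<integral>\<^sup>+\<omega>. l2_norm_sq (\<lambda>x. U m x - spm_solution f b u0 \<tau> N a h (\<lambda>j i. Y j i \<omega>) m x) \<partial>M)
      \<le> ennreal (exp ((growth_rate T f A Lf h + 1) * T) * (C * h\<^sup>2 + (\<Sum>j<m. sampling_term N a h M Y j))))"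
  proof
    fix m
    show "\<exists>C\<ge>0. real m * \<tau> \<le> T \<longrightarrow> (\<forall>N h a (M :: 'w measure) Y. N \<ge> 1 \<longrightarrow> h > 0 \<longrightarrow>
    spm_draws f b u0 \<tau> N a h m M Y \<longrightarrow>
    (\<integral>\<^sup>+\<omega>. l2_norm_sq (\<lambda>x. U m x - spm_solution f b u0 \<tau> N a h (\<lambda>j i. Y j i \<omega>) m x) \<partial>M)
      \<le> ennreal (exp ((growth_rate T f A Lf h + 1) * T) * (C * h\<^sup>2 + (\<Sum>j<m. sampling_term N a h M Y j))))"
    proof (cases "real m * \<tau> \<le> T")
      case True
      show ?thesis using error_bound[OF True, where 'w = 'w] by (simp only: True simp_thms)
    next
      case False
      then show ?thesis by (intro exI[of _ 0] conjI impI) simp_all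
    qed
  qed
  from choice[OF this] obtain C where C: "\<forall>m. 0 \<le> C m \<and> (real m * \<tau> \<le> T \<longrightarrow> (\<forall>N h a (M :: 'w measure) Y. N \<ge> 1 \<longrightarrow> h > 0 \<longrightarrow>
    spm_draws f b u0 \<tau> N a h m M Y \<longrightarrow>
    (\<integral>\<^sup>+\<omega>. l2_norm_sq (\<lambda>x. U m x - spm_solution f b u0 \<tau> N a h (\<lambda>j i. Y j i \<omega>) m x) \<partial>M)
      \<le> ennreal (exp ((growth_rate T f A Lf h + 1) * T) * (C m * h\<^sup>2 + (\<Sum>j<m. sampling_term N a h M Y j)))))" ..
  note C_nonneg = C[THEN spec, THEN conjunct1] and bound = C[THEN spec, THEN conjunct2, rule_format]
  \<comment> \<open>\<open>C m\<close> depends on m, but only indices up to T / \<tau> occur, and a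
    finite sum of nonnegative constants dominates each of them. The 1 makes \<open>C1\<close>
    strictly positive.\<close>
  define C1 where "C1 = 1 + (\<Sum>m\<le>nat \<lfloor>T / \<tau>\<rfloor>. C m)"
  have C1: "C1 > 0" using C_nonneg by (auto simp: C1_def intro!: add_pos_nonneg sum_nonneg)
  show ?thesis
  proof (intro exI[of _ C1] conjI C1 allI impI)
    fix N :: nat and h :: real and a :: "real ^ 'd" and m :: nat and M :: "'w measure" and Y
    assume N: "N \<ge> 1" and h: "h > 0" and m: "real m * \<tau> \<le> T" and Y: "spm_draws f b u0 \<tau> N a h m M Y"
    let ?r = "\<lambda>j. (sqrt (real CARD('d)) / pi)\<^sup>2 * h1_seminorm_sq (U j) * h\<^sup>2"
    \<comment> \<open>The projection error is already contained in the term with \<open>C1\<close>;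
      the H1 terms are nonnegative and can be added to the bound.\<close>
    have r: "?r j \<ge> 0" for j by (simp add: h1_seminorm_sq_def)
    have "m \<le> nat \<lfloor>T / \<tau>\<rfloor>"
      using m \<tau>_pos by (simp add: le_nat_floor pos_le_divide_eq)
    then have "C m \<le> C1"
      unfolding C1_def using member_le_sum[of m "{..nat \<lfloor>T / \<tau>\<rfloor>}" C] C_nonneg by simp
    also have "C1 \<le> A * C1" using A_gt_1 C1 by simp
    finally have "C m * h\<^sup>2 \<le> A * C1 * h\<^sup>2" by (intro mult_right_mono) auto
    moreover have "(\<Sum>j<m. sampling_term N a h M Y j) \<le> (\<Sum>j<m. sampling_term N a h M Y j + ?r j)"
      using r by (intro sum_mono) simp
    ultimately have "exp ((growth_rate T f A Lf h + 1) * T) * (C m * h\<^sup>2 + (\<Sum>j<m. sampling_term N a h M Y j))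
      \<le> exp ((growth_rate T f A Lf h + 1) * T) * (A * C1 * h\<^sup>2 + (\<Sum>j<m. sampling_term N a h M Y j + ?r j))"
      by (intro mult_left_mono add_mono) auto
    then show "(\<integral>\<^sup>+ \<omega>. l2_norm_sq (\<lambda>x. U m x - spm_solution f b u0 \<tau> N a h (\<lambda>j i. Y j i \<omega>) m x) \<partial>M)
    \<le> ennreal (exp ((growth_rate T f A Lf h + 1) * T) *
        (A * C1 * h\<^sup>2 +
         (\<Sum>j<m. (LINT \<omega>|M. (spm_Z f b u0 \<tau> N a h (\<lambda>k i. Y k i \<omega>) j)\<^sup>2)
                    / (real N * h ^ CARD('d)) + ?r j)))"
      unfolding sampling_term_def[symmetric] using bound[OF m N h Y] by (meson ennreal_leI order_trans)
  qed
qed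

end
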